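(* Let $n\ge1$, let $\mu$ be a partition with $\ell(\mu)\le n$ and $\mu'_1+\mu'_2\le n$, let $\lambda$ be a partition with $\ell(\lambda)\le n$, and let $\delta\in\mathscr P^{(2)}_n$ be a partition of length $\le n$ with all parts even. Then the bijection $\psi:\mathtt{LR}^{\lambda'}_{\delta'\mu'}\to\mathtt{LR}^{\lambda}_{\delta\mu^\pi}$ (defined in the context) restricts to a bijection from $\overline{\mathtt{LR}}^{\lambda'}_{\delta'\mu'}$ onto $\underline{\mathtt{LR}}^{\lambda}_{\delta\mu}$.
   Context: Tableaux. $SST(\cdot)$ is the set of semistandard tableaux of given (skew) shape with positive integer entries. $w(T)$ is the word reading columns right to left, each from top to bottom. $a\to T$ is column insertion of $a$ (start with the leftmost column; $a$ replaces the smallest entry $\ge a$, which is inserted in the next column; if no such entry exists $a$ is added at the bottom). For $w(S)=w_1\cdots w_k$, $(S\to T)=(w_k\to(\cdots\to(w_1\to T)))$. $H_\nu\in SST(\nu)$ has all entries in row $i$ equal to $i$. $\mathrm{sh}$ denotes shape, $'$ conjugation, and $\mu^\pi$ is the diagram of $\mu$ rotated by $180^\circ$. Set $\mathtt{LR}^{\lambda'}_{\delta'\mu'}=\{S\in SST(\mu'):(S\to H_{\delta'})=H_{\lambda'}\}$ and $\mathtt{LR}^{\lambda}_{\delta\mu^\pi}=\{U\in SST(\mu^\pi):(U\to H_\delta)=H_\lambda\}$. Put $p=\mu'_1$, $q=\mu'_2$, and $r=p$ if $n-2\mu'_1\ge0$, $r=n-\mu'_1$ if $n-2\mu'_1<0$.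 Write $\delta=(\delta_1,\dots,\delta_n)$, $\delta^{\mathrm{rev}}_k=\delta_{n-k+1}$. The map $\psi$: for $S\in\mathtt{LR}^{\lambda'}_{\delta'\mu'}$ let $S^1,\dots,S^p$ be its columns from the right, $H^0=H_{\delta'}$, $H^i=(S^i\to H^{i-1})$; let $Q(S\to H_{\delta'})\in SST(\lambda/\delta)$ be the tableau in which $\mathrm{sh}(H^i)'/\mathrm{sh}(H^{i-1})'$ is filled with $i$, $1\le i\le p$. For $U\in\mathtt{LR}^{\lambda}_{\delta\mu^\pi}$ let $U_1,\dots,U_p$ be its rows from the top, $H_0=H_\delta$, $H_i=(U_i\to H_{i-1})$, and let $Q(U\to H_\delta)$ be the tableau in which $\mathrm{sh}(H_i)/\mathrm{sh}(H_{i-1})$ is filled with $i$. For each $S$ there is a unique $U\in\mathtt{LR}^{\lambda}_{\delta\mu^\pi}$ with $Q(U\to H_\delta)=Q(S\to H_{\delta'})$; put $\psi(S)=U$. This $\psi$ is a bijection. $\overline{\mathtt{LR}}^{\lambda'}_{\delta'\mu'}$: for $S\in\mathtt{LR}^{\lambda'}_{\delta'\mu'}$ let $s_1\le\dots\le s_p$ and $t_1\le\dots\le t_q$ be its first and second rows. Define $m_p,\dots,m_1$ inductively (from $p$ down to $1$) by $m_i=\max\{k\in K_i:\delta^{\mathrm{rev}}_k<s_i\}$, where $K_i=\{i,\dots,2i-1\}\setminus\{m_{i+1},\dots,m_p\}$ if $1\le i\le r$ and $K_i=\{i,\dots,n-p+i\}\setminus\{m_{i+1},\dots,m_p\}$ if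 $r<i\le p$. Let $n_j$ be the $j$-th smallest integer in $\{j+1,\dots,n\}\setminus\{m_{j+1},\dots,m_p\}$, $1\le j\le q$. Then $S\in\overline{\mathtt{LR}}^{\lambda'}_{\delta'\mu'}$ iff $t_j>\delta^{\mathrm{rev}}_{n_j}$ for all $1\le j\le q$. $\underline{\mathtt{LR}}^{\lambda}_{\delta\mu}$: for $U\in\mathtt{LR}^{\lambda}_{\delta\mu^\pi}$ let $\sigma_1>\dots>\sigma_p$ be the entries of the rightmost column and $\tau_1>\dots>\tau_q$ those of the second rightmost column. Let $m_i=\min\{n-\sigma_i+1,2i-1\}$ for $1\le i\le r$, $m_i=\min\{n-\sigma_i+1,n-p+i\}$ for $r<i\le p$, and let $n_j$ be the $j$-th smallest number in $\{j+1,\dots,n\}\setminus\{m_{j+1},\dots,m_p\}$. Then $U\in\underline{\mathtt{LR}}^{\lambda}_{\delta\mu}$ iff $\tau_j+n_j\le n+1$ for all $1\le j\le q$. *)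

theory Defs
  imports Main
begin

text \<open>Partitions are lists of positive parts in weakly decreasing order, so that the length of the
  list is the length of the partition. Parts, rows and columns are numbered from 1, and
  \<open>part \<nu> i = 0\<close> for every \<open>i\<close> outside \<open>{1..length \<nu>}\<close>.\<close>

definition is_partition :: "nat list \<Rightarrow> bool" where
  "is_partition \<nu> \<longleftrightarrow> sorted_wrt (\<ge>) \<nu> \<and> 0 \<notin> set \<nu>"

definition part :: "nat list \<Rightarrow> nat \<Rightarrow> nat" where
  "part \<nu> i = (if 1 \<le> i \<and> i \<le> length \<nu> then \<nu> ! (i - 1) else 0)"

definition conjugate :: "nat list \<Rightarrow> nat list" where
  "conjugate \<nu> = map (\<lambda>j. length (filter (\<lambda>x. j \<le> x) \<nu>)) [1..<Suc (part \<nu> 1)]"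

text \<open>A box is a pair (row, column).\<close>

definition diagram :: "nat list \<Rightarrow> (nat \<times> nat) set" where
  "diagram \<nu> = {(i, j). 1 \<le> i \<and> 1 \<le> j \<and> j \<le> part \<nu> i}"

text \<open>The rotated diagram is placed in the rectangle with \<open>\<mu>'\<^sub>1\<close> rows and \<open>\<mu>\<^sub>1\<close> columns.\<close>

definition rot_diagram :: "nat list \<Rightarrow> (nat \<times> nat) set" where
  "rot_diagram \<mu> = (\<lambda>(i, j). (length \<mu> + 1 - i, part \<mu> 1 + 1 - j)) ` diagram \<mu>"

text \<open>A tableau has positive entries on its shape and the value 0 elsewhere.\<close>

type_synonym tableau = "nat \<times> nat \<Rightarrow> nat"

definition shape :: "tableau \<Rightarrow> (nat \<times> nat) set" where
  "shape T = {b. T b \<noteq> 0}"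

definition SST :: "(nat \<times> nat) set \<Rightarrow> tableau set" where
  "SST D = {T. shape T = D
     \<and> (\<forall>i j j'. (i, j) \<in> D \<and> (i, j') \<in> D \<and> j < j' \<longrightarrow> T (i, j) \<le> T (i, j'))
     \<and> (\<forall>i i' j. (i, j) \<in> D \<and> (i', j) \<in> D \<and> i < i' \<longrightarrow> T (i, j) < T (i', j))}"

definition H_tab :: "nat list \<Rightarrow> tableau" where
  "H_tab \<nu> = (\<lambda>(i, j). if (i, j) \<in> diagram \<nu> then i else 0)"

definition restrict_tab :: "tableau \<Rightarrow> (nat \<times> nat) set \<Rightarrow> tableau" where
  "restrict_tab T B = (\<lambda>b. if b \<in> B then T b else 0)"

definition column :: "tableau \<Rightarrow> nat \<Rightarrow> nat list" where
  "column T j = map (\<lambda>i. T (i, j)) (sorted_list_of_set {i. (i, j) \<in> shape T})"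

definition columns :: "tableau \<Rightarrow> nat list list" where
  "columns T = map (column T) [1..<Suc (Max (insert 0 (snd ` shape T)))]"

text \<open>Inverse of \<open>columns\<close> on tableaux whose columns are all top-justified.\<close>

definition of_columns :: "nat list list \<Rightarrow> tableau" where
  "of_columns Cs = (\<lambda>(i, j).
     if 1 \<le> j \<and> j \<le> length Cs \<and> 1 \<le> i \<and> i \<le> length (Cs ! (j - 1))
     then Cs ! (j - 1) ! (i - 1) else 0)"

definition word :: "tableau \<Rightarrow> nat list" where
  "word T = concat (rev (columns T))"

text \<open>Columns are strictly increasing from top to bottom, so the first entry \<open>\<ge> a\<close> is the smallest
  one. The second component is the entry that is bumped out, if any.\<close>

fun bump :: "nat \<Rightarrow> nat list \<Rightarrow> nat list \<times> nat option" where
  "bump a [] = ([a], None)"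
| "bump a (x # xs) =
     (if a \<le> x then (a # xs, Some x)
      else (case bump a xs of (ys, b) \<Rightarrow> (x # ys, b)))"

fun insert_columns :: "nat \<Rightarrow> nat list list \<Rightarrow> nat list list" where
  "insert_columns a [] = [[a]]"
| "insert_columns a (C # Cs) =
     (case bump a C of
        (C', None) \<Rightarrow> C' # Cs
      | (C', Some b) \<Rightarrow> C' # insert_columns b Cs)"

definition col_insert :: "nat \<Rightarrow> tableau \<Rightarrow> tableau" where
  "col_insert a T = of_columns (insert_columns a (columns T))"

text \<open>\<open>tab_insert S T\<close> is \<open>S \<rightarrow> T\<close>; \<open>fold\<close> inserts the first letter of the word first.\<close>

definition tab_insert :: "tableau \<Rightarrow> tableau \<Rightarrow> tableau" where
  "tab_insert S T = fold col_insert (word S) T"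

text \<open>The third partition \<open>lam\<close> is the \<open>\<lambda>\<close> of the tableau sets; the second lower index, a partition
  or a rotated partition, is given by its diagram \<open>D\<close>.\<close>

definition LR :: "(nat \<times> nat) set \<Rightarrow> nat list \<Rightarrow> nat list \<Rightarrow> tableau set" where
  "LR D \<delta> lam = {T \<in> SST D. tab_insert T (H_tab \<delta>) = H_tab lam}"

abbreviation LR_conj :: "nat list \<Rightarrow> nat list \<Rightarrow> nat list \<Rightarrow> tableau set" where
  "LR_conj lam \<delta> \<mu> \<equiv> LR (diagram (conjugate \<mu>)) (conjugate \<delta>) (conjugate lam)"

abbreviation LR_rot :: "nat list \<Rightarrow> nat list \<Rightarrow> nat list \<Rightarrow> tableau set" where
  "LR_rot lam \<delta> \<mu> \<equiv> LR (rot_diagram \<mu>) \<delta> lam"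

text \<open>\<open>insert_chain P H i\<close> inserts the pieces \<open>P 1, \<dots>, P i\<close> successively into \<open>H\<close>.\<close>

primrec insert_chain :: "(nat \<Rightarrow> tableau) \<Rightarrow> tableau \<Rightarrow> nat \<Rightarrow> tableau" where
  "insert_chain P H 0 = H"
| "insert_chain P H (Suc i) = tab_insert (P (Suc i)) (insert_chain P H i)"

definition recording :: "nat \<Rightarrow> (nat \<Rightarrow> (nat \<times> nat) set) \<Rightarrow> tableau" where
  "recording p D = (\<lambda>b.
     if \<exists>i\<in>{1..p}. b \<in> D i - D (i - 1)
     then (THE i. i \<in> {1..p} \<and> b \<in> D i - D (i - 1)) else 0)"

text \<open>Below \<open>p = \<mu>'\<^sub>1\<close>, which is both the number of columns of \<open>S\<close> and the number of rows of \<open>U\<close>.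
  As diagrams are relations, \<open>converse\<close> is conjugation.\<close>

definition Q_conj :: "nat list \<Rightarrow> nat list \<Rightarrow> tableau \<Rightarrow> tableau" where
  "Q_conj \<delta> \<mu> S = (let p = part (conjugate \<mu>) 1 in
     recording p (\<lambda>i. converse (shape
       (insert_chain (\<lambda>k. restrict_tab S {b. snd b = p + 1 - k}) (H_tab (conjugate \<delta>)) i))))"

definition Q_rot :: "nat list \<Rightarrow> nat list \<Rightarrow> tableau \<Rightarrow> tableau" where
  "Q_rot \<delta> \<mu> U = (let p = part (conjugate \<mu>) 1 in
     recording p (\<lambda>i. shape
       (insert_chain (\<lambda>k. restrict_tab U {b. fst b = k}) (H_tab \<delta>) i)))"

definition psi :: "nat list \<Rightarrow> nat list \<Rightarrow> nat list \<Rightarrow> tableau \<Rightarrow> tableau" where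
  "psi lam \<delta> \<mu> S = (THE U. U \<in> LR_rot lam \<delta> \<mu> \<and> Q_rot \<delta> \<mu> U = Q_conj \<delta> \<mu> S)"

definition rev_part :: "nat \<Rightarrow> nat list \<Rightarrow> nat \<Rightarrow> nat" where
  "rev_part n \<delta> k = part \<delta> (n + 1 - k)"

text \<open>The largest element of \<open>K\<^sub>i\<close> before removing the indices already used; the first case is
  \<open>i \<le> r\<close>, with \<open>r = p\<close> if \<open>n - 2 p \<ge> 0\<close> and \<open>r = n - p\<close> otherwise.\<close>

definition upper :: "nat \<Rightarrow> nat \<Rightarrow> nat \<Rightarrow> nat" where
  "upper n p i =
     (let r = (if 2 * p \<le> n then p else n - p) in if i \<le> r then 2 * i - 1 else n - p + i)"

function m_over :: "nat \<Rightarrow> nat \<Rightarrow> nat list \<Rightarrow> tableau \<Rightarrow> nat \<Rightarrow> nat" where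
  "m_over n p \<delta> S i =
     Max {k \<in> {i..upper n p i} - m_over n p \<delta> S ` {i + 1..p}. rev_part n \<delta> k < S (1, i)}"
  by pat_completeness auto
termination
  by (relation "measure (\<lambda>(n, p, \<delta>, S, i). p + 1 - i)") auto

declare m_over.simps [simp del]

text \<open>The entries of the rightmost column of \<open>U\<close>, listed in decreasing order, are read from the
  bottom row \<open>p\<close> upwards: \<open>\<sigma>\<^sub>i = U (p + 1 - i, \<mu>\<^sub>1)\<close>; likewise \<open>\<tau>\<^sub>j = U (p + 1 - j, \<mu>\<^sub>1 - 1)\<close>.\<close>

definition m_under :: "nat \<Rightarrow> nat \<Rightarrow> nat list \<Rightarrow> tableau \<Rightarrow> nat \<Rightarrow> nat" where
  "m_under n p \<mu> U i = min (n + 1 - U (p + 1 - i, part \<mu> 1)) (upper n p i)"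

definition jth_smallest :: "nat \<Rightarrow> nat set \<Rightarrow> nat" where
  "jth_smallest j A = sorted_list_of_set A ! (j - 1)"

definition n_index :: "nat \<Rightarrow> nat \<Rightarrow> (nat \<Rightarrow> nat) \<Rightarrow> nat \<Rightarrow> nat" where
  "n_index n p m j = jth_smallest j ({j + 1..n} - m ` {j + 1..p})"

definition LR_over :: "nat \<Rightarrow> nat list \<Rightarrow> nat list \<Rightarrow> nat list \<Rightarrow> tableau set" where
  "LR_over n lam \<delta> \<mu> = {S \<in> LR_conj lam \<delta> \<mu>.
     let p = part (conjugate \<mu>) 1; q = part (conjugate \<mu>) 2 in
     \<forall>j\<in>{1..q}. S (2, j) > rev_part n \<delta> (n_index n p (m_over n p \<delta> S) j)}"

definition LR_under :: "nat \<Rightarrow> nat list \<Rightarrow> nat list \<Rightarrow> nat list \<Rightarrow> tableau set" where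
  "LR_under n lam \<delta> \<mu> = {U \<in> LR_rot lam \<delta> \<mu>.
     let p = part (conjugate \<mu>) 1; q = part (conjugate \<mu>) 2 in
     \<forall>j\<in>{1..q}. U (p + 1 - j, part \<mu> 1 - 1) + n_index n p (m_under n p \<mu> U) j \<le> n + 1}"

end

theory Submission
  imports Defs
begin

text \<open>A letter \<open>a\<close> inserted into \<open>H\<^sub>\<nu>\<close> passes unchanged through the columns of length at least \<open>a\<close>
  and lands below the first shorter one. Either this adds a box to row \<open>a\<close> and gives \<open>H\<close> of a larger
  partition, or it leaves a column that is not an interval \<open>1, \<dots>, l\<close>; such a defect is never repaired
  by later insertions (\<open>insert_columns_bad\<close>). Membership in an \<open>LR\<close> set therefore means that the
  contents of the last columns of the tableau keep adding up with \<open>\<nu>\<close> to a partition (\<open>LR_iff\<close>).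

  Hence \<open>S\<close> and \<open>U\<close> both amount to a chain of partitions from \<open>\<delta>\<close> to \<open>\<lambda>\<close> whose \<open>k\<close>-th step is a
  horizontal strip: column \<open>p + 1 - k\<close> of \<open>S\<close> lists the columns of the boxes of the strip, and row \<open>k\<close>
  of \<open>U\<close> lists their rows. The tableau \<open>S\<close> is semistandard iff among the first \<open>x\<close> columns strip
  \<open>k + 1\<close> has at least as many boxes as strip \<open>k\<close>, and \<open>U\<close> is semistandard iff strip \<open>k + 1\<close> has at
  least as many boxes strictly below row \<open>a\<close> as strip \<open>k\<close> has weakly below it. These two conditions
  agree (\<open>head_lattice_iff_tail_lattice\<close>), and either tableau can be rebuilt from the chain, so \<open>\<psi>\<close>
  is a bijection.

  For the restriction, the \<open>l\<close>-th box of strip \<open>k\<close> from the left lies in column \<open>S (l, p + 1 - k)\<close>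
  and in row \<open>U (k, \<mu>\<^sub>1 + 1 - l)\<close> (\<open>box_of_entries\<close>). A box of the same column that is higher up but
  outside \<open>\<delta>\<close> is the \<open>l'\<close>-th box of an earlier strip, with \<open>l' \<le> l\<close> (\<open>box_above_entry\<close>). The case
  \<open>l = 1\<close> shows that both definitions of the indices \<open>m\<^sub>i\<close> give the same numbers (\<open>Max_m\<close>): an
  index of the range for \<open>m\<^sub>i\<close> that exceeds \<open>n + 1 - \<sigma>\<^sub>i\<close> but passes the comparison with \<open>s\<^sub>i\<close> is some
  \<open>m\<^sub>j\<close> with \<open>j > i\<close>. The case
  \<open>l = 2\<close> compares the inequalities for \<open>t\<^sub>j\<close> and \<open>\<tau>\<^sub>j\<close> by induction from \<open>j = q\<close> downwards
  (\<open>over_iff_under\<close>).\<close>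

section \<open>Column insertion into highest weight tableaux\<close>

definition parts_ge :: "nat list \<Rightarrow> nat \<Rightarrow> nat" where
  "parts_ge ls a = length (filter (\<lambda>l. a \<le> l) ls)"

lemma le_parts_ge_iff:
  assumes "sorted_wrt (\<ge>) ls" "1 \<le> j" "1 \<le> a"
  shows "j \<le> parts_ge ls a \<longleftrightarrow> a \<le> part ls j"
  using assms
proof (induction ls arbitrary: j)
  case Nil
  then show ?case by (simp add: parts_ge_def part_def)
next
  case (Cons l ls)
  show ?case
  proof (cases "a \<le> l")
    case True
    show ?thesis
    proof (cases "j = 1")
      case True
      then show ?thesis using \<open>a \<le> l\<close> by (simp add: parts_ge_def part_def)
    next
      case False
      then have "j - 1 \<le> parts_ge ls a \<longleftrightarrow> a \<le> part ls (j - 1)"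
        using Cons by simp
      moreover have "part (l # ls) j = part ls (j - 1)"
        using False Cons.prems by (auto simp: part_def nth_Cons')
      ultimately show ?thesis using True False by (auto simp: parts_ge_def)
    qed
  next
    case False
    then have "filter (\<lambda>l. a \<le> l) (l # ls) = []"
      using Cons.prems(1) by (auto simp: filter_empty_conv)
    moreover have "part (l # ls) j \<le> l"
      using Cons.prems(1,2) by (auto simp: part_def nth_Cons')
    ultimately show ?thesis using False Cons.prems by (simp add: parts_ge_def)
  qed
qed

lemma parts_ge_eq_0: "(\<And>l. l \<in> set ls \<Longrightarrow> l < a) \<Longrightarrow> parts_ge ls a = 0"
  by (auto simp: parts_ge_def filter_empty_conv not_le)

text \<open>The columns of the highest weight tableau with column lengths \<open>ls\<close>; the predicate \<open>interval_col\<close>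
  singles out the columns that occur in such tableaux.\<close>

definition init_cols :: "nat list \<Rightarrow> nat list list" where
  "init_cols ls = map (\<lambda>l. [1..<Suc l]) ls"

definition interval_col :: "nat list \<Rightarrow> bool" where
  "interval_col C \<longleftrightarrow> C = [1..<Suc (length C)]"

definition le_count :: "nat list \<Rightarrow> nat \<Rightarrow> nat" where
  "le_count C x = length (filter (\<lambda>y. y \<le> x) C)"

definition dominates :: "nat list \<Rightarrow> nat list \<Rightarrow> bool" where
  "dominates C C' \<longleftrightarrow> (\<forall>x. le_count C' x \<le> le_count C x)"

text \<open>For strictly increasing columns, \<open>dominates\<close> says at once that the second column is not longer
  and that the rows increase weakly. Unlike a comparison of entries, a comparison of counts needs no
  case distinction when an entry moves from one column to the next.\<close>

fun semistd :: "nat list list \<Rightarrow> bool" where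
  "semistd [] \<longleftrightarrow> True"
| "semistd (C # Cs) \<longleftrightarrow> C \<noteq> [] \<and> 0 \<notin> set C \<and> sorted_wrt (<) C
     \<and> (case Cs of [] \<Rightarrow> True | C' # _ \<Rightarrow> dominates C C') \<and> semistd Cs"

lemma bump_None:
  "bump a C = (C', None) \<Longrightarrow> C' = C @ [a] \<and> (\<forall>x\<in>set C. x < a)"
  by (induction C arbitrary: C') (auto split: if_splits prod.splits)

lemma bump_Some:
  "bump a C = (C', Some b) \<Longrightarrow>
     \<exists>u v. C = u @ b # v \<and> C' = u @ a # v \<and> (\<forall>x\<in>set u. x < a) \<and> a \<le> b"
proof (induction C arbitrary: C')
  case Nil
  then show ?case by simp
next
  case (Cons x C)
  show ?case
  proof (cases "a \<le> x")
    case True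
    then show ?thesis using Cons.prems
      by (intro exI[of _ "[]"] exI[of _ C]) auto
  next
    case False
    then obtain D where D: "bump a C = (D, Some b)" "C' = x # D"
      using Cons.prems by (auto split: prod.splits)
    from Cons.IH[OF D(1)] obtain u v where
      "C = u @ b # v \<and> D = u @ a # v \<and> (\<forall>x\<in>set u. x < a) \<and> a \<le> b" by blast
    then show ?thesis using D False
      by (intro exI[of _ "x # u"] exI[of _ v]) auto
  qed
qed

lemma le_count_append: "le_count (u @ v) x = le_count u x + le_count v x"
  by (simp add: le_count_def)
lemma le_count_Cons: "le_count (a # v) x = (if a \<le> x then 1 else 0) + le_count v x"
  by (simp add: le_count_def)
lemma le_count_Nil: "le_count [] x = 0"
  by (simp add: le_count_def)
lemma le_count_all: "(\<And>y. y \<in> set u \<Longrightarrow> y \<le> x) \<Longrightarrow> le_count u x = length u"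
  by (simp add: le_count_def)
lemma le_count_none: "(\<And>y. y \<in> set u \<Longrightarrow> x < y) \<Longrightarrow> le_count u x = 0"
  by (auto simp: le_count_def filter_empty_conv not_le)
lemma le_count_le: "le_count C x \<le> length C"
  by (simp add: le_count_def)

lemmas le_count_simps = le_count_append le_count_Cons le_count_Nil

lemma dominates_length:
  assumes "dominates C C'" shows "length C' \<le> length C"
proof -
  have "length C' = le_count C' (Max (insert 0 (set C')))"
    by (rule le_count_all[symmetric]) auto
  also have "\<dots> \<le> le_count C (Max (insert 0 (set C')))"
    using assms by (simp add: dominates_def)
  also have "\<dots> \<le> length C" by (rule le_count_le)
  finally show ?thesis .
qed

text \<open>In the first column \<open>a\<close> replaces \<open>b\<close>, which only increases its counts. The count of the second
  column at \<open>x\<close> grows only for \<open>x\<close> from \<open>b\<close> up to the next bumped entry. For these \<open>x\<close> the second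
  column had no entry between \<open>b\<close> and \<open>x\<close>, so its count equalled that at \<open>b - 1\<close>, while the
  new first column counts at \<open>x\<close> at least one entry more than the old one did at \<open>b - 1\<close>.\<close>

lemma insert_columns_dominates:
  assumes C1: "sorted_wrt (<) C1" "0 \<notin> set C1" "C1 = u @ b # v" "\<forall>x\<in>set u. x < a" "a \<le> b"
    and C2: "sorted_wrt (<) C2" "dominates C1 C2" and b: "bump b C2 = (C2', out)"
  shows "dominates (u @ a # v) C2'"
  unfolding dominates_def
proof
  fix x
  let ?C1' = "u @ a # v"
  have grow: "le_count C1 y \<le> le_count ?C1' y" for y
    using C1 by (auto simp: le_count_simps)
  have dom: "le_count C2 y \<le> le_count C1 y" for y
    using C2(2) by (simp add: dominates_def)
  have "b > 0" using C1 by (cases b) auto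
  have "le_count C1 (b - 1) = length u"
  proof -
    have "le_count v (b - 1) = 0" using C1(1,3)
      by (intro le_count_none) (auto simp: sorted_wrt_append)
    moreover have "le_count u (b - 1) = length u"
      using C1(4,5) by (intro le_count_all) auto
    ultimately show ?thesis using C1(3) \<open>b > 0\<close> by (simp add: le_count_simps)
  qed
  then have u2: "le_count C2 (b - 1) \<le> length u" using dom[of "b - 1"] by simp
  have big: "length u + 1 \<le> le_count ?C1' x" if "b \<le> x"
  proof -
    have "le_count u x = length u" using C1(4,5) that by (intro le_count_all) auto
    then show ?thesis using that C1(5) by (simp add: le_count_simps)
  qed
  show "le_count C2' x \<le> le_count ?C1' x"
  proof (cases out)
    case None
    then have C2': "C2' = C2 @ [b]" "\<forall>y\<in>set C2. y < b" using b bump_None by auto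
    show ?thesis
    proof (cases "b \<le> x")
      case True
      have "le_count C2 (b - 1) = length C2"
        using C2'(2) by (intro le_count_all) auto
      moreover have "le_count C2 x = length C2"
        using C2'(2) True by (intro le_count_all) auto
      ultimately show ?thesis using big u2 True by (simp add: C2' le_count_simps)
    next
      case False
      then show ?thesis using dom[of x] grow[of x] by (simp add: C2' le_count_simps)
    qed
  next
    case (Some c)
    then obtain u2' v2 where c: "C2 = u2' @ c # v2" "C2' = u2' @ b # v2"
      "\<forall>x\<in>set u2'. x < b" "b \<le> c" using b bump_Some by blast
    consider "x < b" | "c \<le> x" | "b \<le> x" "x < c" by linarith
    then show ?thesis
    proof cases
      case 1
      then have "le_count C2' x \<le> le_count C2 x" using c by (simp add: le_count_simps)
      then show ?thesis using dom[of x] grow[of x] by linarith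
    next
      case 2
      then have "le_count C2' x \<le> le_count C2 x" using c by (simp add: le_count_simps)
      then show ?thesis using dom[of x] grow[of x] by linarith
    next
      case 3
      have "le_count v2 x = 0" using C2(1) c(1) 3
        by (intro le_count_none) (auto simp: sorted_wrt_append)
      moreover have "le_count u2' x = length u2'"
        using c(3) 3 by (intro le_count_all) auto
      ultimately have "le_count C2' x = length u2' + 1" using 3 c by (simp add: le_count_simps)
      moreover have "length u2' \<le> le_count C2 (b - 1)"
      proof -
        have "le_count u2' (b - 1) = length u2'" using c(3) by (intro le_count_all) auto
        then show ?thesis by (simp add: c(1) le_count_simps)
      qed
      ultimately show ?thesis using big[OF 3(1)] u2 by linarith
    qed
  qed
qed

lemma sorted_replace:
  assumes "sorted_wrt (<) (u @ b # v)" "\<forall>x\<in>set u. x < a" "a \<le> (b::nat)"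
  shows "sorted_wrt (<) (u @ a # v)"
  using assms by (force simp: sorted_wrt_append)

lemma semistd_insert_columns:
  "semistd Cs \<Longrightarrow> 1 \<le> a \<Longrightarrow> semistd (insert_columns a Cs)"
proof (induction Cs arbitrary: a)
  case Nil
  then show ?case by simp
next
  case (Cons C Cs)
  obtain C' out where bump: "bump a C = (C', out)" by force
  show ?case
  proof (cases out)
    case None
    then have C': "C' = C @ [a]" "\<forall>x\<in>set C. x < a" using bump bump_None by auto
    have "sorted_wrt (<) C'" using Cons.prems C' by (auto simp: sorted_wrt_append)
    moreover have "case Cs of [] \<Rightarrow> True | D # _ \<Rightarrow> dominates C' D"
    proof -
      have "dominates C' D" if "dominates C D" for D
        using that unfolding C'(1) dominates_def le_count_append by (meson trans_le_add1)
      then show ?thesis using Cons.prems(1) by (cases Cs) simp_all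
    qed
    ultimately show ?thesis using Cons.prems bump None C' by auto
  next
    case (Some b)
    then obtain u v where uv: "C = u @ b # v" "C' = u @ a # v" "\<forall>x\<in>set u. x < a" "a \<le> b"
      using bump bump_Some by blast
    have sC: "sorted_wrt (<) C" "0 \<notin> set C" using Cons.prems by auto
    have "sorted_wrt (<) C'" using sorted_replace sC(1) uv by blast
    moreover have "0 \<notin> set C'" "C' \<noteq> []" using uv sC Cons.prems(2) by auto
    moreover have "semistd (insert_columns b Cs)"
      using Cons.prems uv(4) by (intro Cons.IH) auto
    moreover have "case insert_columns b Cs of [] \<Rightarrow> True | D # _ \<Rightarrow> dominates C' D"
    proof (cases Cs)
      case Nil
      then show ?thesis using uv by (auto simp: dominates_def le_count_simps)
    next
      case (Cons C2 Cs2)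
      obtain C2' out2 where bump2: "bump b C2 = (C2', out2)" by force
      have "dominates C' C2'"
        unfolding uv(2)
        by (rule insert_columns_dominates[OF sC uv(1,3,4) _ _ bump2])
           (use Cons.prems Cons in auto)
      then show ?thesis using bump2 Cons by (auto split: option.splits)
    qed
    ultimately show ?thesis using bump Some by simp
  qed
qed

lemma insert_columns_hd:
  "\<exists>C Ds. insert_columns b Cs = C # Ds \<and> b \<in> set C"
proof (cases Cs)
  case (Cons D Cs')
  obtain D' out where bump: "bump b D = (D', out)" by force
  then have "b \<in> set D'" using bump_None bump_Some by (cases out) fastforce+
  then show ?thesis using Cons bump by (auto split: option.splits)
qed auto

text \<open>A letter appended to a defective column leaves the column defective, and defects further to the right
  persist by induction. Suppose that bumping repairs the first column. As \<open>a\<close> replaced \<open>b\<close> and the result is an interval,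
  \<open>b\<close> exceeds the length of that column. But \<open>b\<close> then belongs to the next column, which is not longer
  than the first one, so the next column is defective.\<close>

lemma insert_columns_bad:
  assumes "semistd Cs" "1 \<le> a" "\<exists>C\<in>set Cs. \<not> interval_col C"
  shows "\<exists>C\<in>set (insert_columns a Cs). \<not> interval_col C"
  using assms
proof (induction Cs arbitrary: a)
  case Nil
  then show ?case by simp
next
  case (Cons C Cs)
  obtain C' out where bump: "bump a C = (C', out)" by force
  have semi: "semistd (insert_columns a (C # Cs))"
    using Cons.prems semistd_insert_columns by blast
  show ?case
  proof (cases out)
    case None
    then have C': "C' = C @ [a]" using bump bump_None by auto
    have "\<not> interval_col C'" if "\<not> interval_col C"
      using that unfolding C' interval_col_def by auto
    then show ?thesis using Cons.prems bump None by auto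
  next
    case (Some b)
    then obtain u v where uv: "C = u @ b # v" "C' = u @ a # v" "\<forall>x\<in>set u. x < a" "a \<le> b"
      using bump bump_Some by blast
    have res: "insert_columns a (C # Cs) = C' # insert_columns b Cs" using bump Some by simp
    show ?thesis
    proof (cases "\<exists>D\<in>set Cs. \<not> interval_col D")
      case True
      then have "\<exists>D\<in>set (insert_columns b Cs). \<not> interval_col D"
        using Cons.prems uv(4) by (intro Cons.IH) auto
      then show ?thesis using res by auto
    next
      case False
      then have bad: "\<not> interval_col C" using Cons.prems by auto
      show ?thesis
      proof (rule ccontr)
        assume no: "\<not> ?thesis"
        then have C': "interval_col C'" unfolding res by simp
        then have setC': "set C' = {1..length C'}" unfolding interval_col_def
          by (metis atLeastLessThanSuc_atLeastAtMost set_upt)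
        have len: "length C' = length C" using uv by simp
        have "b > length C'"
        proof (rule ccontr)
          assume "\<not> b > length C'"
          then have "b \<in> set C'" using setC' uv Cons.prems by auto
          moreover have "b \<notin> set u" "b \<notin> set v" using Cons.prems(1) uv(1)
            by (auto simp: sorted_wrt_append)
          ultimately have "b = a" using uv by auto
          then show False using bad C' uv by simp
        qed
        moreover obtain D Ds where D: "insert_columns b Cs = D # Ds" "b \<in> set D"
          using insert_columns_hd by blast
        then have "interval_col D" using no unfolding res by simp
        then have "b \<le> length D" using D(2) unfolding interval_col_def
          by (metis atLeastLessThan_iff less_Suc_eq_le set_upt)
        moreover have "length D \<le> length C'"
          using semi unfolding res D(1) by (intro dominates_length) simp
        ultimately show False by linarith
      qed
    qed
  qed
qed

lemma bump_interval:
  assumes "1 \<le> a"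
  shows "bump a [1..<Suc l] = (if a \<le> l then ([1..<Suc l], Some a) else ([1..<Suc l] @ [a], None))"
proof -
  obtain C' out where bump: "bump a [1..<Suc l] = (C', out)" by force
  show ?thesis
  proof (cases out)
    case None
    then have "C' = [1..<Suc l] @ [a]" "\<forall>x\<in>set [1..<Suc l]. x < a"
      using bump bump_None by metis+
    moreover have "\<not> a \<le> l"
    proof
      assume "a \<le> l"
      then have "a \<in> set [1..<Suc l]" using assms by auto
      then show False using calculation(2) by blast
    qed
    ultimately show ?thesis using bump None by simp
  next
    case (Some b)
    then obtain u v where uv: "[1..<Suc l] = u @ b # v" "C' = u @ a # v" "\<forall>x\<in>set u. x < a" "a \<le> b"
      using bump bump_Some by metis
    have "b \<in> set [1..<Suc l]" unfolding uv(1) by simp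
    then have "b \<le> l" by auto
    then have "a \<in> set [1..<Suc l]" using assms uv(4) by auto
    moreover have "\<forall>x\<in>set v. b < x"
      using sorted_wrt_upt[of 1 "Suc l"] unfolding uv(1) by (simp add: sorted_wrt_append)
    ultimately have "a = b" using uv(3,4) unfolding uv(1) by fastforce
    then show ?thesis using bump Some uv \<open>b \<le> l\<close> by simp
  qed
qed

text \<open>The letter \<open>a\<close> meets an equal letter in each column of length at least \<open>a\<close> and passes on unchanged.
  It completes the first shorter column to an interval iff that column has length \<open>a - 1\<close>, that is, iff
  a box may be added to row \<open>a\<close>. The bound on the parts of \<open>ls'\<close> keeps the induction going.\<close>

lemma insert_init_cols:
  assumes "is_partition ls" "1 \<le> a"
  shows "(if a = 1 \<or> parts_ge ls a < parts_ge ls (a - 1)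
    then \<exists>ls'. is_partition ls' \<and> insert_columns a (init_cols ls) = init_cols ls'
      \<and> set ls' \<subseteq> insert a (set ls)
      \<and> (\<forall>b\<ge>1. parts_ge ls' b = (if b = a then Suc (parts_ge ls a) else parts_ge ls b))
    else \<exists>C\<in>set (insert_columns a (init_cols ls)). \<not> interval_col C)"
  using assms
proof (induction ls)
  case Nil
  show ?case
  proof (cases "a = 1")
    case True
    then show ?thesis
      by (auto simp: init_cols_def parts_ge_def is_partition_def intro!: exI[of _ "[1]"])
  next
    case False
    then show ?thesis using Nil by (auto simp: init_cols_def parts_ge_def interval_col_def)
  qed
next
  case (Cons l ls)
  have p: "is_partition ls" "l \<ge> 1" "\<And>x. x \<in> set ls \<Longrightarrow> x \<le> l"
    using Cons.prems by (auto simp: is_partition_def)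
  note IH = Cons.IH[OF p(1) Cons.prems(2)]
  show ?case
  proof (cases "a \<le> l")
    case True
    have ins: "insert_columns a (init_cols (l # ls)) = [1..<Suc l] # insert_columns a (init_cols ls)"
      using True bump_interval[OF Cons.prems(2), of l] by (simp add: init_cols_def del: upt_Suc)
    have pg: "parts_ge (l # ls) a = Suc (parts_ge ls a)"
       "parts_ge (l # ls) (a - 1) = Suc (parts_ge ls (a - 1))"
      using True by (auto simp: parts_ge_def)
    show ?thesis
    proof (cases "a = 1 \<or> parts_ge ls a < parts_ge ls (a - 1)")
      case ok: True
      then obtain ls' where ls': "is_partition ls'" "insert_columns a (init_cols ls) = init_cols ls'"
        "set ls' \<subseteq> insert a (set ls)"
        "\<forall>b\<ge>1. parts_ge ls' b = (if b = a then Suc (parts_ge ls a) else parts_ge ls b)"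
        using IH by auto
      have "is_partition (l # ls')" using ls'(1,3) True p(2,3)
        by (auto simp: is_partition_def)
      moreover have "insert_columns a (init_cols (l # ls)) = init_cols (l # ls')"
        using ins ls'(2) by (simp add: init_cols_def)
      moreover have "\<forall>b\<ge>1. parts_ge (l # ls') b =
          (if b = a then Suc (parts_ge (l # ls) a) else parts_ge (l # ls) b)"
        using ls'(4) True by (simp add: parts_ge_def)
      moreover have "set (l # ls') \<subseteq> insert a (set (l # ls))" using ls'(3) by auto
      moreover have cond: "a = 1 \<or> parts_ge (l # ls) a < parts_ge (l # ls) (a - 1)"
        using ok pg by auto
      ultimately show ?thesis unfolding if_P[OF cond] by blast
    next
      case False
      then show ?thesis using IH ins pg by auto
    qed
  next
    case False
    have ins: "insert_columns a (init_cols (l # ls)) = ([1..<Suc l] @ [a]) # init_cols ls"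
      using False bump_interval[OF Cons.prems(2), of l] by (simp add: init_cols_def del: upt_Suc)
    have 0: "parts_ge (l # ls) a = 0" using False p(3) by (intro parts_ge_eq_0) fastforce
    show ?thesis
    proof (cases "a = Suc l")
      case True
      have "parts_ge (l # ls) (a - 1) > 0" using True by (simp add: parts_ge_def)
      moreover have "is_partition (a # ls)" using Cons.prems p True by (fastforce simp: is_partition_def)
      moreover have "insert_columns a (init_cols (l # ls)) = init_cols (a # ls)"
        using ins True by (simp add: init_cols_def)
      moreover have "\<forall>b\<ge>1. parts_ge (a # ls) b =
          (if b = a then Suc (parts_ge (l # ls) a) else parts_ge (l # ls) b)"
        using 0 True by (auto simp: parts_ge_def)
      ultimately show ?thesis using 0 by (auto intro!: exI[of _ "a # ls"])
    next
      case F: False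
      have "parts_ge (l # ls) (a - 1) = 0" using False F p(3) by (intro parts_ge_eq_0) fastforce
      moreover have "\<not> interval_col ([1..<Suc l] @ [a])"
        using False F by (simp add: interval_col_def)
      moreover have "a \<noteq> 1" using False p(2) by simp
      ultimately show ?thesis using ins 0 by (auto simp del: upt_Suc)
    qed
  qed
qed

lemma semistd_init_cols: "is_partition ls \<Longrightarrow> semistd (init_cols ls)"
proof (induction ls)
  case Nil
  then show ?case by (simp add: init_cols_def)
next
  case (Cons l ls)
  have le: "le_count [1..<Suc m] x = min m x" for m x
  proof (induction m)
    case (Suc m)
    then show ?case by (auto simp: le_count_simps)
  qed (simp add: le_count_simps)
  have semi: "semistd (init_cols ls)" using Cons by (auto simp: is_partition_def)
  have l: "l \<ge> 1" "\<And>x. x \<in> set ls \<Longrightarrow> x \<le> l"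
    using Cons.prems by (auto simp: is_partition_def)
  have "case init_cols ls of [] \<Rightarrow> True | C' # _ \<Rightarrow> dominates [1..<Suc l] C'"
  proof (cases ls)
    case (Cons l' ls')
    then have "l' \<le> l" using l(2) by simp
    then have "dominates [1..<Suc l] [1..<Suc l']" unfolding dominates_def le by auto
    then show ?thesis using Cons by (simp add: init_cols_def del: upt_Suc)
  qed (simp add: init_cols_def)
  moreover have "init_cols (l # ls) = [1..<Suc l] # init_cols ls" by (simp add: init_cols_def)
  moreover have "[1..<Suc l] \<noteq> []" "0 \<notin> set [1..<Suc l]" "sorted_wrt (<) [1..<Suc l]"
    using l(1) sorted_wrt_upt by (auto simp del: upt_Suc)
  ultimately show ?case using semi by (simp only: semistd.simps simp_thms)
qed

lemma shape_of_columns: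
  assumes "\<And>C. C \<in> set Cs \<Longrightarrow> 0 \<notin> set C"
  shows "shape (of_columns Cs) = {(i, j). 1 \<le> j \<and> j \<le> length Cs \<and> 1 \<le> i \<and> i \<le> length (Cs ! (j - 1))}"
proof -
  have "Cs ! (j - 1) ! (i - 1) \<noteq> 0"
    if "1 \<le> j" "j \<le> length Cs" "1 \<le> i" "i \<le> length (Cs ! (j - 1))" for i j
  proof -
    have "Cs ! (j - 1) \<in> set Cs" using that by auto
    moreover have "Cs ! (j - 1) ! (i - 1) \<in> set (Cs ! (j - 1))" using that by auto
    ultimately show ?thesis using assms by metis
  qed
  then show ?thesis by (auto simp: shape_def of_columns_def split: if_splits)
qed

lemma columns_of_columns:
  assumes ne: "\<And>C. C \<in> set Cs \<Longrightarrow> C \<noteq> [] \<and> 0 \<notin> set C"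
  shows "columns (of_columns Cs) = Cs"
proof -
  have sh: "shape (of_columns Cs) = {(i, j). 1 \<le> j \<and> j \<le> length Cs \<and> 1 \<le> i \<and> i \<le> length (Cs ! (j - 1))}"
    using ne by (intro shape_of_columns) auto
  have "snd ` shape (of_columns Cs) = {1..length Cs}"
  proof
    show "{1..length Cs} \<subseteq> snd ` shape (of_columns Cs)"
    proof
      fix j assume j: "j \<in> {1..length Cs}"
      then have "Cs ! (j - 1) \<in> set Cs" by auto
      then have "1 \<le> length (Cs ! (j - 1))" using ne by (simp add: Suc_le_eq)
      then have "(1, j) \<in> shape (of_columns Cs)" using j sh by auto
      then show "j \<in> snd ` shape (of_columns Cs)" by force
    qed
  qed (auto simp: sh)
  moreover have "Max (insert 0 {1..length Cs}) = length Cs"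
    by (rule Max_eqI) (auto simp: Suc_le_eq)
  ultimately have mx: "Max (insert 0 (snd ` shape (of_columns Cs))) = length Cs" by simp
  have col: "column (of_columns Cs) j = Cs ! (j - 1)" if "1 \<le> j" "j \<le> length Cs" for j
  proof -
    have "{i. (i, j) \<in> shape (of_columns Cs)} = {1..<Suc (length (Cs ! (j - 1)))}"
      using that by (auto simp: sh)
    then have "column (of_columns Cs) j
        = map (\<lambda>i. of_columns Cs (i, j)) [1..<Suc (length (Cs ! (j - 1)))]"
      unfolding column_def by (metis sorted_list_of_set_range)
    also have "\<dots> = Cs ! (j - 1)"
      by (rule nth_equalityI) (use that in \<open>auto simp: of_columns_def simp del: upt_Suc\<close>)
    finally show ?thesis .
  qed
  show ?thesis unfolding columns_def mx
    by (rule nth_equalityI) (auto simp: col simp del: upt_Suc)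
qed

lemma fold_col_insert:
  assumes "semistd Cs" "0 \<notin> set w"
  shows "fold col_insert w (of_columns Cs) = of_columns (fold insert_columns w Cs)
    \<and> semistd (fold insert_columns w Cs)"
  using assms
proof (induction w arbitrary: Cs)
  case (Cons a w)
  have ne: "\<And>C. C \<in> set Cs \<Longrightarrow> C \<noteq> [] \<and> 0 \<notin> set C" using Cons.prems(1)
    by (induction Cs) auto
  have "semistd (insert_columns a Cs)" using Cons.prems semistd_insert_columns by auto
  then show ?case using Cons.IH[of "insert_columns a Cs"] Cons.prems
    by (simp add: col_insert_def columns_of_columns[OF ne])
qed simp

lemma fold_insert_columns_bad:
  assumes "semistd Cs" "0 \<notin> set w" "\<exists>C\<in>set Cs. \<not> interval_col C"
  shows "\<exists>C\<in>set (fold insert_columns w Cs). \<not> interval_col C"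
  using assms
proof (induction w arbitrary: Cs)
  case (Cons a w)
  have a: "1 \<le> a" using Cons.prems(2) by auto
  have "semistd (insert_columns a Cs)" using semistd_insert_columns[OF Cons.prems(1) a] .
  moreover have "\<exists>C\<in>set (insert_columns a Cs). \<not> interval_col C"
    by (rule insert_columns_bad[OF Cons.prems(1) a Cons.prems(3)])
  ultimately show ?case using Cons.IH[of "insert_columns a Cs"] Cons.prems(2) by simp
qed simp

text \<open>From here on a partition is given by its row lengths, a function whose value at 0 is arbitrary
  and is ignored by the following notions.\<close>

definition young :: "(nat \<Rightarrow> nat) \<Rightarrow> (nat \<times> nat) set" where
  "young \<nu> = {(a, y). 1 \<le> a \<and> 1 \<le> y \<and> y \<le> \<nu> a}"

definition highest :: "(nat \<Rightarrow> nat) \<Rightarrow> tableau" where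
  "highest \<nu> = (\<lambda>(a, y). if (a, y) \<in> young \<nu> then a else 0)"

definition decr :: "(nat \<Rightarrow> nat) \<Rightarrow> bool" where
  "decr \<nu> \<longleftrightarrow> (\<forall>a\<ge>1. \<nu> (Suc a) \<le> \<nu> a)"

definition is_shape :: "(nat \<Rightarrow> nat) \<Rightarrow> bool" where
  "is_shape \<nu> \<longleftrightarrow> (\<exists>ls. is_partition ls \<and> (\<forall>a\<ge>1. \<nu> a = parts_ge ls a))"

text \<open>The lattice (Yamanouchi) condition relative to \<open>\<nu>\<close>: adding the letters one by one as boxes of rows
  produces partitions throughout.\<close>

fun lattice :: "(nat \<Rightarrow> nat) \<Rightarrow> nat list \<Rightarrow> bool" where
  "lattice \<nu> [] \<longleftrightarrow> decr \<nu>"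
| "lattice \<nu> (a # w) \<longleftrightarrow> decr \<nu> \<and> lattice (\<nu>(a := Suc (\<nu> a))) w"

lemma nat_eq_if_le_iff: "(\<And>l. 1 \<le> l \<Longrightarrow> l \<le> a \<longleftrightarrow> l \<le> b) \<Longrightarrow> a = (b :: nat)"
  by (metis One_nat_def Suc_leI antisym bot_nat_0.not_eq_extremum le_refl zero_le)

lemma young_eq_iff: "young \<nu> = young \<kappa> \<longleftrightarrow> (\<forall>a\<ge>1. \<nu> a = \<kappa> a)"
proof
  assume eq: "young \<nu> = young \<kappa>"
  show "\<forall>a\<ge>1. \<nu> a = \<kappa> a"
  proof (intro allI impI)
    fix a :: nat assume a: "a \<ge> 1"
    have "(a, y) \<in> young \<nu> \<longleftrightarrow> (a, y) \<in> young \<kappa>" for y using eq by simp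
    then have "y \<le> \<nu> a \<longleftrightarrow> y \<le> \<kappa> a" if "1 \<le> y" for y
      using a that unfolding young_def mem_Collect_eq prod.case by blast
    then show "\<nu> a = \<kappa> a" by (rule nat_eq_if_le_iff)
  qed
qed (auto simp: young_def)

lemma young_converse: "is_partition ls \<Longrightarrow> young (parts_ge ls) = converse (young (part ls))"
  using le_parts_ge_iff[of ls] by (fastforce simp: young_def is_partition_def)

lemma shape_highest: "shape (highest \<nu>) = young \<nu>"
  by (auto simp: shape_def highest_def young_def split: if_splits)

lemma highest_eq_iff: "highest \<nu> = highest \<kappa> \<longleftrightarrow> (\<forall>a\<ge>1. \<nu> a = \<kappa> a)"
proof
  assume "highest \<nu> = highest \<kappa>"
  then have "young \<nu> = young \<kappa>" by (metis shape_highest)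
  then show "\<forall>a\<ge>1. \<nu> a = \<kappa> a" by (simp add: young_eq_iff)
next
  assume "\<forall>a\<ge>1. \<nu> a = \<kappa> a"
  then have "young \<nu> = young \<kappa>" by (simp add: young_eq_iff)
  then show "highest \<nu> = highest \<kappa>" by (simp add: highest_def)
qed

lemma diagram_young: "diagram \<nu> = young (part \<nu>)"
  by (simp add: diagram_def young_def)

lemma H_tab_highest: "H_tab \<nu> = highest (part \<nu>)"
  by (simp add: H_tab_def highest_def diagram_young)

lemma part_conjugate:
  assumes "is_partition \<nu>" "1 \<le> a" shows "part (conjugate \<nu>) a = parts_ge \<nu> a"
proof (cases "a \<le> part \<nu> 1")
  case True
  then show ?thesis using assms by (auto simp: part_def conjugate_def parts_ge_def simp del: upt_Suc)
next
  case False
  have "\<not> 1 \<le> parts_ge \<nu> a"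
    using le_parts_ge_iff[of \<nu> 1 a] assms False by (auto simp: is_partition_def)
  then show ?thesis using False by (auto simp: part_def conjugate_def)
qed

lemma young_conjugate: "is_partition \<nu> \<Longrightarrow> young (part (conjugate \<nu>)) = converse (young (part \<nu>))"
  using young_converse[of \<nu>] young_eq_iff[of "part (conjugate \<nu>)" "parts_ge \<nu>"]
    part_conjugate[of \<nu>] by auto

lemma is_partition_conjugate:
  assumes "is_partition \<nu>" shows "is_partition (conjugate \<nu>)"
proof -
  have anti: "parts_ge \<nu> k \<le> parts_ge \<nu> j" if "j \<le> k" for j k
  proof -
    have "filter (\<lambda>l. k \<le> l) \<nu> = filter (\<lambda>l. k \<le> l) (filter (\<lambda>l. j \<le> l) \<nu>)"
      using that by (auto intro!: filter_cong)
    then show ?thesis unfolding parts_ge_def by (metis length_filter_le)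
  qed
  have pos: "1 \<le> parts_ge \<nu> j" if "1 \<le> j" "j \<le> part \<nu> 1" for j
    using le_parts_ge_iff[of \<nu> 1 j] assms that by (auto simp: is_partition_def)
  have c: "conjugate \<nu> = map (parts_ge \<nu>) [1..<Suc (part \<nu> 1)]"
    by (simp add: conjugate_def parts_ge_def)
  have "sorted_wrt (\<ge>) (conjugate \<nu>)"
    unfolding c sorted_wrt_map
    by (rule sorted_wrt_mono_rel[OF _ sorted_wrt_upt]) (auto intro: anti)
  moreover have "0 \<notin> set (conjugate \<nu>)"
    using pos by (force simp: c simp del: upt_Suc)
  ultimately show ?thesis by (simp add: is_partition_def)
qed

text \<open>The column lengths of \<open>\<nu>\<close> are the parts of its conjugate.\<close>

lemma is_shape_part: "is_partition \<nu> \<Longrightarrow> is_shape (part \<nu>)"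
  using young_converse[OF is_partition_conjugate, of \<nu>] young_conjugate[of \<nu>] is_partition_conjugate[of \<nu>]
  by (metis converse_converse is_shape_def young_eq_iff)

lemma of_columns_init_cols:
  assumes "is_partition ls" shows "of_columns (init_cols ls) = highest (parts_ge ls)"
proof
  fix b :: "nat \<times> nat"
  obtain i j where b: "b = (i, j)" by force
  have "(i, j) \<in> young (parts_ge ls) \<longleftrightarrow> (j, i) \<in> young (part ls)"
    using young_converse[OF assms] by auto
  then show "of_columns (init_cols ls) b = highest (parts_ge ls) b"
    unfolding b by (auto simp: of_columns_def init_cols_def highest_def young_def part_def simp del: upt_Suc)
qed

lemma is_shape_decr:
  assumes "is_shape \<nu>" shows "decr \<nu>"
proof -
  obtain ls where ls: "is_partition ls" "\<forall>a\<ge>1. \<nu> a = parts_ge ls a"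
    using assms by (auto simp: is_shape_def)
  show ?thesis unfolding decr_def
  proof (intro allI impI)
    fix a :: nat assume "a \<ge> 1"
    have "length (filter (\<lambda>l. Suc a \<le> l) ls) \<le> length (filter (\<lambda>l. a \<le> l) ls)"
      by (induction ls) auto
    then show "\<nu> (Suc a) \<le> \<nu> a" using \<open>a \<ge> 1\<close> ls(2) by (simp add: parts_ge_def)
  qed
qed

lemma decr_fun_upd:
  assumes "decr \<nu>" "1 \<le> a"
  shows "decr (\<nu>(a := Suc (\<nu> a))) \<longleftrightarrow> a = 1 \<or> \<nu> a < \<nu> (a - 1)"
proof
  assume d: "decr (\<nu>(a := Suc (\<nu> a)))"
  show "a = 1 \<or> \<nu> a < \<nu> (a - 1)"
  proof (cases "a = 1")
    case False
    then have "1 \<le> a - 1" using assms(2) by simp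
    then have "(\<nu>(a := Suc (\<nu> a))) (Suc (a - 1)) \<le> (\<nu>(a := Suc (\<nu> a))) (a - 1)"
      using d unfolding decr_def by blast
    moreover have "a - 1 \<noteq> a" "Suc (a - 1) = a" using assms(2) by auto
    ultimately show ?thesis by simp
  qed simp
next
  assume a: "a = 1 \<or> \<nu> a < \<nu> (a - 1)"
  have "(\<nu>(a := Suc (\<nu> a))) (Suc b) \<le> (\<nu>(a := Suc (\<nu> a))) b" if "1 \<le> b" for b
  proof -
    have "\<nu> (Suc b) \<le> \<nu> b" using assms(1) that by (simp add: decr_def)
    then show ?thesis using a that by auto
  qed
  then show "decr (\<nu>(a := Suc (\<nu> a)))" by (simp add: decr_def)
qed

lemma lattice_cong:
  "(\<And>b. b \<ge> 1 \<Longrightarrow> \<kappa> b = \<kappa>' b) \<Longrightarrow> 0 \<notin> set w \<Longrightarrow> lattice \<kappa> w = lattice \<kappa>' w"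
proof (induction w arbitrary: \<kappa> \<kappa>')
  case (Cons a w)
  have "lattice (\<kappa>(a := Suc (\<kappa> a))) w = lattice (\<kappa>'(a := Suc (\<kappa>' a))) w"
    using Cons.prems by (intro Cons.IH) auto
  then show ?case using Cons.prems by (auto simp: decr_def)
qed (auto simp: decr_def)

lemma lattice_decr: "lattice \<nu> w \<Longrightarrow> decr \<nu>"
  by (cases w) auto

lemma insertion_dichotomy:
  assumes "is_partition ls" "0 \<notin> set w"
  shows "if lattice (parts_ge ls) w
    then \<exists>ls'. is_partition ls' \<and> fold insert_columns w (init_cols ls) = init_cols ls'
      \<and> (\<forall>b\<ge>1. parts_ge ls' b = parts_ge ls b + count_list w b)
    else \<exists>C\<in>set (fold insert_columns w (init_cols ls)). \<not> interval_col C"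
  using assms
proof (induction w arbitrary: ls)
  case Nil
  have "decr (parts_ge ls)" using Nil is_shape_decr by (auto simp: is_shape_def)
  then show ?case using Nil by auto
next
  case (Cons a w)
  let ?\<nu> = "parts_ge ls"
  have a: "1 \<le> a" using Cons.prems by auto
  have d: "decr ?\<nu>" using Cons.prems is_shape_decr by (auto simp: is_shape_def)
  note ins = insert_init_cols[OF Cons.prems(1) a]
  show ?case
  proof (cases "a = 1 \<or> ?\<nu> a < ?\<nu> (a - 1)")
    case True
    then obtain ls' where ls': "is_partition ls'" "insert_columns a (init_cols ls) = init_cols ls'"
        "\<forall>b\<ge>1. parts_ge ls' b = (if b = a then Suc (parts_ge ls a) else parts_ge ls b)"
      using ins by auto
    have "lattice (?\<nu>(a := Suc (?\<nu> a))) w = lattice (parts_ge ls') w"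
      using ls'(3) Cons.prems by (intro lattice_cong) auto
    then have iff: "lattice ?\<nu> (a # w) \<longleftrightarrow> lattice (parts_ge ls') w" using d by simp
    show ?thesis
    proof (cases "lattice (parts_ge ls') w")
      case lattice: True
      then obtain ls'' where "is_partition ls''" "fold insert_columns w (init_cols ls') = init_cols ls''"
          "\<forall>b\<ge>1. parts_ge ls'' b = parts_ge ls' b + count_list w b"
        using Cons.IH[OF ls'(1)] Cons.prems(2) by auto
      then show ?thesis unfolding if_P[OF iff[THEN iffD2, OF lattice]] using ls'(2,3) by auto
    next
      case False
      then show ?thesis using Cons.IH[OF ls'(1)] Cons.prems(2) ls'(2) iff
        by (simp del: lattice.simps)
    qed
  next
    case False
    then have "\<not> lattice ?\<nu> (a # w)" using d a decr_fun_upd lattice_decr by (meson lattice.simps(2))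
    moreover have "\<exists>C\<in>set (fold insert_columns w (insert_columns a (init_cols ls))). \<not> interval_col C"
      using ins False Cons.prems a
      by (intro fold_insert_columns_bad semistd_insert_columns semistd_init_cols) auto
    ultimately show ?thesis by (auto simp del: lattice.simps)
  qed
qed

lemma fold_col_insert_lattice:
  assumes "is_shape \<nu>" "0 \<notin> set w" "lattice \<nu> w"
  shows "fold col_insert w (highest \<nu>) = highest (\<lambda>a. \<nu> a + count_list w a)
    \<and> is_shape (\<lambda>a. \<nu> a + count_list w a)"
proof -
  obtain ls where ls: "is_partition ls" "\<forall>a\<ge>1. \<nu> a = parts_ge ls a"
    using assms by (auto simp: is_shape_def)
  have "lattice (parts_ge ls) w" using assms ls(2) lattice_cong by metis
  then obtain ls' where ls': "is_partition ls'" "fold insert_columns w (init_cols ls) = init_cols ls'"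
      "\<forall>b\<ge>1. parts_ge ls' b = parts_ge ls b + count_list w b"
    using insertion_dichotomy[OF ls(1) assms(2)] by auto
  have "highest \<nu> = of_columns (init_cols ls)"
    using ls by (simp add: of_columns_init_cols highest_eq_iff)
  then have "fold col_insert w (highest \<nu>) = highest (parts_ge ls')"
    using fold_col_insert[OF semistd_init_cols[OF ls(1)] assms(2)] ls'(2)
    by (simp add: of_columns_init_cols[OF ls'(1)])
  then show ?thesis using ls' ls by (auto simp: highest_eq_iff is_shape_def)
qed

lemma fold_col_insert_not_lattice:
  assumes "is_shape \<nu>" "0 \<notin> set w" "\<not> lattice \<nu> w" "is_shape \<kappa>"
  shows "fold col_insert w (highest \<nu>) \<noteq> highest \<kappa>"
proof
  assume eq: "fold col_insert w (highest \<nu>) = highest \<kappa>"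
  obtain ls where ls: "is_partition ls" "\<forall>a\<ge>1. \<nu> a = parts_ge ls a"
    using assms by (auto simp: is_shape_def)
  obtain ks where ks: "is_partition ks" "\<forall>a\<ge>1. \<kappa> a = parts_ge ks a"
    using assms by (auto simp: is_shape_def)
  let ?F = "fold insert_columns w (init_cols ls)"
  have "\<not> lattice (parts_ge ls) w" using assms ls(2) lattice_cong by metis
  then have bad: "\<exists>C\<in>set ?F. \<not> interval_col C"
    using insertion_dichotomy[OF ls(1) assms(2)] by auto
  have semi: "fold col_insert w (of_columns (init_cols ls)) = of_columns ?F" "semistd ?F"
    using fold_col_insert[OF semistd_init_cols[OF ls(1)] assms(2)] by auto
  have "highest \<nu> = of_columns (init_cols ls)" "highest \<kappa> = of_columns (init_cols ks)"
    using ls ks by (simp_all add: of_columns_init_cols highest_eq_iff)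
  then have "of_columns ?F = of_columns (init_cols ks)" using eq semi(1) by simp
  moreover have "semistd Cs \<Longrightarrow> columns (of_columns Cs) = Cs" for Cs
  proof (rule columns_of_columns)
    show "semistd Cs \<Longrightarrow> C \<in> set Cs \<Longrightarrow> C \<noteq> [] \<and> 0 \<notin> set C" for C
      by (induction Cs) auto
  qed
  ultimately have "?F = init_cols ks" using semi(2) semistd_init_cols[OF ks(1)] by metis
  then show False using bad by (auto simp: init_cols_def interval_col_def simp del: upt_Suc)
qed

section \<open>Lattice words of tableaux\<close>

lemma decr_cong: "(\<And>a. 1 \<le> a \<Longrightarrow> \<nu> a = \<kappa> a) \<Longrightarrow> decr \<nu> \<longleftrightarrow> decr \<kappa>"
  by (simp add: decr_def)

lemma lattice_append:
  "lattice \<nu> (u @ v) \<longleftrightarrow> lattice \<nu> u \<and> lattice (\<lambda>a. \<nu> a + count_list u a) v"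
proof (induction u arbitrary: \<nu>)
  case Nil
  then show ?case using lattice_decr by auto
next
  case (Cons a u)
  have "(\<lambda>b. (\<nu>(a := Suc (\<nu> a))) b + count_list u b) = (\<lambda>b. \<nu> b + count_list (a # u) b)"
    by (auto simp: fun_eq_iff)
  then show ?case using Cons.IH[of "\<nu>(a := Suc (\<nu> a))"]
    by (simp only: append_Cons lattice.simps conj_assoc)
qed

text \<open>A strictly increasing word adds to row \<open>a - 1\<close> before it adds to row \<open>a\<close>, so it is enough to look at
  the end.\<close>

lemma lattice_increasing:
  assumes "sorted_wrt (<) u" "0 \<notin> set u" "decr \<nu>"
  shows "lattice \<nu> u \<longleftrightarrow> decr (\<lambda>a. \<nu> a + count_list u a)"
  using assms
proof (induction u arbitrary: \<nu>)
  case Nil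
  then show ?case by simp
next
  case (Cons a u)
  let ?\<kappa> = "\<nu>(a := Suc (\<nu> a))"
  have eq: "(\<lambda>b. ?\<kappa> b + count_list u b) = (\<lambda>b. \<nu> b + count_list (a # u) b)"
    by (auto simp: fun_eq_iff)
  have a: "1 \<le> a" using Cons.prems(2) by auto
  have IH: "decr ?\<kappa> \<Longrightarrow> lattice ?\<kappa> u \<longleftrightarrow> decr (\<lambda>b. \<nu> b + count_list (a # u) b)"
  proof -
    assume "decr ?\<kappa>"
    moreover have "sorted_wrt (<) u" "0 \<notin> set u" using Cons.prems by auto
    ultimately show ?thesis using Cons.IH[of ?\<kappa>] unfolding eq by blast
  qed
  have "decr ?\<kappa>" if d: "decr (\<lambda>b. \<nu> b + count_list (a # u) b)"
  proof (cases "a = 1")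
    case False
    have "a - 1 \<notin> set (a # u)" using Cons.prems(1) a by auto
    then have "count_list (a # u) (a - 1) = 0" by (rule count_notin)
    moreover have "\<nu> (Suc (a - 1)) + count_list (a # u) (Suc (a - 1)) \<le> \<nu> (a - 1) + count_list (a # u) (a - 1)"
      using d False a unfolding decr_def by (metis One_nat_def Suc_leI diff_is_0_eq le_antisym not_gr_zero)
    ultimately have "\<nu> a < \<nu> (a - 1)" using a by simp
    then show ?thesis using decr_fun_upd Cons.prems(3) a by blast
  qed (use decr_fun_upd Cons.prems(3) a in blast)
  then show ?case using IH Cons.prems(3) lattice_decr by (metis lattice.simps(2))
qed

text \<open>The content of the part right of column \<open>c\<close> and, in the next definition, of the first \<open>i\<close> rows;
  only its values at positive letters matter.\<close>

definition col_content :: "tableau \<Rightarrow> nat \<Rightarrow> nat \<Rightarrow> nat" where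
  "col_content T c a = card {b. T b = a \<and> c < snd b}"

definition row_content :: "tableau \<Rightarrow> nat \<Rightarrow> nat \<Rightarrow> nat" where
  "row_content T i a = card {b. T b = a \<and> fst b \<le> i}"

abbreviation in_box :: "tableau \<Rightarrow> nat \<Rightarrow> nat \<Rightarrow> bool" where
  "in_box T R M \<equiv> shape T \<subseteq> {1..R} \<times> {1..M}"

lemma in_boxD: "in_box T R M \<Longrightarrow> T (i, j) \<noteq> 0 \<Longrightarrow> 1 \<le> i \<and> i \<le> R \<and> 1 \<le> j \<and> j \<le> M"
  by (auto simp: shape_def)

lemma in_box_entry:
  assumes "in_box T R M" "T b = a" "1 \<le> a"
  shows "1 \<le> fst b \<and> fst b \<le> R \<and> 1 \<le> snd b \<and> snd b \<le> M"
  using in_boxD[OF assms(1), of "fst b" "snd b"] assms(2,3) by simp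

lemma finite_entries:
  assumes "in_box T R M" "1 \<le> a" shows "finite {b. T b = a \<and> P b}"
proof (rule finite_subset)
  show "{b. T b = a \<and> P b} \<subseteq> {1..R} \<times> {1..M}"
  proof
    fix b assume "b \<in> {b. T b = a \<and> P b}"
    then have "b \<in> shape T" using assms(2) by (auto simp: shape_def)
    then show "b \<in> {1..R} \<times> {1..M}" using assms(1) by blast
  qed
qed simp

lemma finite_row_entries:
  assumes "in_box T R M" "1 \<le> a" shows "finite {j. a \<le> T (i, j)}"
proof (rule finite_subset)
  show "{j. a \<le> T (i, j)} \<subseteq> {1..M}" using in_boxD[OF assms(1), of i] assms(2) by fastforce
qed simp

lemma finite_col_entries:
  assumes "in_box T R M" "1 \<le> a" shows "finite {i. a \<le> T (i, j)}"
proof (rule finite_subset)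
  show "{i. a \<le> T (i, j)} \<subseteq> {1..R}" using in_boxD[OF assms(1), of _ j] assms(2) by fastforce
qed simp

lemma col_content_Suc:
  assumes "in_box T R M" "1 \<le> a"
  shows "col_content T c a = col_content T (Suc c) a + card {i. T (i, Suc c) = a}"
proof -
  have "{b. T b = a \<and> c < snd b} = {b. T b = a \<and> Suc c < snd b} \<union> {b. T b = a \<and> snd b = Suc c}"
    by auto
  moreover have "{b. T b = a \<and> snd b = Suc c} = (\<lambda>i. (i, Suc c)) ` {i. T (i, Suc c) = a}"
    by force
  then have "card {b. T b = a \<and> snd b = Suc c} = card {i. T (i, Suc c) = a}"
    by (simp add: card_image inj_on_def)
  moreover have "{b. T b = a \<and> Suc c < snd b} \<inter> {b. T b = a \<and> snd b = Suc c} = {}" by auto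
  ultimately show ?thesis unfolding col_content_def
    using card_Un_disjoint[OF finite_entries[OF assms] finite_entries[OF assms]] by simp
qed

lemma row_content_Suc:
  assumes "in_box T R M" "1 \<le> a"
  shows "row_content T (Suc i) a = row_content T i a + card {j. T (Suc i, j) = a}"
proof -
  have "{b. T b = a \<and> fst b \<le> Suc i} = {b. T b = a \<and> fst b \<le> i} \<union> {b. T b = a \<and> fst b = Suc i}"
    by auto
  moreover have "{b. T b = a \<and> fst b = Suc i} = (\<lambda>j. (Suc i, j)) ` {j. T (Suc i, j) = a}"
    by force
  then have "card {b. T b = a \<and> fst b = Suc i} = card {j. T (Suc i, j) = a}"
    by (simp add: card_image inj_on_def)
  moreover have "{b. T b = a \<and> fst b \<le> i} \<inter> {b. T b = a \<and> fst b = Suc i} = {}" by auto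
  ultimately show ?thesis unfolding row_content_def
    using card_Un_disjoint[OF finite_entries[OF assms] finite_entries[OF assms]] by simp
qed

lemma col_content_0:
  assumes "in_box T R M" "1 \<le> a" "M \<le> c" shows "col_content T c a = 0"
proof -
  have "{b. T b = a \<and> c < snd b} = {}" using in_box_entry[OF assms(1) _ assms(2)] assms(3)
    by (metis (mono_tags, lifting) Collect_empty_eq leD le_trans)
  then show ?thesis unfolding col_content_def by (simp only: card.empty)
qed

lemma row_content_0:
  assumes "in_box T R M" "1 \<le> a" shows "row_content T 0 a = 0"
proof -
  have "{b. T b = a \<and> fst b \<le> 0} = {}" using in_box_entry[OF assms(1) _ assms(2)]
    by (metis (mono_tags, lifting) Collect_empty_eq not_one_le_zero le_trans)
  then show ?thesis unfolding row_content_def by (simp only: card.empty)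
qed

lemma row_content_all:
  assumes "in_box T R M" "1 \<le> a" shows "row_content T R a = col_content T 0 a"
proof -
  have "{b. T b = a \<and> fst b \<le> R} = {b. T b = a \<and> 0 < snd b}"
    using in_box_entry[OF assms(1) _ assms(2)] by (auto simp: Suc_le_eq)
  then show ?thesis by (simp add: row_content_def col_content_def)
qed

lemma count_list_map: "distinct xs \<Longrightarrow> count_list (map f xs) a = card {x \<in> set xs. f x = a}"
proof (induction xs)
  case (Cons x xs)
  have "{y \<in> set (x # xs). f y = a} = (if f x = a then insert x {y \<in> set xs. f y = a} else {y \<in> set xs. f y = a})"
    by auto
  then show ?case using Cons by auto
qed simp

lemma finite_col_rows: "in_box T R M \<Longrightarrow> finite {i. (i, j) \<in> shape T}"
  by (rule finite_subset[of _ "{1..R}"]) auto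

lemma count_list_column:
  assumes "in_box T R M" "1 \<le> a"
  shows "count_list (column T j) a = card {i. T (i, j) = a}"
proof -
  have "count_list (column T j) a = card {i \<in> {i. (i, j) \<in> shape T}. T (i, j) = a}"
    unfolding column_def
    by (subst count_list_map) (auto simp: finite_col_rows[OF assms(1)])
  also have "{i \<in> {i. (i, j) \<in> shape T}. T (i, j) = a} = {i. T (i, j) = a}"
    using assms(2) by (auto simp: shape_def)
  finally show ?thesis .
qed

definition col_strict :: "tableau \<Rightarrow> bool" where
  "col_strict T \<longleftrightarrow> (\<forall>i i' j. T (i, j) \<noteq> 0 \<and> T (i', j) \<noteq> 0 \<and> i < i' \<longrightarrow> T (i, j) < T (i', j))"

lemma sorted_column:
  assumes "in_box T R M" "col_strict T" shows "sorted_wrt (<) (column T j)"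
proof -
  have "sorted_wrt (<) (sorted_list_of_set {i. (i, j) \<in> shape T})"
    by (rule strict_sorted_list_of_set)
  then show ?thesis unfolding column_def sorted_wrt_map
    by (rule sorted_wrt_mono_rel[rotated])
      (use assms(2) in \<open>auto simp: col_strict_def shape_def finite_col_rows[OF assms(1), unfolded shape_def, simplified]\<close>)
qed

lemma zero_notin_column: "in_box T R M \<Longrightarrow> 0 \<notin> set (column T j)"
  using finite_col_rows[of T R M j] by (auto simp: column_def shape_def)

text \<open>The part of the word of \<open>T\<close> that comes from the columns to the right of \<open>c\<close>; the parameter \<open>M\<close>
  may be any upper bound for the number of columns, as empty columns contribute nothing.\<close>

definition cols_word :: "tableau \<Rightarrow> nat \<Rightarrow> nat \<Rightarrow> nat list" where
  "cols_word T M c = concat (map (column T) (rev [Suc c..<Suc M]))"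

lemma cols_word_Suc: "c < M \<Longrightarrow> cols_word T M c = cols_word T M (Suc c) @ column T (Suc c)"
  by (simp add: cols_word_def upt_conv_Cons del: upt_Suc)

lemma word_cols_word:
  assumes "in_box T R M" shows "word T = cols_word T M 0"
proof -
  let ?m = "Max (insert 0 (snd ` shape T))"
  have fin: "finite (shape T)" by (rule finite_subset[OF assms]) simp
  have m: "?m \<le> M" using fin assms by (subst Max_le_iff) auto
  have "column T j = []" if "?m < j" for j
  proof -
    have "{i. (i, j) \<in> shape T} = {}"
    proof (rule ccontr)
      assume "\<not> ?thesis"
      then have "j \<in> insert 0 (snd ` shape T)" by force
      then have "j \<le> ?m" using fin by (intro Max_ge) auto
      then show False using that by simp
    qed
    then show ?thesis by (simp add: column_def)
  qed
  then have "concat (map (column T) (rev [Suc ?m..<Suc M])) = []" by auto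
  moreover have "[1..<Suc M] = [1..<Suc ?m] @ [Suc ?m..<Suc M]"
    using m upt_add_eq_append[of 1 "Suc ?m" "M - ?m"] by simp
  ultimately show ?thesis
    by (simp add: word_def columns_def cols_word_def rev_map del: upt_Suc)
qed

lemma count_list_cols_word:
  assumes "in_box T R M" "1 \<le> a" "c \<le> M"
  shows "count_list (cols_word T M c) a = col_content T c a"
  using assms(3)
proof (induction rule: inc_induct)
  case base
  then show ?case using col_content_0[OF assms(1,2)] by (simp add: cols_word_def)
next
  case (step c)
  then show ?case using col_content_Suc[OF assms(1,2), of c] count_list_column[OF assms(1,2)]
    by (simp add: cols_word_Suc)
qed

lemma count_list_word: "in_box T R M \<Longrightarrow> 1 \<le> a \<Longrightarrow> count_list (word T) a = col_content T 0 a"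
  by (simp add: word_cols_word count_list_cols_word)

lemma zero_notin_word: "in_box T R M \<Longrightarrow> 0 \<notin> set (word T)"
  using zero_notin_column by (auto simp: word_cols_word cols_word_def simp del: upt_Suc)

lemma lattice_cols_word:
  assumes box: "in_box T R M" and cs: "col_strict T" and \<nu>: "decr \<nu>" and c: "c \<le> M"
  shows "lattice \<nu> (cols_word T M c) \<longleftrightarrow> (\<forall>d\<ge>c. decr (\<lambda>a. \<nu> a + col_content T d a))"
  using c
proof (induction rule: inc_induct)
  case base
  have "decr (\<lambda>a. \<nu> a + col_content T d a)" if "d \<ge> M" for d
    using \<nu> col_content_0[OF box _ that] by (subst decr_cong[of _ \<nu>]) auto
  then show ?case using \<nu> by (simp add: cols_word_def)
next
  case (step c)
  let ?\<kappa> = "\<lambda>a. \<nu> a + col_content T (Suc c) a"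
  have "lattice \<nu> (cols_word T M c) \<longleftrightarrow> lattice \<nu> (cols_word T M (Suc c))
      \<and> lattice (\<lambda>a. \<nu> a + count_list (cols_word T M (Suc c)) a) (column T (Suc c))"
    using step by (simp add: cols_word_Suc lattice_append)
  also have "lattice (\<lambda>a. \<nu> a + count_list (cols_word T M (Suc c)) a) (column T (Suc c))
      \<longleftrightarrow> lattice ?\<kappa> (column T (Suc c))"
    using step count_list_cols_word[OF box] zero_notin_column[OF box]
    by (intro lattice_cong) auto
  also have "lattice \<nu> (cols_word T M (Suc c)) \<and> lattice ?\<kappa> (column T (Suc c)) \<longleftrightarrow>
     (\<forall>d\<ge>Suc c. decr (\<lambda>a. \<nu> a + col_content T d a)) \<and> decr (\<lambda>a. \<nu> a + col_content T c a)"
  proof (cases "\<forall>d\<ge>Suc c. decr (\<lambda>a. \<nu> a + col_content T d a)")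
    case True
    then have "decr ?\<kappa>" by auto
    then have "lattice ?\<kappa> (column T (Suc c)) \<longleftrightarrow> decr (\<lambda>a. ?\<kappa> a + count_list (column T (Suc c)) a)"
      by (rule lattice_increasing[OF sorted_column[OF box cs] zero_notin_column[OF box]])
    also have "\<dots> \<longleftrightarrow> decr (\<lambda>a. \<nu> a + col_content T c a)"
      using col_content_Suc[OF box, of _ c] count_list_column[OF box]
      by (intro decr_cong) auto
    finally show ?thesis using True step.IH by auto
  qed (use step.IH in auto)
  also have "\<dots> \<longleftrightarrow> (\<forall>d\<ge>c. decr (\<lambda>a. \<nu> a + col_content T d a))"
    using Suc_le_eq nat_less_le by auto
  finally show ?case .
qed

text \<open>Columns are increasing words, so prefixes that end inside a column impose no further
  condition.\<close>

lemma lattice_word: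
  assumes "in_box T R M" "col_strict T" "decr \<nu>"
  shows "lattice \<nu> (word T) \<longleftrightarrow> (\<forall>d. decr (\<lambda>a. \<nu> a + col_content T d a))"
  using lattice_cols_word[OF assms, of 0] word_cols_word[OF assms(1)] by simp

lemma SST_col_strict: "T \<in> SST D \<Longrightarrow> col_strict T"
  by (auto simp: SST_def col_strict_def shape_def)

lemma LR_iff:
  assumes D: "D \<subseteq> {1..R} \<times> {1..M}" and "is_partition \<epsilon>" "is_partition \<kappa>"
  shows "T \<in> LR D \<epsilon> \<kappa> \<longleftrightarrow> T \<in> SST D \<and> (\<forall>c. decr (\<lambda>a. part \<epsilon> a + col_content T c a))
    \<and> (\<forall>a\<ge>1. part \<kappa> a = part \<epsilon> a + col_content T 0 a)"
proof (cases "T \<in> SST D")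
  case True
  then have box: "in_box T R M" using D by (auto simp: SST_def)
  note lat = lattice_word[OF box SST_col_strict[OF True] is_shape_decr[OF is_shape_part[OF assms(2)]]]
  note pos = zero_notin_word[OF box]
  have LR: "T \<in> LR D \<epsilon> \<kappa> \<longleftrightarrow> fold col_insert (word T) (highest (part \<epsilon>)) = highest (part \<kappa>)"
    using True by (simp add: LR_def tab_insert_def H_tab_highest)
  show ?thesis
  proof (cases "lattice (part \<epsilon>) (word T)")
    case lattice: True
    have "fold col_insert (word T) (highest (part \<epsilon>)) = highest (\<lambda>a. part \<epsilon> a + count_list (word T) a)"
      using fold_col_insert_lattice[OF is_shape_part[OF assms(2)] pos lattice] by simp
    then have "T \<in> LR D \<epsilon> \<kappa> \<longleftrightarrow> (\<forall>a\<ge>1. part \<kappa> a = part \<epsilon> a + col_content T 0 a)"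
      unfolding LR highest_eq_iff using count_list_word[OF box]
      by (simp add: highest_eq_iff) metis
    then show ?thesis using True lat lattice by auto
  next
    case False
    then show ?thesis
      using fold_col_insert_not_lattice[OF is_shape_part[OF assms(2)] pos False is_shape_part[OF assms(3)]]
        lat LR by auto
  qed
qed (simp add: LR_def)

lemma insert_chain_highest:
  assumes "is_shape (\<nu> 0)"
    and "\<And>i. i < p \<Longrightarrow> 0 \<notin> set (word (P (Suc i))) \<and> lattice (\<nu> i) (word (P (Suc i)))
      \<and> (\<forall>a\<ge>1. \<nu> (Suc i) a = \<nu> i a + count_list (word (P (Suc i))) a)"
  shows "i \<le> p \<Longrightarrow> insert_chain P (highest (\<nu> 0)) i = highest (\<nu> i) \<and> is_shape (\<nu> i)"
proof (induction i)
  case 0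
  then show ?case using assms(1) by simp
next
  case (Suc i)
  let ?\<kappa> = "\<lambda>a. \<nu> i a + count_list (word (P (Suc i))) a"
  have "fold col_insert (word (P (Suc i))) (highest (\<nu> i)) = highest ?\<kappa> \<and> is_shape ?\<kappa>"
    using Suc assms(2)[of i] by (intro fold_col_insert_lattice) auto
  moreover have eq: "\<forall>a\<ge>1. \<nu> (Suc i) a = ?\<kappa> a" using Suc assms(2)[of i] by auto
  moreover have "highest (\<nu> (Suc i)) = highest ?\<kappa>" using eq by (simp add: highest_eq_iff)
  moreover have "is_shape (\<nu> (Suc i)) \<longleftrightarrow> is_shape ?\<kappa>" unfolding is_shape_def using eq by auto
  ultimately show ?case using Suc by (simp add: tab_insert_def)
qed

lemma is_shape_cong: "(\<And>a. 1 \<le> a \<Longrightarrow> \<nu> a = \<kappa> a) \<Longrightarrow> is_shape \<nu> \<longleftrightarrow> is_shape \<kappa>"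
  by (simp add: is_shape_def)

lemma restrict_in_box: "in_box T R M \<Longrightarrow> in_box (restrict_tab T B) R M"
  by (auto simp: restrict_tab_def shape_def)

lemma restrict_col_strict: "col_strict T \<Longrightarrow> col_strict (restrict_tab T B)"
  by (auto simp: restrict_tab_def col_strict_def)

text \<open>Each piece is a single column, and the contents reached are those of \<open>col_content\<close>.\<close>

lemma insert_chain_columns:
  assumes box: "in_box S R p" and cs: "col_strict S" and "is_partition \<epsilon>"
    and d: "\<And>c. decr (\<lambda>a. part \<epsilon> a + col_content S c a)" and "i \<le> p"
  shows "shape (insert_chain (\<lambda>k. restrict_tab S {b. snd b = p + 1 - k}) (H_tab \<epsilon>) i)
    = young (\<lambda>a. part \<epsilon> a + col_content S (p - i) a)
    \<and> is_shape (\<lambda>a. part \<epsilon> a + col_content S (p - i) a)"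
proof -
  let ?\<nu> = "\<lambda>i a. part \<epsilon> a + col_content S (p - i) a"
  let ?P = "\<lambda>k. restrict_tab S {b. snd b = p + 1 - k}"
  have 0: "part \<epsilon> a = ?\<nu> 0 a" if "1 \<le> a" for a using col_content_0[OF box that] by simp
  have H: "H_tab \<epsilon> = highest (?\<nu> 0)" unfolding H_tab_highest highest_eq_iff using 0 by blast
  have "insert_chain ?P (highest (?\<nu> 0)) i = highest (?\<nu> i) \<and> is_shape (?\<nu> i)"
  proof (rule insert_chain_highest[OF _ _ \<open>i \<le> p\<close>])
    show "is_shape (?\<nu> 0)" using is_shape_part[OF assms(3)] is_shape_cong[OF 0] by simp
    fix i assume i: "i < p"
    let ?T = "?P (Suc i)"
    note rbox = restrict_in_box[OF box, of "{b. snd b = p + 1 - Suc i}"]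
    have cc: "col_content ?T d a = (if d < p - i then card {l. S (l, p - i) = a} else 0)" if "1 \<le> a" for d a
    proof -
      have "{b. ?T b = a \<and> d < snd b} = (if d < p - i then (\<lambda>l. (l, p - i)) ` {l. S (l, p - i) = a} else {})"
        using that i by (auto simp: restrict_tab_def)
      then show ?thesis by (simp add: col_content_def card_image inj_on_def)
    qed
    have step: "?\<nu> (Suc i) a = ?\<nu> i a + card {l. S (l, p - i) = a}" if "1 \<le> a" for a
    proof -
      have "Suc (p - Suc i) = p - i" using i by simp
      then show ?thesis using col_content_Suc[OF box that, of "p - Suc i"] that by simp
    qed
    have "decr (\<lambda>a. ?\<nu> i a + col_content ?T d a)" for d
    proof (cases "d < p - i")
      case True
      then show ?thesis using d[of "p - Suc i"] cc step by (subst decr_cong[of _ "?\<nu> (Suc i)"]) auto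
    next
      case False
      then show ?thesis using d[of "p - i"] cc by (subst decr_cong[of _ "?\<nu> i"]) auto
    qed
    then have "lattice (?\<nu> i) (word ?T)"
      using lattice_word[OF rbox restrict_col_strict[OF cs] d] by blast
    moreover have "\<forall>a\<ge>1. ?\<nu> (Suc i) a = ?\<nu> i a + count_list (word ?T) a"
      using count_list_word[OF rbox] cc step i by auto
    ultimately show "0 \<notin> set (word ?T) \<and> lattice (?\<nu> i) (word ?T)
        \<and> (\<forall>a\<ge>1. ?\<nu> (Suc i) a = ?\<nu> i a + count_list (word ?T) a)"
      using zero_notin_word[OF rbox] by blast
  qed
  then show ?thesis by (simp add: H shape_highest)
qed

text \<open>A row is read from right to left, hence in decreasing order: when letters \<open>a + 1\<close> are added, no
  letter \<open>a\<close> of that row has been added yet. This is why the steps have to be horizontal strips.\<close>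

lemma insert_chain_rows:
  assumes box: "in_box U p M" and cs: "col_strict U" and "is_partition \<epsilon>"
    and strip: "\<And>i a. i < p \<Longrightarrow> 1 \<le> a \<Longrightarrow>
      part \<epsilon> (Suc a) + row_content U (Suc i) (Suc a) \<le> part \<epsilon> a + row_content U i a" and "i \<le> p"
  shows "shape (insert_chain (\<lambda>k. restrict_tab U {b. fst b = k}) (H_tab \<epsilon>) i)
    = young (\<lambda>a. part \<epsilon> a + row_content U i a)
    \<and> is_shape (\<lambda>a. part \<epsilon> a + row_content U i a)"
proof -
  let ?\<nu> = "\<lambda>i a. part \<epsilon> a + row_content U i a"
  let ?P = "\<lambda>k. restrict_tab U {b. fst b = k}"
  have 0: "part \<epsilon> a = ?\<nu> 0 a" if "1 \<le> a" for a using row_content_0[OF box that] by simp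
  have H: "H_tab \<epsilon> = highest (?\<nu> 0)" unfolding H_tab_highest highest_eq_iff using 0 by blast
  have "insert_chain ?P (highest (?\<nu> 0)) i = highest (?\<nu> i) \<and> is_shape (?\<nu> i)"
  proof (rule insert_chain_highest[OF _ _ \<open>i \<le> p\<close>])
    show "is_shape (?\<nu> 0)" using is_shape_part[OF assms(3)] is_shape_cong[OF 0] by simp
    fix i assume i: "i < p"
    let ?T = "?P (Suc i)"
    note rbox = restrict_in_box[OF box, of "{b. fst b = Suc i}"]
    have eq: "{b. ?T b = a \<and> d < snd b} = (\<lambda>j. (Suc i, j)) ` {j. U (Suc i, j) = a \<and> d < j}" if "1 \<le> a" for a d
      using that by (auto simp: restrict_tab_def)
    have cc: "col_content ?T d a = card {j. U (Suc i, j) = a \<and> d < j}" if "1 \<le> a" for a d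
      unfolding col_content_def eq[OF that] by (simp add: card_image inj_on_def)
    have step: "?\<nu> (Suc i) a = ?\<nu> i a + card {j. U (Suc i, j) = a}" if "1 \<le> a" for a
      using row_content_Suc[OF box that, of i] that by simp
    have fin: "finite {j. U (Suc i, j) = a}" if "1 \<le> a" for a
      by (rule finite_subset[OF _ finite_row_entries[OF box that, of "Suc i"]]) auto
    have cc_le: "col_content ?T d a \<le> card {j. U (Suc i, j) = a}" if "1 \<le> a" for a d
      unfolding cc[OF that] by (rule card_mono[OF fin[OF that]]) auto
    have dec: "decr (?\<nu> i)"
      unfolding decr_def
    proof (intro allI impI)
      fix a :: nat assume a: "a \<ge> 1"
      have "row_content U i (Suc a) \<le> row_content U (Suc i) (Suc a)"
        using row_content_Suc[OF box, of "Suc a" i] by simp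
      then show "?\<nu> i (Suc a) \<le> ?\<nu> i a" using strip[OF i a] a by simp
    qed
    have "decr (\<lambda>a. ?\<nu> i a + col_content ?T d a)" for d
      unfolding decr_def
    proof (intro allI impI)
      fix a :: nat assume a: "a \<ge> 1"
      have "?\<nu> i (Suc a) + col_content ?T d (Suc a) \<le> ?\<nu> (Suc i) (Suc a)"
        using cc_le[of "Suc a" d] step[of "Suc a"] by simp
      also have "\<dots> \<le> ?\<nu> i a" using strip[OF i a] a by simp
      finally show "?\<nu> i (Suc a) + col_content ?T d (Suc a) \<le> ?\<nu> i a + col_content ?T d a" by simp
    qed
    then have "lattice (?\<nu> i) (word ?T)"
      using lattice_word[OF rbox restrict_col_strict[OF cs] dec] by blast
    moreover have "{j. U (Suc i, j) = a \<and> 0 < j} = {j. U (Suc i, j) = a}" if "1 \<le> a" for a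
      using in_boxD[OF box, of "Suc i"] that by (intro Collect_cong) (metis less_eq_Suc_le not_one_le_zero One_nat_def)
    then have "\<forall>a\<ge>1. ?\<nu> (Suc i) a = ?\<nu> i a + count_list (word ?T) a"
      using count_list_word[OF rbox] cc step by simp
    ultimately show "0 \<notin> set (word ?T) \<and> lattice (?\<nu> i) (word ?T)
        \<and> (\<forall>a\<ge>1. ?\<nu> (Suc i) a = ?\<nu> i a + count_list (word ?T) a)"
      using zero_notin_word[OF rbox] by blast
  qed
  then show ?thesis by (simp add: H shape_highest)
qed

text \<open>Semistandard tableaux whose rows end at the right border and whose columns end at the bottom of a
  \<open>p \<times> M\<close> rectangle. As the value outside the shape is 0, the rows increase weakly over their
  whole length \<open>M\<close>.\<close>

definition anti_std :: "nat \<Rightarrow> nat \<Rightarrow> tableau \<Rightarrow> bool" where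
  "anti_std p M U \<longleftrightarrow> in_box U p M
     \<and> (\<forall>i j j'. 1 \<le> j \<and> j \<le> j' \<and> j' \<le> M \<longrightarrow> U (i, j) \<le> U (i, j'))
     \<and> (\<forall>i i' j. U (i, j) \<noteq> 0 \<and> i < i' \<and> i' \<le> p \<longrightarrow> U (i, j) < U (i', j))"

lemma anti_std_box: "anti_std p M U \<Longrightarrow> in_box U p M"
  by (simp add: anti_std_def)

lemma anti_std_row:
  "anti_std p M U \<Longrightarrow> 1 \<le> j \<Longrightarrow> j \<le> j' \<Longrightarrow> j' \<le> M \<Longrightarrow> U (i, j) \<le> U (i, j')"
  by (simp add: anti_std_def)

lemma anti_std_col:
  "anti_std p M U \<Longrightarrow> U (i, j) \<noteq> 0 \<Longrightarrow> i < i' \<Longrightarrow> i' \<le> p \<Longrightarrow> U (i, j) < U (i', j)"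
  unfolding anti_std_def by blast

lemma anti_std_strict: "anti_std p M U \<Longrightarrow> col_strict U"
  unfolding anti_std_def col_strict_def by (metis in_boxD)

text \<open>If row \<open>i + 1\<close> contains \<open>a + 1\<close>, let \<open>j\<close> be the leftmost such column. All letters \<open>a + 1\<close> of the
  first \<open>i + 1\<close> rows then lie in the columns from \<open>j\<close> on, and the letters \<open>a\<close> of these columns lie in the
  first \<open>i\<close> rows. So the claim follows from the condition for the columns from \<open>j\<close> on.\<close>

lemma strip_of_cols:
  assumes U: "anti_std p M U" and d: "\<And>c. decr (\<lambda>a. \<delta> a + col_content U c a)" and a: "1 \<le> a"
  shows "i \<le> p \<Longrightarrow> \<delta> (Suc a) + row_content U i (Suc a) \<le> \<delta> a + row_content U (i - 1) a"
proof (induction i)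
  case 0
  note box = anti_std_box[OF U]
  have "\<delta> (Suc a) + col_content U M (Suc a) \<le> \<delta> a + col_content U M a"
    using d[of M] a by (auto simp: decr_def)
  then show ?case using a row_content_0[OF box] col_content_0[OF box] by simp
next
  case (Suc i)
  note box = anti_std_box[OF U] and row = anti_std_row[OF U] and col = anti_std_col[OF U]
  show ?case
  proof (cases "\<exists>j. U (Suc i, j) = Suc a")
    case False
    then have "{j. U (Suc i, j) = Suc a} = {}" by auto
    then have "row_content U (Suc i) (Suc a) = row_content U i (Suc a)"
      using row_content_Suc[OF box, of "Suc a" i] by simp
    moreover have "row_content U (i - 1) a \<le> row_content U i a"
      using row_content_Suc[OF box a, of "i - 1"] by (cases i) auto
    ultimately show ?thesis using Suc by simp
  next
    case True
    define j where "j = (LEAST j. U (Suc i, j) = Suc a)"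
    have j: "U (Suc i, j) = Suc a" unfolding j_def using True by (rule LeastI_ex)
    have least: "U (Suc i, j') \<noteq> Suc a" if "j' < j" for j'
      using not_less_Least that unfolding j_def by blast
    have jM: "1 \<le> j" "j \<le> M" "Suc i \<le> p" using in_boxD[OF box, of "Suc i" j] j by auto
    have "{b. U b = Suc a \<and> fst b \<le> Suc i} \<subseteq> {b. U b = Suc a \<and> j - 1 < snd b}"
    proof clarsimp
      fix i' j' assume h: "U (i', j') = Suc a" "i' \<le> Suc i"
      then have j': "1 \<le> j'" using in_boxD[OF box, of i' j'] by auto
      show "j - Suc 0 < j'"
      proof (rule ccontr)
        assume "\<not> j - Suc 0 < j'"
        then have "j' < j" using jM by simp
        then have "i' < Suc i" using least h by (metis le_neq_implies_less)
        moreover have "Suc a \<le> U (i', j)" using row[of j' j i'] h j' jM \<open>j' < j\<close> by simp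
        ultimately have "U (i', j) < U (Suc i, j)" using jM by (intro col) auto
        then show False using \<open>Suc a \<le> U (i', j)\<close> j by simp
      qed
    qed
    then have 1: "row_content U (Suc i) (Suc a) \<le> col_content U (j - 1) (Suc a)"
      unfolding row_content_def col_content_def by (rule card_mono[rotated]) (simp add: finite_entries[OF box])
    have "{b. U b = a \<and> j - 1 < snd b} \<subseteq> {b. U b = a \<and> fst b \<le> i}"
    proof clarsimp
      fix i' j' assume h: "a = U (i', j')" "j - Suc 0 < j'"
      then have b: "i' \<le> p" "j' \<le> M" using in_boxD[OF box, of i' j'] a by auto
      show "i' \<le> i"
      proof (rule ccontr)
        assume "\<not> i' \<le> i"
        moreover have "Suc a \<le> U (Suc i, j')" using row[of j j' "Suc i"] h(2) b j jM by simp
        moreover have "U (Suc i, j') < U (i', j')" if "Suc i < i'"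
          using calculation that b by (intro col) auto
        ultimately show False using h(1) by (cases "i' = Suc i") auto
      qed
    qed
    then have 2: "col_content U (j - 1) a \<le> row_content U i a"
      unfolding row_content_def col_content_def
      by (rule card_mono[rotated]) (simp add: finite_entries[OF box a])
    have "\<delta> (Suc a) + col_content U (j - 1) (Suc a) \<le> \<delta> a + col_content U (j - 1) a"
      using d[of "j - 1"] a by (auto simp: decr_def)
    then show ?thesis using 1 2 by simp
  qed
qed

text \<open>Compare the columns right of \<open>c\<close> with the first rows.
  The letters \<open>a + 1\<close> in the first \<open>i\<close> rows but not in these columns stand in row \<open>i\<close>. Below each
  letter \<open>a\<close> of the first \<open>i - 1\<close> rows outside these columns, row \<open>i\<close> has such an \<open>a + 1\<close>. Hence
  passing from rows to columns loses at least as many letters \<open>a + 1\<close> as letters \<open>a\<close>.\<close>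

lemma content_right_of_entry:
  assumes U: "anti_std p M U" and strip: "\<And>i a. i < p \<Longrightarrow> 1 \<le> a \<Longrightarrow>
      \<delta> (Suc a) + row_content U (Suc i) (Suc a) \<le> \<delta> a + row_content U i a"
    and a: "1 \<le> a" and i: "U (i, Suc c) = Suc a"
  shows "\<delta> (Suc a) + col_content U c (Suc a) \<le> \<delta> a + col_content U c a"
proof -
  note box = anti_std_box[OF U] and row = anti_std_row[OF U] and col = anti_std_col[OF U]
  have ip: "1 \<le> i" "i \<le> p" "Suc c \<le> M" using in_boxD[OF box, of i "Suc c"] i by auto
  let ?A = "{b. U b = Suc a \<and> c < snd b}"
  let ?X = "{b. U b = Suc a \<and> fst b = i \<and> snd b \<le> c}"
  let ?Y = "{b. U b = a \<and> fst b \<le> i - 1 \<and> snd b \<le> c}"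
  have fin: "finite {b. U b = Suc a \<and> P b}" "finite {b. U b = a \<and> P b}" for P
    using finite_entries[OF box] a by auto
  have "?A \<union> ?X \<subseteq> {b. U b = Suc a \<and> fst b \<le> i}"
  proof (rule subsetI)
    fix b assume b: "b \<in> ?A \<union> ?X"
    obtain i' j' where ij: "b = (i', j')" by force
    have h: "U (i', j') = Suc a" "c < j' \<or> i' = i \<and> j' \<le> c" using b ij by auto
    have "i' \<le> i"
    proof (rule ccontr)
      assume "\<not> i' \<le> i"
      moreover have b: "i' \<le> p" "j' \<le> M" using h in_boxD[OF box, of i' j'] by auto
      moreover have "Suc a \<le> U (i, j')" using row[of "Suc c" j' i] h b i \<open>\<not> i' \<le> i\<close> by auto
      ultimately have "U (i, j') < U (i', j')" by (intro col) auto
      then show False using h \<open>Suc a \<le> U (i, j')\<close> by simp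
    qed
    then show "b \<in> {b. U b = Suc a \<and> fst b \<le> i}" using h ij by simp
  qed
  then have "card (?A \<union> ?X) \<le> row_content U i (Suc a)"
    unfolding row_content_def by (intro card_mono fin)
  moreover have "card (?A \<union> ?X) = card ?A + card ?X"
    by (rule card_Un_disjoint) (use fin in auto)
  ultimately have 1: "col_content U c (Suc a) + card ?X \<le> row_content U i (Suc a)"
    by (simp add: col_content_def)
  have "{b. U b = a \<and> fst b \<le> i - 1} \<subseteq> {b. U b = a \<and> c < snd b} \<union> ?Y" by auto
  then have "row_content U (i - 1) a \<le> card ({b. U b = a \<and> c < snd b} \<union> ?Y)"
    unfolding row_content_def by (intro card_mono) (use fin in auto)
  also have "\<dots> \<le> col_content U c a + card ?Y"
    unfolding col_content_def by (rule card_Un_le)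
  finally have 2: "row_content U (i - 1) a \<le> col_content U c a + card ?Y" .
  have 3: "card ?Y \<le> card ?X"
  proof (rule card_inj_on_le[of "\<lambda>b. (i, snd b)"])
    show "inj_on (\<lambda>b. (i, snd b)) ?Y"
    proof (rule inj_onI)
      fix b b' assume h: "b \<in> ?Y" "b' \<in> ?Y" "(i, snd b) = (i, snd b')"
      obtain x z y where b: "b = (x, z)" "b' = (y, z)" using h(3) by (cases b; cases b') auto
      have "x \<le> p" "y \<le> p" using h(1,2) b ip by auto
      then have "\<not> x < y" using col[of x z y] h(1,2) b ip a by auto
      moreover have "\<not> y < x" using col[of y z x] h(1,2) b \<open>x \<le> p\<close> a by auto
      ultimately show "b = b'" using b by simp
    qed
    show "(\<lambda>b. (i, snd b)) ` ?Y \<subseteq> ?X"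
    proof (rule image_subsetI)
      fix b assume b: "b \<in> ?Y"
      obtain x z where xz: "b = (x, z)" by force
      have h: "U (x, z) = a" "x \<le> i - 1" "z \<le> c" using b xz by auto
      have z: "1 \<le> z" using in_box_entry[OF box h(1) a] by simp
      have "U (x, z) < U (i, z)" using h a ip by (intro col) auto
      moreover have "U (i, z) \<le> Suc a" using row[of z "Suc c" i] h z ip i by simp
      ultimately show "(i, snd b) \<in> ?X" using h xz by simp
    qed
  qed (use fin in auto)
  have "\<delta> (Suc a) + row_content U i (Suc a) \<le> \<delta> a + row_content U (i - 1) a"
    using strip[of "i - 1" a] ip a by simp
  then show ?thesis using 1 2 3 by linarith
qed

lemma cols_of_strip:
  assumes U: "anti_std p M U" and \<delta>: "decr \<delta>"
    and strip: "\<And>i a. i < p \<Longrightarrow> 1 \<le> a \<Longrightarrow>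
      \<delta> (Suc a) + row_content U (Suc i) (Suc a) \<le> \<delta> a + row_content U i a"
  shows "decr (\<lambda>a. \<delta> a + col_content U c a)"
proof -
  note box = anti_std_box[OF U]
  have big: "decr (\<lambda>a. \<delta> a + col_content U c a)" if "M \<le> c" for c
    using \<delta> col_content_0[OF box _ that] by (subst decr_cong[of _ \<delta>]) auto
  have "c \<le> M \<Longrightarrow> decr (\<lambda>a. \<delta> a + col_content U c a)" for c
  proof (induction rule: inc_induct)
    case base
    then show ?case using big by simp
  next
    case (step c)
    show ?case unfolding decr_def
    proof (intro allI impI)
      fix a :: nat assume a: "a \<ge> 1"
      show "\<delta> (Suc a) + col_content U c (Suc a) \<le> \<delta> a + col_content U c a"
      proof (cases "\<exists>i. U (i, Suc c) = Suc a")
        case False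
        then have "{i. U (i, Suc c) = Suc a} = {}" by auto
        then have "col_content U c (Suc a) = col_content U (Suc c) (Suc a)"
          using col_content_Suc[OF box, of "Suc a" c] by simp
        moreover have "col_content U (Suc c) a \<le> col_content U c a"
          using col_content_Suc[OF box a, of c] by simp
        ultimately show ?thesis using step.IH a by (fastforce simp: decr_def)
      next
        case True
        then obtain i where "U (i, Suc c) = Suc a" by blast
        then show ?thesis using content_right_of_entry[OF U strip a] by blast
      qed
    qed
  qed
  then show ?thesis using big by (cases "c \<le> M") auto
qed

section \<open>Chains of horizontal strips\<close>

text \<open>Tableaux and strips are compared letter by letter; this turns equal multiplicities into equal
  counts of the letters in a set.\<close>

lemma card_fibres_eq:
  assumes "finite A" "finite B"
    and eq: "\<And>v. v \<in> V \<Longrightarrow> card {z \<in> A. f z = v} = card {z \<in> B. g z = v}"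
  shows "card {z \<in> A. f z \<in> V} = card {z \<in> B. g z \<in> V}"
proof -
  let ?W = "(f ` A \<union> g ` B) \<inter> V"
  have W: "finite ?W" using assms by auto
  have "card {z \<in> A. f z \<in> V} = card (\<Union>v\<in>?W. {z \<in> A. f z = v})"
    by (rule arg_cong[of _ _ card]) auto
  also have "\<dots> = (\<Sum>v\<in>?W. card {z \<in> A. f z = v})"
    by (rule card_UN_disjoint) (use W assms in auto)
  also have "\<dots> = (\<Sum>v\<in>?W. card {z \<in> B. g z = v})"
    using eq by (intro sum.cong) auto
  also have "\<dots> = card (\<Union>v\<in>?W. {z \<in> B. g z = v})"
    by (rule card_UN_disjoint[symmetric]) (use W assms in auto)
  also have "\<dots> = card {z \<in> B. g z \<in> V}"
    by (rule arg_cong[of _ _ card]) auto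
  finally show ?thesis .
qed

lemma initial_segment:
  assumes "finite S" "\<And>x. x \<in> S \<Longrightarrow> 1 \<le> x" "\<And>x y. x \<in> S \<Longrightarrow> 1 \<le> y \<Longrightarrow> y \<le> x \<Longrightarrow> y \<in> S"
  shows "S = {1..card (S :: nat set)}"
proof (cases "S = {}")
  case False
  let ?m = "Max S"
  have "?m \<in> S" using assms(1) False by simp
  then have "{1..?m} \<subseteq> S" using assms(3)[of ?m] by auto
  moreover have "S \<subseteq> {1..?m}" using assms(2) Max_ge[OF assms(1)] by auto
  ultimately have S: "S = {1..?m}" by (rule equalityI[rotated])
  have "card S = ?m" by (subst S) simp
  then show ?thesis using S by simp
qed simp

text \<open>A chain of Young diagrams, each obtained from the previous one by adding a horizontal strip: a box
  directly below a box \<open>(a, y)\<close> may be added only if \<open>(a, y)\<close> was already present.\<close>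

locale strip_chain =
  fixes p :: nat and Y :: "nat \<Rightarrow> (nat \<times> nat) set"
  assumes finite_Y: "i \<le> p \<Longrightarrow> finite (Y i)"
    and pos_Y: "i \<le> p \<Longrightarrow> (a, y) \<in> Y i \<Longrightarrow> 1 \<le> a \<and> 1 \<le> y"
    and closed_Y: "i \<le> p \<Longrightarrow> (a, y) \<in> Y i \<Longrightarrow> 1 \<le> a' \<Longrightarrow> a' \<le> a \<Longrightarrow> 1 \<le> y' \<Longrightarrow> y' \<le> y \<Longrightarrow> (a', y') \<in> Y i"
    and sub_Y: "i < p \<Longrightarrow> Y i \<subseteq> Y (Suc i)"
    and strip_Y: "i < p \<Longrightarrow> 1 \<le> a \<Longrightarrow> (Suc a, y) \<in> Y (Suc i) \<Longrightarrow> (a, y) \<in> Y i"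
begin

text \<open>The \<open>k\<close>-th strip; its numbers of boxes in the rows from \<open>a\<close> on and in the first \<open>x\<close> columns
  determine the rows and the columns in which its boxes lie.\<close>

definition D :: "nat \<Rightarrow> (nat \<times> nat) set" where
  "D k = Y k - Y (k - 1)"

definition tail :: "nat \<Rightarrow> nat \<Rightarrow> nat" where
  "tail k a = card {b \<in> D k. a \<le> fst b}"

definition head :: "nat \<Rightarrow> nat \<Rightarrow> nat" where
  "head k x = card {b \<in> D k. snd b \<le> x}"

definition rowlen :: "nat \<Rightarrow> nat \<Rightarrow> nat" where
  "rowlen i a = card {y. (a, y) \<in> Y i}"

definition collen :: "nat \<Rightarrow> nat \<Rightarrow> nat" where
  "collen i x = card {a. (a, x) \<in> Y i}"

lemma finite_D: "k \<le> p \<Longrightarrow> finite (D k)"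
  using finite_Y by (simp add: D_def)

lemma finite_row: "i \<le> p \<Longrightarrow> finite {y. (a, y) \<in> Y i}"
  by (rule finite_subset[of _ "snd ` Y i"]) (force simp: finite_Y)+

lemma finite_col: "i \<le> p \<Longrightarrow> finite {a. (a, x) \<in> Y i}"
  by (rule finite_subset[of _ "fst ` Y i"]) (force simp: finite_Y)+

lemma row_eq:
  assumes "i \<le> p" shows "{y. (a, y) \<in> Y i} = {1..rowlen i a}"
  unfolding rowlen_def
proof (rule initial_segment)
  show "y \<in> {y. (a, y) \<in> Y i}" if "x \<in> {y. (a, y) \<in> Y i}" "1 \<le> y" "y \<le> x" for x y
    using that closed_Y[OF assms, of a x a y] pos_Y[OF assms, of a x] by simp
qed (use finite_row[OF assms] pos_Y[OF assms, of a] in auto)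

lemma col_eq:
  assumes "i \<le> p" shows "{a. (a, x) \<in> Y i} = {1..collen i x}"
  unfolding collen_def
proof (rule initial_segment)
  show "b \<in> {a. (a, x) \<in> Y i}" if "a \<in> {a. (a, x) \<in> Y i}" "1 \<le> b" "b \<le> a" for a b
    using that closed_Y[OF assms, of a x b x] pos_Y[OF assms, of a x] by simp
qed (use finite_col[OF assms] pos_Y[OF assms, of _ x] in auto)

lemma mem_row: "i \<le> p \<Longrightarrow> (a, y) \<in> Y i \<longleftrightarrow> 1 \<le> y \<and> y \<le> rowlen i a"
  using row_eq[of i a] by (metis atLeastAtMost_iff mem_Collect_eq)

lemma mem_col: "i \<le> p \<Longrightarrow> (a, y) \<in> Y i \<longleftrightarrow> 1 \<le> a \<and> a \<le> collen i y"
  using col_eq[of i y] by (metis atLeastAtMost_iff mem_Collect_eq)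

lemma young_rowlen: "i \<le> p \<Longrightarrow> young (rowlen i) = Y i"
  using mem_row[of i] pos_Y[of i] by (auto simp: young_def)

lemma young_collen: "i \<le> p \<Longrightarrow> young (collen i) = converse (Y i)"
  using mem_col[of i] pos_Y[of i] by (auto simp: young_def)

lemma decr_collen: "i \<le> p \<Longrightarrow> decr (collen i)"
  unfolding decr_def collen_def
proof (intro allI impI card_mono finite_col)
  fix x :: nat assume "i \<le> p" "1 \<le> x"
  then show "{a. (a, Suc x) \<in> Y i} \<subseteq> {a. (a, x) \<in> Y i}"
    using closed_Y[of i _ "Suc x" _ x] pos_Y[of i _ "Suc x"] by auto
qed

lemma rowlen_strip: "i < p \<Longrightarrow> 1 \<le> a \<Longrightarrow> rowlen (Suc i) (Suc a) \<le> rowlen i a"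
  unfolding rowlen_def using strip_Y by (intro card_mono finite_row) auto

lemma D_iff: "(a, y) \<in> D k \<longleftrightarrow> (a, y) \<in> Y k \<and> (a, y) \<notin> Y (k - 1)"
  by (simp add: D_def)

lemma pos_D: "k \<le> p \<Longrightarrow> (a, y) \<in> D k \<Longrightarrow> 1 \<le> a \<and> 1 \<le> y"
  using pos_Y D_iff by blast

lemma above:
  assumes "1 \<le> k" "k \<le> p" "(a, y) \<in> Y k" "1 \<le> b" "b < a"
  shows "(b, y) \<in> Y (k - 1)"
proof -
  have "(Suc (a - 1), y) \<in> Y (Suc (k - 1))" using assms by simp
  then have "(a - 1, y) \<in> Y (k - 1)"
    using strip_Y[of "k - 1" "a - 1" y] assms by (simp del: Suc_pred One_nat_def)
  then show ?thesis using closed_Y[of "k - 1" "a - 1" y b y] pos_Y[of "k - 1" "a - 1" y] assms by auto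
qed

lemma D_column:
  assumes "1 \<le> k" "k \<le> p" "(a, y) \<in> D k" "(b, y) \<in> D k" shows "a = b"
  using above[OF assms(1,2), of a y b] above[OF assms(1,2), of b y a] assms pos_D D_iff
  by (metis linorder_less_linear)

lemma D_order:
  assumes "1 \<le> k" "k \<le> p" "(a, x) \<in> D k" "(b, y) \<in> D k" "x < y" shows "b \<le> a"
proof (rule ccontr)
  assume "\<not> b \<le> a"
  have pos: "1 \<le> a" "1 \<le> x" using pos_D[OF assms(2,3)] by auto
  have "(b, y) \<in> Y k" using assms(4) by (simp add: D_iff)
  then have "(a, y) \<in> Y (k - 1)"
    using above[OF assms(1,2), of b y a] pos \<open>\<not> b \<le> a\<close> by simp
  then have "(a, x) \<in> Y (k - 1)"
    using closed_Y[of "k - 1" a y a x] assms(1,2,5) pos by simp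
  then show False using assms(3) by (simp add: D_iff)
qed

text \<open>The boxes of strip \<open>k\<close> in the rows from \<open>a\<close> on are those in the columns met by row \<open>a\<close> of the
  \<open>k\<close>-th diagram: further up, strip \<open>k\<close> only has boxes to the right of that row. The same columns cut off
  the part of strip \<open>k + 1\<close> that lies strictly below row \<open>a\<close>.\<close>

lemma tail_eq_head:
  assumes "1 \<le> k" "k \<le> p" "1 \<le> a" shows "tail k a = head k (rowlen k a)"
proof -
  have iff: "a \<le> b \<longleftrightarrow> y \<le> rowlen k a" if h: "(b, y) \<in> D k" for b y
  proof
    have pos: "1 \<le> b" "1 \<le> y" using pos_D assms(2) h by blast+
    show "y \<le> rowlen k a" if "a \<le> b"
    proof -
      have "(a, y) \<in> Y k" using closed_Y[of k b y a y] assms pos h that by (simp add: D_iff)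
      then show ?thesis using mem_row assms by blast
    qed
    show "a \<le> b" if "y \<le> rowlen k a"
    proof -
      have "(a, y) \<in> Y k" using that pos mem_row assms by blast
      then have "\<not> b < a" using above[OF assms(1,2), of a y b] h pos D_iff by blast
      then show ?thesis by simp
    qed
  qed
  have "{b \<in> D k. a \<le> fst b} = {b \<in> D k. snd b \<le> rowlen k a}"
    using iff by auto
  then show ?thesis by (simp add: tail_def head_def)
qed

lemma tail_Suc_eq_head:
  assumes "1 \<le> k" "k < p" "1 \<le> a" shows "tail (Suc k) (Suc a) = head (Suc k) (rowlen k a)"
proof -
  have iff: "Suc a \<le> b \<longleftrightarrow> y \<le> rowlen k a" if h: "(b, y) \<in> D (Suc k)" for b y
  proof
    have pos: "1 \<le> b" "1 \<le> y" using pos_D[of "Suc k"] assms(2) h by auto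
    have h': "(b, y) \<in> Y (Suc k)" "(b, y) \<notin> Y k" using h by (auto simp: D_iff)
    show "y \<le> rowlen k a" if "Suc a \<le> b"
      using above[of "Suc k" b y a] assms that h' mem_row[of k a y] by simp
    show "Suc a \<le> b" if "y \<le> rowlen k a"
    proof -
      have "(a, y) \<in> Y k" using that pos mem_row[of k a y] assms by simp
      then have "\<not> b \<le> a" using closed_Y[of k a y b y] h' pos assms by auto
      then show ?thesis by simp
    qed
  qed
  have "{b \<in> D (Suc k). Suc a \<le> fst b} = {b \<in> D (Suc k). snd b \<le> rowlen k a}"
    using iff by auto
  then show ?thesis by (simp add: tail_def head_def)
qed

lemma head_mono: "k \<le> p \<Longrightarrow> x \<le> y \<Longrightarrow> head k x \<le> head k y"
  unfolding head_def by (rule card_mono) (auto simp: finite_D)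

lemma tail_antimono: "k \<le> p \<Longrightarrow> a \<le> b \<Longrightarrow> tail k b \<le> tail k a"
  unfolding tail_def by (rule card_mono) (auto simp: finite_D)

lemma head_diff:
  assumes "1 \<le> k" "k \<le> p" "x \<le> y" shows "head k y \<le> head k x + (y - x)"
proof -
  have "{b \<in> D k. snd b \<le> y} = {b \<in> D k. snd b \<le> x} \<union> {b \<in> D k. x < snd b \<and> snd b \<le> y}"
    using assms(3) by auto
  then have "head k y \<le> head k x + card {b \<in> D k. x < snd b \<and> snd b \<le> y}"
    unfolding head_def by (simp add: card_Un_le)
  moreover have "card {b \<in> D k. x < snd b \<and> snd b \<le> y} \<le> card {x<..y}"
  proof (rule card_inj_on_le)
    show "inj_on snd {b \<in> D k. x < snd b \<and> snd b \<le> y}"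
      using D_column[OF assms(1,2)] by (auto simp: inj_on_def)
  qed auto
  ultimately show ?thesis by simp
qed

definition head_lattice :: bool where
  "head_lattice \<longleftrightarrow> (\<forall>k x. 1 \<le> k \<and> k < p \<longrightarrow> head k x \<le> head (Suc k) x)"

definition tail_lattice :: bool where
  "tail_lattice \<longleftrightarrow> (\<forall>k a. 1 \<le> k \<and> k < p \<and> 1 \<le> a \<longrightarrow> tail k a \<le> tail (Suc k) (Suc a))"

text \<open>By the two preceding lemmas, the inequality for the rows from \<open>a\<close> on is the inequality for the first
  \<open>rowlen k a\<close> columns. It remains to interpolate. Let \<open>x\<close> lie between the lengths \<open>\<beta>\<close> of row \<open>a\<close> and
  \<open>z\<close> of row \<open>a - 1\<close>. If strip \<open>k\<close> has no box in the columns between \<open>\<beta>\<close> and \<open>x\<close>, the inequality at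
  \<open>\<beta>\<close> gives the one at \<open>x\<close>. Otherwise strip \<open>k\<close> occupies every column from \<open>x + 1\<close> to \<open>z\<close>, and strip
  \<open>k + 1\<close> has at most one box in each of them, so the inequality at \<open>z\<close> gives the one at \<open>x\<close>.\<close>

lemma head_lattice_iff_tail_lattice: "head_lattice \<longleftrightarrow> tail_lattice"
proof
  assume "head_lattice"
  then show tail_lattice unfolding tail_lattice_def head_lattice_def
    using tail_eq_head tail_Suc_eq_head by auto
next
  assume tl: tail_lattice
  have corner: "head k (rowlen k a) \<le> head (Suc k) (rowlen k a)" if "1 \<le> k" "k < p" "1 \<le> a" for k a
    using tl that tail_eq_head[of k a] tail_Suc_eq_head[of k a]
    unfolding tail_lattice_def by (metis less_imp_le)
  have "head k x \<le> head (Suc k) x" if k: "1 \<le> k" "k < p" for k x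
  proof -
    have "(Suc (collen k 1), 1) \<notin> Y k" using mem_col[of k] k by simp
    then have "rowlen k (Suc (collen k 1)) = 0" using mem_row[of k _ 1] k by (simp add: not_le)
    then have ex: "\<exists>a. 1 \<le> a \<and> rowlen k a \<le> x" by (intro exI[of _ "Suc (collen k 1)"]) simp
    define a where "a = (LEAST a. 1 \<le> a \<and> rowlen k a \<le> x)"
    have a12: "1 \<le> a \<and> rowlen k a \<le> x" unfolding a_def by (rule LeastI_ex[OF ex])
    have a3: "x < rowlen k b" if "1 \<le> b" "b < a" for b
      using not_less_Least[of b "\<lambda>a. 1 \<le> a \<and> rowlen k a \<le> x"] that unfolding a_def by linarith
    note a = conjunct1[OF a12] conjunct2[OF a12] a3
    let ?\<beta> = "rowlen k a"
    show ?thesis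
    proof (cases "head k x = head k ?\<beta>")
      case True
      then show ?thesis using corner[OF k a(1)] head_mono[of "Suc k" ?\<beta> x] a(2) k by simp
    next
      case False
      have "\<exists>b\<in>D k. ?\<beta> < snd b \<and> snd b \<le> x"
      proof (rule ccontr)
        assume "\<not> ?thesis"
        then have "{b \<in> D k. snd b \<le> x} = {b \<in> D k. snd b \<le> ?\<beta>}" using a(2) by force
        then show False using False by (simp add: head_def)
      qed
      then obtain b y where b: "(b, y) \<in> D k" "?\<beta> < y" "y \<le> x" by auto
      have pos: "1 \<le> b" "1 \<le> y" using pos_D[of k b y] b(1) k by auto
      have "b < a"
      proof (rule ccontr)
        assume "\<not> b < a"
        then have "(a, y) \<in> Y k" using closed_Y[of k b y a y] b(1) a(1) pos k D_iff by auto
        then show False using mem_row[of k a y] b(2) k by simp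
      qed
      define z where "z = rowlen k (a - 1)"
      have xz: "x < z" using a(3)[of "a - 1"] \<open>b < a\<close> pos by (simp add: z_def)
      have full: "(a - 1, x') \<in> D k" if x': "x < x'" "x' \<le> z" for x'
      proof -
        have "(a - 1, x') \<in> Y k" using mem_row[of k "a - 1" x'] x' k by (simp add: z_def)
        moreover have "(a - 1, x') \<notin> Y (k - 1)"
        proof
          assume "(a - 1, x') \<in> Y (k - 1)"
          then have "(b, y) \<in> Y (k - 1)"
            using closed_Y[of "k - 1" "a - 1" x' b y] k pos \<open>b < a\<close> x' b(3) by auto
          then show False using b(1) D_iff by blast
        qed
        ultimately show ?thesis by (simp add: D_iff)
      qed
      have fin: "finite (D k)" using finite_D k by simp
      \<comment> \<open>Strip k has a box in row a - 1 of each column from x + 1 to z.\<close>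
      have "head k x + (z - x) = card ({b \<in> D k. snd b \<le> x} \<union> (\<lambda>x'. (a - 1, x')) ` {x<..z})"
        unfolding head_def
        by (subst card_Un_disjoint) (auto simp: card_image inj_on_def fin)
      also have "\<dots> \<le> head k z"
        unfolding head_def by (rule card_mono) (use full xz fin in auto)
      also have "\<dots> \<le> head (Suc k) z"
        using corner[OF k, of "a - 1"] \<open>b < a\<close> pos by (simp add: z_def)
      also have "\<dots> \<le> head (Suc k) x + (z - x)" using head_diff[of "Suc k" x z] k xz by simp
      finally show ?thesis by simp
    qed
  qed
  then show head_lattice by (auto simp: head_lattice_def)
qed

lemma head_lattice_trans:
  assumes head_lattice "1 \<le> k" "k \<le> k'" "k' \<le> p" shows "head k x \<le> head k' x"
  using assms(3,4)
proof (induction k' rule: dec_induct)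
  case (step m)
  then have "head m x \<le> head (Suc m) x" using assms(1,2) by (simp add: head_lattice_def)
  then show ?case using step by simp
qed simp

text \<open>Read from left to right, the boxes of a horizontal strip go weakly upwards. So the boxes left of
  \<open>(a, x)\<close> lie in rows from \<open>a\<close> on, and those in lower rows lie strictly to the left.\<close>

lemma box_position:
  assumes k: "1 \<le> k" "k \<le> p" and box: "(a, x) \<in> D k"
  shows "head k x \<le> tail k a" "tail k (Suc a) < head k x"
proof -
  have fin: "finite (D k)" using finite_D k by simp
  have "b \<ge> a" if "(b, y) \<in> D k" "y \<le> x" for b y
    using D_column[OF k box, of b] D_order[OF k that(1) box] that by (cases "y = x") auto
  then have "{b \<in> D k. snd b \<le> x} \<subseteq> {b \<in> D k. a \<le> fst b}" by auto
  then show "head k x \<le> tail k a" unfolding head_def tail_def by (rule card_mono[rotated]) (simp add: fin)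
  have right: "y < x" if "(b, y) \<in> D k" "Suc a \<le> b" for b y
    using D_column[OF k box, of b] D_order[OF k box that(1)] that by (cases y x rule: linorder_cases) auto
  have "{b \<in> D k. Suc a \<le> fst b} \<subset> {b \<in> D k. snd b \<le> x}"
  proof (rule psubsetI)
    show "{b \<in> D k. Suc a \<le> fst b} \<subseteq> {b \<in> D k. snd b \<le> x}"
      using right by (force simp: less_imp_le)
    have "(a, x) \<in> {b \<in> D k. snd b \<le> x}" "(a, x) \<notin> {b \<in> D k. Suc a \<le> fst b}"
      using box by auto
    then show "{b \<in> D k. Suc a \<le> fst b} \<noteq> {b \<in> D k. snd b \<le> x}" by metis
  qed
  then show "tail k (Suc a) < head k x" unfolding head_def tail_def
    by (rule psubset_card_mono[rotated]) (simp add: fin)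
qed

text \<open>Read from the right, row \<open>k\<close> lists the rows of the boxes of strip \<open>k\<close> in weakly decreasing order, so it is
  the conjugate of \<open>tail k\<close>. Column \<open>c\<close> lists the columns of strip \<open>p + 1 - c\<close> in increasing order.\<close>

definition rows_of :: "nat \<Rightarrow> tableau" where
  "rows_of M = (\<lambda>(k, j). if 1 \<le> k \<and> k \<le> p \<and> 1 \<le> j \<and> j \<le> M
     then card {a. 1 \<le> a \<and> M + 1 - j \<le> tail k a} else 0)"

definition cols_of :: tableau where
  "cols_of = (\<lambda>(l, c). if 1 \<le> c \<and> c \<le> p \<and> 1 \<le> l \<and> l \<le> card (D (p + 1 - c))
     then LEAST x. l \<le> head (p + 1 - c) x else 0)"

lemma tail_bound: "k \<le> p \<Longrightarrow> \<exists>A. \<forall>a>A. tail k a = 0"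
proof -
  assume "k \<le> p"
  then have fin: "finite (D k)" by (rule finite_D)
  have "tail k a = 0" if "a > Max (insert 0 (fst ` D k))" for a
  proof -
    have "{b \<in> D k. a \<le> fst b} = {}" using that fin by auto
    then show ?thesis unfolding tail_def by (simp only: card.empty)
  qed
  then show ?thesis by blast
qed

lemma tail_1: "k \<le> p \<Longrightarrow> tail k 1 = card (D k)"
  unfolding tail_def using pos_D by (intro arg_cong[of _ _ card]) force

lemma head_max:
  assumes "k \<le> p" shows "\<exists>x. head k x = card (D k)"
proof -
  have "snd b \<le> Max (insert 0 (snd ` D k))" if "b \<in> D k" for b
    using finite_D[OF assms] that by (intro Max_ge) auto
  then have "{b \<in> D k. snd b \<le> Max (insert 0 (snd ` D k))} = D k" by auto
  then have "head k (Max (insert 0 (snd ` D k))) = card (D k)"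
    unfolding head_def by (rule arg_cong)
  then show ?thesis by blast
qed

lemma head_le: "k \<le> p \<Longrightarrow> head k x \<le> card (D k)"
  unfolding head_def by (intro card_mono finite_D) auto

lemma rows_of_ge:
  assumes k: "1 \<le> k" "k \<le> p" and j: "1 \<le> j" "j \<le> M" and a: "1 \<le> a"
  shows "a \<le> rows_of M (k, j) \<longleftrightarrow> M + 1 - j \<le> tail k a"
proof -
  let ?S = "{a. 1 \<le> a \<and> M + 1 - j \<le> tail k a}"
  obtain A where A: "\<forall>a>A. tail k a = 0" using tail_bound k by blast
  have "?S = {1..card ?S}"
  proof (rule initial_segment)
    have "?S \<subseteq> {..A}" using A j by (auto simp: not_less[symmetric])
    then show "finite ?S" by (rule finite_subset) simp
    show "y \<in> ?S" if "x \<in> ?S" "1 \<le> y" "y \<le> x" for x y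
      using that tail_antimono[of k y x] k by auto
  qed auto
  then have "a \<in> ?S \<longleftrightarrow> a \<in> {1..card ?S}" by (rule arg_cong)
  then show ?thesis using assms by (simp add: rows_of_def)
qed

lemma cols_of_le:
  assumes c: "1 \<le> c" "c \<le> p" and l: "1 \<le> l"
  shows "cols_of (l, c) \<noteq> 0 \<and> cols_of (l, c) \<le> x \<longleftrightarrow> l \<le> head (p + 1 - c) x"
proof -
  let ?k = "p + 1 - c"
  have k: "?k \<le> p" using c by simp
  show ?thesis
  proof (cases "l \<le> card (D ?k)")
    case True
    have ex: "\<exists>x. l \<le> head ?k x" using True head_max[OF k] by metis
    let ?m = "LEAST x. l \<le> head ?k x"
    have m: "l \<le> head ?k ?m" using ex by (rule LeastI_ex)
    have "{b \<in> D ?k. snd b \<le> 0} = {}" using pos_D k by force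
    then have "head ?k 0 = 0" unfolding head_def by (simp only: card.empty)
    then have "?m \<noteq> 0" using m l by (metis not_one_le_zero le_trans)
    moreover have "?m \<le> x \<longleftrightarrow> l \<le> head ?k x"
      using m head_mono[OF k, of ?m x] Least_le[of "\<lambda>x. l \<le> head ?k x" x] by auto
    ultimately show ?thesis using True assms by (simp add: cols_of_def)
  next
    case False
    then show ?thesis using head_le[OF k, of x] by (simp add: cols_of_def)
  qed
qed

lemma row_of_D: 
  assumes "1 \<le> k" "k \<le> p" shows "card {y. (a, y) \<in> D k} = rowlen k a - rowlen (k - 1) a"
    "rowlen (k - 1) a \<le> rowlen k a"
proof -
  have sub: "Y (k - 1) \<subseteq> Y k" using sub_Y[of "k - 1"] assms by simp
  have "{y. (a, y) \<in> D k} = {y. (a, y) \<in> Y k} - {y. (a, y) \<in> Y (k - 1)}" by (auto simp: D_iff)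
  then show "card {y. (a, y) \<in> D k} = rowlen k a - rowlen (k - 1) a"
    unfolding rowlen_def using sub assms by (subst card_Diff_subset[symmetric]) (auto simp: finite_row)
  show "rowlen (k - 1) a \<le> rowlen k a"
    unfolding rowlen_def using sub assms by (intro card_mono) (auto simp: finite_row)
qed

lemma col_of_D: 
  assumes "1 \<le> k" "k \<le> p" shows "card {a. (a, x) \<in> D k} = collen k x - collen (k - 1) x"
    "collen (k - 1) x \<le> collen k x"
proof -
  have sub: "Y (k - 1) \<subseteq> Y k" using sub_Y[of "k - 1"] assms by simp
  have "{a. (a, x) \<in> D k} = {a. (a, x) \<in> Y k} - {a. (a, x) \<in> Y (k - 1)}" by (auto simp: D_iff)
  then show "card {a. (a, x) \<in> D k} = collen k x - collen (k - 1) x"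
    unfolding collen_def using sub assms by (subst card_Diff_subset[symmetric]) (auto simp: finite_col)
  show "collen (k - 1) x \<le> collen k x"
    unfolding collen_def using sub assms by (intro card_mono) (auto simp: finite_col)
qed

lemma tail_Suc: "k \<le> p \<Longrightarrow> tail k a = tail k (Suc a) + card {y. (a, y) \<in> D k}"
proof -
  assume k: "k \<le> p"
  have "{b \<in> D k. a \<le> fst b} = {b \<in> D k. Suc a \<le> fst b} \<union> (\<lambda>y. (a, y)) ` {y. (a, y) \<in> D k}"
    by (force simp: Suc_le_eq le_less)
  moreover have "finite {y. (a, y) \<in> D k}"
    by (rule finite_subset[OF _ finite_row[OF k]]) (auto simp: D_iff)
  moreover have "finite {b \<in> D k. Suc a \<le> fst b}" using finite_D[OF k] by simp
  ultimately show ?thesis unfolding tail_def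
    by (simp only:, subst card_Un_disjoint) (auto simp: card_image inj_on_def)
qed

lemma head_Suc: "k \<le> p \<Longrightarrow> head k (Suc x) = head k x + card {a. (a, Suc x) \<in> D k}"
proof -
  assume k: "k \<le> p"
  have "{b \<in> D k. snd b \<le> Suc x} = {b \<in> D k. snd b \<le> x} \<union> (\<lambda>a. (a, Suc x)) ` {a. (a, Suc x) \<in> D k}"
    by (force simp: le_Suc_eq)
  moreover have "finite {a. (a, Suc x) \<in> D k}"
    by (rule finite_subset[OF _ finite_col[OF k]]) (auto simp: D_iff)
  moreover have "finite {b \<in> D k. snd b \<le> x}" using finite_D[OF k] by simp
  ultimately show ?thesis unfolding head_def
    by (simp only:, subst card_Un_disjoint) (auto simp: card_image inj_on_def)
qed

end

section \<open>Tableaux read off a chain\<close>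

text \<open>Semistandard tableaux of a straight shape inside an \<open>R \<times> p\<close> rectangle.\<close>

definition normal_std :: "nat \<Rightarrow> nat \<Rightarrow> tableau \<Rightarrow> bool" where
  "normal_std R p S \<longleftrightarrow> in_box S R p
     \<and> (\<forall>l l' c. S (l, c) \<noteq> 0 \<and> 1 \<le> l' \<and> l' < l \<longrightarrow> S (l', c) \<noteq> 0 \<and> S (l', c) < S (l, c))
     \<and> (\<forall>l c c'. S (l, c') \<noteq> 0 \<and> 1 \<le> c \<and> c < c' \<longrightarrow> S (l, c) \<noteq> 0 \<and> S (l, c) \<le> S (l, c'))"

text \<open>The entries at least \<open>a\<close> fill the right end of their row, and the entries at most \<open>x\<close> fill
  the top of their column.\<close>

lemma anti_std_entry:
  assumes "anti_std p M U" "1 \<le> j" "j \<le> M" "1 \<le> a"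
  shows "a \<le> U (k, j) \<longleftrightarrow> M + 1 - j \<le> card {j. a \<le> U (k, j)}"
proof -
  let ?X = "{j. a \<le> U (k, j)}"
  note box = anti_std_box[OF assms(1)] and row = anti_std_row[OF assms(1)]
  have fin: "finite ?X" by (rule finite_row_entries[OF box assms(4)])
  have X: "1 \<le> j'" "j' \<le> M" if "j' \<in> ?X" for j'
    using in_boxD[OF box, of k j'] that assms(4) by auto
  show ?thesis
  proof (cases "j \<in> ?X")
    case True
    then have "{j..M} \<subseteq> ?X" using row[of j _ k] assms(2) by fastforce
    then have "card {j..M} \<le> card ?X" by (rule card_mono[OF fin])
    then show ?thesis using True by simp
  next
    case False
    have "?X \<subseteq> {Suc j..M}"
    proof
      fix j' assume j': "j' \<in> ?X"
      have "\<not> j' \<le> j" using row[of j' j k] X[OF j'] j' False assms(3) by auto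
      then show "j' \<in> {Suc j..M}" using X[OF j'] by simp
    qed
    then have "card ?X \<le> card {Suc j..M}" by (intro card_mono) auto
    then show ?thesis using False assms(3) by simp
  qed
qed

lemma normal_std_entry:
  assumes "normal_std R p S" "1 \<le> l"
  shows "S (l, c) \<noteq> 0 \<and> S (l, c) \<le> x \<longleftrightarrow> l \<le> card {l. S (l, c) \<noteq> 0 \<and> S (l, c) \<le> x}"
proof -
  let ?X = "{l. S (l, c) \<noteq> 0 \<and> S (l, c) \<le> x}"
  have box: "in_box S R p"
    and col: "\<And>l l'. S (l, c) \<noteq> 0 \<Longrightarrow> 1 \<le> l' \<Longrightarrow> l' < l \<Longrightarrow> S (l', c) \<noteq> 0 \<and> S (l', c) < S (l, c)"
    using assms(1) unfolding normal_std_def by blast+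
  have "?X = {1..card ?X}"
  proof (rule initial_segment)
    show "finite ?X"
      by (rule finite_subset[OF _ finite_col_entries[OF box, of 1 c]]) auto
    show "1 \<le> l" if "l \<in> ?X" for l using in_boxD[OF box, of l c] that by simp
    show "l' \<in> ?X" if "l \<in> ?X" "1 \<le> l'" "l' \<le> l" for l l'
      using col[of l l'] that by (cases "l' = l") auto
  qed
  then have "l \<in> ?X \<longleftrightarrow> l \<in> {1..card ?X}" by (rule arg_cong)
  then show ?thesis using assms(2) by simp
qed

context strip_chain
begin

text \<open>These conditions say that the tableau describes the strips, and by monotonicity they determine
  all its entries.\<close>

definition rows_rep :: "nat \<Rightarrow> tableau \<Rightarrow> bool" where
  "rows_rep M U \<longleftrightarrow> in_box U p M \<and> (\<forall>k j a. 1 \<le> k \<and> k \<le> p \<and> 1 \<le> j \<and> j \<le> M \<and> 1 \<le> a \<longrightarrow>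
     (a \<le> U (k, j) \<longleftrightarrow> M + 1 - j \<le> tail k a))"

definition cols_rep :: "tableau \<Rightarrow> bool" where
  "cols_rep S \<longleftrightarrow> (\<forall>l c. S (l, c) \<noteq> 0 \<longrightarrow> 1 \<le> l \<and> 1 \<le> c \<and> c \<le> p) \<and>
     (\<forall>l c x. 1 \<le> c \<and> c \<le> p \<and> 1 \<le> l \<longrightarrow>
        (S (l, c) \<noteq> 0 \<and> S (l, c) \<le> x \<longleftrightarrow> l \<le> head (p + 1 - c) x))"

lemma rows_rep_unique:
  assumes "rows_rep M U" "rows_rep M U'" shows "U = U'"
proof
  fix b :: "nat \<times> nat"
  obtain k j where b: "b = (k, j)" by force
  show "U b = U' b"
  proof (cases "1 \<le> k \<and> k \<le> p \<and> 1 \<le> j \<and> j \<le> M")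
    case True
    then show ?thesis unfolding b using assms
      by (intro nat_eq_if_le_iff) (simp add: rows_rep_def)
  next
    case False
    then show ?thesis using assms in_boxD unfolding rows_rep_def b by metis
  qed
qed

lemma cols_rep_unique:
  assumes "cols_rep S" "cols_rep S'" shows "S = S'"
proof
  fix b :: "nat \<times> nat"
  obtain l c where b: "b = (l, c)" by force
  show "S b = S' b"
  proof (cases "1 \<le> c \<and> c \<le> p \<and> 1 \<le> l")
    case True
    then have iff: "S (l, c) \<noteq> 0 \<and> S (l, c) \<le> x \<longleftrightarrow> S' (l, c) \<noteq> 0 \<and> S' (l, c) \<le> x" for x
      using assms by (simp add: cols_rep_def)
    have "S (l, c) = 0 \<longleftrightarrow> S' (l, c) = 0"
      using iff[of "S (l, c)"] iff[of "S' (l, c)"] by auto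
    then show ?thesis using iff[of "S (l, c)"] iff[of "S' (l, c)"] unfolding b
      by (metis order_refl order_antisym)
  next
    case False
    then show ?thesis using assms unfolding cols_rep_def b by metis
  qed
qed

lemma rows_rep_shape:
  assumes "rows_rep M U" "1 \<le> k" "k \<le> p" "1 \<le> j" "j \<le> M"
  shows "U (k, j) \<noteq> 0 \<longleftrightarrow> M + 1 - j \<le> card (D k)"
proof -
  have "1 \<le> U (k, j) \<longleftrightarrow> M + 1 - j \<le> tail k 1" using assms unfolding rows_rep_def by blast
  then show ?thesis using tail_1[OF assms(3)] by (simp add: Suc_le_eq)
qed

lemma cols_rep_shape:
  assumes "cols_rep S" "1 \<le> c" "c \<le> p" "1 \<le> l"
  shows "S (l, c) \<noteq> 0 \<longleftrightarrow> l \<le> card (D (p + 1 - c))"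
proof -
  have k: "p + 1 - c \<le> p" using assms(2) by simp
  have rep: "S (l, c) \<noteq> 0 \<and> S (l, c) \<le> x \<longleftrightarrow> l \<le> head (p + 1 - c) x" for x
    using assms unfolding cols_rep_def by blast
  obtain x where x: "head (p + 1 - c) x = card (D (p + 1 - c))" using head_max[OF k] by blast
  show ?thesis using rep[of x] rep[of "S (l, c)"] x head_le[OF k, of "S (l, c)"] by auto
qed

lemma rows_rep_rows_of: "rows_rep M (rows_of M)"
proof -
  have "in_box (rows_of M) p M" by (auto simp: shape_def rows_of_def split: if_splits)
  then show ?thesis using rows_of_ge by (simp add: rows_rep_def)
qed

lemma cols_rep_cols_of: "cols_rep cols_of"
proof -
  have "\<forall>l c. cols_of (l, c) \<noteq> 0 \<longrightarrow> 1 \<le> l \<and> 1 \<le> c \<and> c \<le> p" by (auto simp: cols_of_def)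
  then show ?thesis using cols_of_le by (simp add: cols_rep_def)
qed

lemma tail_eq_card:
  assumes k: "1 \<le> k" "k \<le> p" and a: "1 \<le> a" and box: "in_box U p M"
    and eq: "\<And>a. 1 \<le> a \<Longrightarrow> card {j. U (k, j) = a} = card {y. (a, y) \<in> D k}"
  shows "tail k a = card {j. a \<le> U (k, j)}"
proof -
  have "card {j \<in> {j. a \<le> U (k, j)}. U (k, j) \<in> {a..}} = card {b \<in> D k. fst b \<in> {a..}}"
  proof (rule card_fibres_eq)
    fix v assume v: "v \<in> {a..}"
    have "{b \<in> D k. fst b = v} = (\<lambda>y. (v, y)) ` {y. (v, y) \<in> D k}" by force
    then have "card {b \<in> D k. fst b = v} = card {y. (v, y) \<in> D k}" by (simp add: card_image inj_on_def)
    moreover have "{j \<in> {j. a \<le> U (k, j)}. U (k, j) = v} = {j. U (k, j) = v}" using v by auto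
    ultimately show "card {j \<in> {j. a \<le> U (k, j)}. U (k, j) = v} = card {b \<in> D k. fst b = v}"
      using eq[of v] v a by simp
  qed (use finite_D k finite_row_entries[OF box a] in auto)
  then show ?thesis by (simp add: tail_def)
qed

lemma head_eq_card:
  assumes k: "1 \<le> k" "k \<le> p" and box: "in_box S R p"
    and eq: "\<And>x. 1 \<le> x \<Longrightarrow> card {l. S (l, p + 1 - k) = x} = card {a. (a, x) \<in> D k}"
  shows "head k x = card {l. S (l, p + 1 - k) \<noteq> 0 \<and> S (l, p + 1 - k) \<le> x}"
proof -
  let ?A = "{l. 1 \<le> S (l, p + 1 - k)}"
  have "card {l \<in> ?A. S (l, p + 1 - k) \<in> {1..x}} = card {b \<in> D k. snd b \<in> {1..x}}"
  proof (rule card_fibres_eq)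
    fix v assume v: "v \<in> {1..x}"
    have "{b \<in> D k. snd b = v} = (\<lambda>a. (a, v)) ` {a. (a, v) \<in> D k}" by force
    then have "card {b \<in> D k. snd b = v} = card {a. (a, v) \<in> D k}" by (simp add: card_image inj_on_def)
    moreover have "{l \<in> ?A. S (l, p + 1 - k) = v} = {l. S (l, p + 1 - k) = v}" using v by auto
    ultimately show "card {l \<in> ?A. S (l, p + 1 - k) = v} = card {b \<in> D k. snd b = v}"
      using eq[of v] v by simp
  qed (use finite_D k finite_col_entries[OF box, of 1] in auto)
  moreover have "{b \<in> D k. snd b \<in> {1..x}} = {b \<in> D k. snd b \<le> x}" using pos_D[OF k(2)] by auto
  moreover have "{l \<in> ?A. S (l, p + 1 - k) \<in> {1..x}} = {l. S (l, p + 1 - k) \<noteq> 0 \<and> S (l, p + 1 - k) \<le> x}"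
    by auto
  ultimately show ?thesis by (simp add: head_def)
qed

lemma rowlen_recorded:
  assumes "i \<le> p" "Y i = young \<nu>" "1 \<le> a" shows "rowlen i a = \<nu> a"
  using young_rowlen[OF assms(1)] assms(2,3) young_eq_iff by metis

lemma collen_recorded:
  assumes "i \<le> p" "Y i = converse (young \<nu>)" "1 \<le> a" shows "collen i a = \<nu> a"
  using young_collen[OF assms(1)] assms(2,3) young_eq_iff by (metis converse_converse)

lemma recorded_rows:
  assumes box: "in_box U p M" and rec: "\<And>i. i \<le> p \<Longrightarrow> Y i = young (\<lambda>a. \<delta> a + row_content U i a)"
    and k: "1 \<le> k" "k \<le> p" and a: "1 \<le> a"
  shows "card {j. U (k, j) = a} = card {y. (a, y) \<in> D k}"
proof -
  have "row_content U k a = row_content U (k - 1) a + card {j. U (k, j) = a}"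
    using row_content_Suc[OF box a, of "k - 1"] k by simp
  moreover have "rowlen k a = \<delta> a + row_content U k a"
    using rowlen_recorded[OF k(2) rec[OF k(2)] a] .
  moreover have "rowlen (k - 1) a = \<delta> a + row_content U (k - 1) a"
    using rowlen_recorded[OF _ rec a, of "k - 1"] k by simp
  ultimately show ?thesis using row_of_D[OF k] by simp
qed

lemma recorded_cols:
  assumes box: "in_box S R p"
    and rec: "\<And>i. i \<le> p \<Longrightarrow> Y i = converse (young (\<lambda>x. \<delta> x + col_content S (p - i) x))"
    and k: "1 \<le> k" "k \<le> p" and x: "1 \<le> x"
  shows "card {l. S (l, p + 1 - k) = x} = card {a. (a, x) \<in> D k}"
proof -
  have "Suc (p - k) = p + 1 - k" "p - (k - 1) = p + 1 - k" using k by auto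
  then have "col_content S (p - k) x = col_content S (p - (k - 1)) x + card {l. S (l, p + 1 - k) = x}"
    using col_content_Suc[OF box x, of "p - k"] by simp
  moreover have "collen k x = \<delta> x + col_content S (p - k) x"
    using collen_recorded[OF k(2) rec[OF k(2)] x] .
  moreover have "collen (k - 1) x = \<delta> x + col_content S (p - (k - 1)) x"
    using collen_recorded[OF _ rec x, of "k - 1"] k by simp
  ultimately show ?thesis using col_of_D[OF k] by simp
qed

text \<open>A tableau whose partial contents are the diagrams of the chain describes its strips, because the
  multiplicity of \<open>a\<close> in row \<open>k\<close> is the number of boxes of strip \<open>k\<close> in row \<open>a\<close>.\<close>

lemma rows_rep_recorded:
  assumes U: "anti_std p M U" and rec: "\<And>i. i \<le> p \<Longrightarrow> Y i = young (\<lambda>a. \<delta> a + row_content U i a)"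
  shows "rows_rep M U" and "\<And>k a. 1 \<le> k \<Longrightarrow> k \<le> p \<Longrightarrow> 1 \<le> a \<Longrightarrow> tail k a = card {j. a \<le> U (k, j)}"
    and "\<And>k. 1 \<le> k \<Longrightarrow> k \<le> p \<Longrightarrow> tail k 1 \<le> M"
proof -
  note box = anti_std_box[OF U]
  show tail: "tail k a = card {j. a \<le> U (k, j)}" if "1 \<le> k" "k \<le> p" "1 \<le> a" for k a
    using that recorded_rows[OF box rec] by (intro tail_eq_card[OF _ _ _ box]) auto
  show "tail k 1 \<le> M" if k: "1 \<le> k" "k \<le> p" for k
  proof -
    have "{j. 1 \<le> U (k, j)} \<subseteq> {1..M}" using in_boxD[OF box, of k] by fastforce
    then have "card {j. 1 \<le> U (k, j)} \<le> card {1..M}" by (intro card_mono) auto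
    then show ?thesis using tail[OF k, of 1] by simp
  qed
  show "rows_rep M U"
    using anti_std_entry[OF U] tail box by (simp add: rows_rep_def)
qed

lemma cols_rep_recorded:
  assumes S: "normal_std R p S"
    and rec: "\<And>i. i \<le> p \<Longrightarrow> Y i = converse (young (\<lambda>x. \<delta> x + col_content S (p - i) x))"
  shows "cols_rep S" and "\<And>k x. 1 \<le> k \<Longrightarrow> k \<le> p \<Longrightarrow>
      head k x = card {l. S (l, p + 1 - k) \<noteq> 0 \<and> S (l, p + 1 - k) \<le> x}"
proof -
  have box: "in_box S R p" using S by (simp add: normal_std_def)
  show head: "head k x = card {l. S (l, p + 1 - k) \<noteq> 0 \<and> S (l, p + 1 - k) \<le> x}"
    if "1 \<le> k" "k \<le> p" for k x
    using that recorded_cols[OF box rec] by (intro head_eq_card[OF _ _ box]) auto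
  have "S (l, c) \<noteq> 0 \<and> S (l, c) \<le> x \<longleftrightarrow> l \<le> head (p + 1 - c) x" if "1 \<le> c" "c \<le> p" "1 \<le> l" for l c x
    using normal_std_entry[OF S that(3), of c x] head[of "p + 1 - c" x] that by simp
  then show "cols_rep S" using in_boxD[OF box] by (auto simp: cols_rep_def)
qed

text \<open>The condition at \<open>a\<close> is read off the column in which the leftmost of the \<open>tail k a\<close> entries
  at least \<open>a\<close> of row \<open>k\<close> stands: the entry below it is larger.\<close>

lemma tail_lattice_of_rows:
  assumes U: "anti_std p M U" and rep: "rows_rep M U"
    and bound: "\<And>k. 1 \<le> k \<Longrightarrow> k \<le> p \<Longrightarrow> tail k 1 \<le> M"
  shows tail_lattice
  unfolding tail_lattice_def
proof (intro allI impI, elim conjE)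
  fix k a :: nat assume k: "1 \<le> k" "k < p" and a: "1 \<le> a"
  let ?m = "tail k a"
  have m: "?m \<le> M" using tail_antimono[of k 1 a] bound[of k] k a by simp
  show "?m \<le> tail (Suc k) (Suc a)"
  proof (cases "?m = 0")
    case False
    \<comment> \<open>The leftmost column with an entry at least a in row k.\<close>
    let ?j = "M + 1 - ?m"
    have j: "1 \<le> ?j" "?j \<le> M" "M + 1 - ?j = ?m" using False m by auto
    have "a \<le> U (k, ?j)" using rep k a j by (simp add: rows_rep_def)
    moreover have "U (k, ?j) < U (Suc k, ?j)"
    proof -
      have "U (k, ?j) \<noteq> 0" "k < Suc k" "Suc k \<le> p" using calculation k a by auto
      then show ?thesis by (rule anti_std_col[OF U])
    qed
    ultimately have "Suc a \<le> U (Suc k, ?j)" by simp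
    moreover have "1 \<le> Suc k" "Suc k \<le> p" "1 \<le> Suc a" using k by auto
    ultimately have "M + 1 - ?j \<le> tail (Suc k) (Suc a)"
      using rep j(1,2) unfolding rows_rep_def by blast
    then show ?thesis using j(3) by simp
  qed simp
qed

lemma head_lattice_of_cols:
  assumes S: "normal_std R p S" and rep: "cols_rep S"
  shows head_lattice
  unfolding head_lattice_def
proof (intro allI impI, elim conjE)
  fix k x assume k: "1 \<le> k" "k < p"
  let ?l = "head k x"
  have eq: "p + 1 - (p + 1 - k) = k" "p + 1 - (p - k) = Suc k" using k by auto
  show "?l \<le> head (Suc k) x"
  proof (cases "?l = 0")
    case False
    then have "S (?l, p + 1 - k) \<noteq> 0 \<and> S (?l, p + 1 - k) \<le> x"
    proof -
      have "1 \<le> p + 1 - k" "p + 1 - k \<le> p" "1 \<le> ?l" using k False by auto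
      then have "S (?l, p + 1 - k) \<noteq> 0 \<and> S (?l, p + 1 - k) \<le> x \<longleftrightarrow> ?l \<le> head (p + 1 - (p + 1 - k)) x"
        using rep unfolding cols_rep_def by blast
      then show ?thesis using eq by simp
    qed
    moreover have "S (?l, p - k) \<noteq> 0 \<and> S (?l, p - k) \<le> S (?l, p + 1 - k)"
    proof -
      have "1 \<le> p - k" "p - k < p + 1 - k" using k by auto
      then show ?thesis using S calculation unfolding normal_std_def by blast
    qed
    ultimately have "S (?l, p - k) \<noteq> 0 \<and> S (?l, p - k) \<le> x" by simp
    moreover have "1 \<le> p - k" "p - k \<le> p" "1 \<le> ?l" using k False by auto
    ultimately have "?l \<le> head (p + 1 - (p - k)) x" using rep unfolding cols_rep_def by blast
    then show ?thesis using eq by simp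
  qed simp
qed

lemma anti_std_rows_of:
  assumes tl: tail_lattice
  shows "anti_std p M (rows_of M)"
proof -
  let ?U = "rows_of M"
  have box: "in_box ?U p M" using rows_rep_rows_of by (simp add: rows_rep_def)
  have rep: "a \<le> ?U (k, j) \<longleftrightarrow> M + 1 - j \<le> tail k a"
    if "1 \<le> k" "k \<le> p" "1 \<le> j" "j \<le> M" "1 \<le> a" for k j a
    using rows_of_ge that by blast
  have row: "?U (i, j) \<le> ?U (i, j')" if j: "1 \<le> j" "j \<le> j'" "j' \<le> M" for i j j'
  proof (cases "?U (i, j) = 0")
    case False
    then have i: "1 \<le> i" "i \<le> p" using in_boxD[OF box, of i j] by auto
    have "M + 1 - j \<le> tail i (?U (i, j))" using rep[OF i, of j "?U (i, j)"] j False by simp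
    then show ?thesis using rep[OF i, of j' "?U (i, j)"] j False by simp
  qed simp
  have "?U (i, j) < ?U (i', j)" if h: "?U (i, j) \<noteq> 0" "i < i'" "i' \<le> p" for i i' j
  proof -
    have step: "?U (m, j) < ?U (Suc m, j)" if "?U (m, j) \<noteq> 0" "m < p" for m
    proof -
      have m: "1 \<le> m" "1 \<le> j" "j \<le> M" using in_boxD[OF box, of m j] that by auto
      have "M + 1 - j \<le> tail m (?U (m, j))" using rep[of m j "?U (m, j)"] m that by simp
      also have "\<dots> \<le> tail (Suc m) (Suc (?U (m, j)))"
        using tl that m by (simp add: tail_lattice_def)
      finally have "Suc (?U (m, j)) \<le> ?U (Suc m, j)"
        using rep[of "Suc m" j "Suc (?U (m, j))"] m that by simp
      then show ?thesis by simp
    qed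
    have "Suc i \<le> i'" using h by simp
    then show ?thesis using h(3)
    proof (induction i' rule: dec_induct)
      case base
      then show ?case using step[of i] h by simp
    next
      case (step m)
      then show ?case using \<open>\<And>m. ?U (m, j) \<noteq> 0 \<Longrightarrow> m < p \<Longrightarrow> ?U (m, j) < ?U (Suc m, j)\<close>[of m] by simp
    qed
  qed
  then show ?thesis unfolding anti_std_def using row box by blast
qed

text \<open>Columns increase strictly because a strip has at most one box in each column; rows increase
  weakly because later strips, which sit further to the left in the tableau, have at least as many boxes
  among the first columns.\<close>

lemma normal_std_cols_of:
  assumes hl: head_lattice and R: "\<And>k. k \<le> p \<Longrightarrow> card (D k) \<le> R"
  shows "normal_std R p cols_of"
proof -
  have box: "in_box cols_of R p"
  proof -
    have "l \<le> R" if "cols_of (l, c) \<noteq> 0" for l c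
    proof -
      have "1 \<le> c" "l \<le> card (D (p + 1 - c))" using that by (auto simp: cols_of_def split: if_splits)
      moreover have "card (D (p + 1 - c)) \<le> R" using calculation(1) by (intro R) simp
      ultimately show ?thesis by simp
    qed
    moreover have "1 \<le> l" "1 \<le> c" "c \<le> p" if "cols_of (l, c) \<noteq> 0" for l c
      using that by (auto simp: cols_of_def split: if_splits)
    ultimately show ?thesis by (auto simp: shape_def)
  qed
  have col: "cols_of (l', c) \<noteq> 0 \<and> cols_of (l', c) < cols_of (l, c)"
    if h: "cols_of (l, c) \<noteq> 0" "1 \<le> l'" "l' < l" for l l' c
  proof -
    have c: "1 \<le> c" "c \<le> p" "1 \<le> l" using in_boxD[OF box, of l c] h by auto
    let ?x = "cols_of (l, c)" and ?k = "p + 1 - c"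
    have k: "1 \<le> ?k" "?k \<le> p" using c by auto
    have "l \<le> head ?k ?x" using cols_of_le[OF c, of ?x] h by simp
    also have "\<dots> \<le> head ?k (?x - 1) + 1" using head_diff[OF k, of "?x - 1" ?x] h by simp
    finally have "l' \<le> head ?k (?x - 1)" using h by simp
    then have "cols_of (l', c) \<noteq> 0 \<and> cols_of (l', c) \<le> ?x - 1"
      using cols_of_le[OF c(1,2) h(2), of "?x - 1"] by simp
    then show ?thesis using h by auto
  qed
  have row: "cols_of (l, c) \<noteq> 0 \<and> cols_of (l, c) \<le> cols_of (l, c')"
    if h: "cols_of (l, c') \<noteq> 0" "1 \<le> c" "c < c'" for l c c'
  proof -
    have c: "1 \<le> c'" "c' \<le> p" "1 \<le> l" using in_boxD[OF box, of l c'] h by auto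
    let ?x = "cols_of (l, c')"
    have "l \<le> head (p + 1 - c') ?x" using cols_of_le[OF c, of ?x] h by simp
    also have "\<dots> \<le> head (p + 1 - c) ?x"
      using c h by (intro head_lattice_trans[OF hl]) auto
    finally show ?thesis using cols_of_le[of c l ?x] c h by simp
  qed
  show ?thesis unfolding normal_std_def using box col row by blast
qed

text \<open>Conversely, the contents of the constructed tableaux add up to the diagrams of the chain.\<close>

lemma rows_of_recorded:
  assumes bound: "\<And>k. 1 \<le> k \<Longrightarrow> k \<le> p \<Longrightarrow> tail k 1 \<le> M" and Y0: "Y 0 = young \<delta>"
  shows "i \<le> p \<Longrightarrow> Y i = young (\<lambda>a. \<delta> a + row_content (rows_of M) i a)"
proof -
  let ?U = "rows_of M"
  have box: "in_box ?U p M" using rows_rep_rows_of by (simp add: rows_rep_def)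
  have ge: "card {j. a \<le> ?U (k, j)} = tail k a" if k: "1 \<le> k" "k \<le> p" and a: "1 \<le> a" for k a
  proof -
    have m: "tail k a \<le> M" using tail_antimono[of k 1 a] bound[OF k] k a by simp
    have "a \<le> ?U (k, j) \<longleftrightarrow> j \<in> {M + 1 - tail k a..M}" for j
    proof (cases "1 \<le> j \<and> j \<le> M")
      case True
      then show ?thesis using rows_of_ge[OF k, of j M a] a by auto
    next
      case False
      then have "?U (k, j) = 0" using in_boxD[OF box, of k j] by blast
      then show ?thesis using False a m by auto
    qed
    then have "{j. a \<le> ?U (k, j)} = {M + 1 - tail k a..M}" by blast
    then show ?thesis using m by simp
  qed
  have eq: "card {j. ?U (k, j) = a} = card {y. (a, y) \<in> D k}" if k: "1 \<le> k" "k \<le> p" and a: "1 \<le> a" for k a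
  proof -
    have "{j. a \<le> ?U (k, j)} = {j. ?U (k, j) = a} \<union> {j. Suc a \<le> ?U (k, j)}" by auto
    moreover have "finite {j. ?U (k, j) = a}"
      by (rule finite_subset[OF _ finite_row_entries[OF box a, of k]]) auto
    moreover have "finite {j. Suc a \<le> ?U (k, j)}" by (rule finite_row_entries[OF box]) simp
    ultimately have "card {j. a \<le> ?U (k, j)} = card {j. ?U (k, j) = a} + card {j. Suc a \<le> ?U (k, j)}"
      by (simp only:, subst card_Un_disjoint) auto
    then show ?thesis using ge[OF k a] ge[OF k, of "Suc a"] tail_Suc[OF k(2), of a] by simp
  qed
  have "i \<le> p \<Longrightarrow> \<forall>a\<ge>1. rowlen i a = \<delta> a + row_content ?U i a" for i
  proof (induction i)
    case 0
    then show ?case using rowlen_recorded[OF _ Y0] row_content_0[OF box] by simp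
  next
    case (Suc i)
    have "rowlen (Suc i) a = \<delta> a + row_content ?U (Suc i) a" if a: "1 \<le> a" for a
    proof -
      have "rowlen i a = \<delta> a + row_content ?U i a" using Suc a by simp
      then show ?thesis using row_of_D[of "Suc i" a] eq[of "Suc i" a]
          row_content_Suc[OF box a, of i] Suc.prems a by simp
    qed
    then show ?case by blast
  qed
  then have rl: "i \<le> p \<Longrightarrow> young (rowlen i) = young (\<lambda>a. \<delta> a + row_content ?U i a)" for i
    unfolding young_eq_iff by blast
  show "Y i = young (\<lambda>a. \<delta> a + row_content ?U i a)" if "i \<le> p"
    using rl[OF that] young_rowlen[OF that] by simp
qed

lemma cols_of_recorded:
  assumes box: "in_box cols_of R p" and Y0: "Y 0 = converse (young \<delta>)"
  shows "i \<le> p \<Longrightarrow> Y i = converse (young (\<lambda>x. \<delta> x + col_content cols_of (p - i) x))"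
proof -
  let ?S = cols_of
  have le: "card {l. ?S (l, p + 1 - k) \<noteq> 0 \<and> ?S (l, p + 1 - k) \<le> x} = head k x"
    if k: "1 \<le> k" "k \<le> p" for k x
  proof -
    have c: "1 \<le> p + 1 - k" "p + 1 - k \<le> p" "p + 1 - (p + 1 - k) = k" using k by auto
    have "?S (l, p + 1 - k) \<noteq> 0 \<and> ?S (l, p + 1 - k) \<le> x \<longleftrightarrow> l \<in> {1..head k x}" for l
    proof (cases "1 \<le> l")
      case True
      then show ?thesis using cols_of_le[OF c(1,2) True, of x] c(3) by simp
    next
      case False
      then have "?S (l, p + 1 - k) = 0" using in_boxD[OF box, of l "p + 1 - k"] by blast
      then show ?thesis using False by simp
    qed
    then have "{l. ?S (l, p + 1 - k) \<noteq> 0 \<and> ?S (l, p + 1 - k) \<le> x} = {1..head k x}" by blast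
    then show ?thesis by simp
  qed
  have eq: "card {l. ?S (l, p + 1 - k) = x} = card {a. (a, x) \<in> D k}"
    if k: "1 \<le> k" "k \<le> p" and x: "1 \<le> x" for k x
  proof -
    let ?f = "\<lambda>l. ?S (l, p + 1 - k)"
    have "{l. ?f l \<noteq> 0 \<and> ?f l \<le> x} = {l. ?f l = x} \<union> {l. ?f l \<noteq> 0 \<and> ?f l \<le> x - 1}"
      using x by auto
    moreover have fin: "finite {l. ?f l \<noteq> 0 \<and> ?f l \<le> z}" for z
      by (rule finite_subset[OF _ finite_col_entries[OF box, of 1 "p + 1 - k"]]) auto
    moreover have "finite {l. ?f l = x}" by (rule finite_subset[OF _ fin[of x]]) (use x in auto)
    ultimately have "card {l. ?f l \<noteq> 0 \<and> ?f l \<le> x}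
        = card {l. ?f l = x} + card {l. ?f l \<noteq> 0 \<and> ?f l \<le> x - 1}"
      using x by (simp only:, subst card_Un_disjoint) auto
    then show ?thesis using le[OF k] head_Suc[OF k(2), of "x - 1"] x by simp
  qed
  have "i \<le> p \<Longrightarrow> \<forall>x\<ge>1. collen i x = \<delta> x + col_content ?S (p - i) x" for i
  proof (induction i)
    case 0
    then show ?case using collen_recorded[OF _ Y0] col_content_0[OF box] by simp
  next
    case (Suc i)
    have "Suc (p - Suc i) = p - i" using Suc.prems by simp
    then have "col_content ?S (p - Suc i) x = col_content ?S (p - i) x + card {a. (a, x) \<in> D (Suc i)}"
      if "1 \<le> x" for x
      using col_content_Suc[OF box that, of "p - Suc i"] eq[of "Suc i" x] that Suc.prems by simp
    moreover have "collen (Suc i) x = collen i x + card {a. (a, x) \<in> D (Suc i)}" for x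
      using col_of_D[of "Suc i" x] Suc.prems by simp
    ultimately show ?case using Suc by auto
  qed
  then have cl: "i \<le> p \<Longrightarrow> young (collen i) = young (\<lambda>x. \<delta> x + col_content ?S (p - i) x)" for i
    unfolding young_eq_iff by blast
  show "Y i = converse (young (\<lambda>x. \<delta> x + col_content ?S (p - i) x))" if "i \<le> p"
    using cl[OF that] young_collen[OF that] by (metis converse_converse)
qed

text \<open>Exactly one box of strip \<open>k\<close> lies in the column \<open>S (l, p + 1 - k)\<close>, and it is the \<open>l\<close>-th one from the
  left, hence also the \<open>l\<close>-th one from below.\<close>

lemma box_of_entries:
  assumes U: "rows_rep M U" and S: "cols_rep S" and k: "1 \<le> k" "k \<le> p" and M: "tail k 1 \<le> M"
    and l: "S (l, p + 1 - k) \<noteq> 0"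
  shows "(U (k, M + 1 - l), S (l, p + 1 - k)) \<in> D k" "head k (S (l, p + 1 - k)) = l"
proof -
  let ?x = "S (l, p + 1 - k)"
  have c: "1 \<le> p + 1 - k" "p + 1 - k \<le> p" "p + 1 - (p + 1 - k) = k" using k by auto
  have l1: "1 \<le> l" using S l unfolding cols_rep_def by blast
  have rep: "?x \<le> x \<longleftrightarrow> l \<le> head k x" for x
    using S c l l1 unfolding cols_rep_def by metis
  have "l \<le> head k ?x" "\<not> l \<le> head k (?x - 1)" using rep[of ?x] rep[of "?x - 1"] l by auto
  moreover have "head k ?x \<le> head k (?x - 1) + 1" using head_diff[OF k, of "?x - 1" ?x] l by simp
  ultimately show hl: "head k ?x = l" by simp
  have "card {a. (a, ?x) \<in> D k} \<noteq> 0"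
    using head_Suc[OF k(2), of "?x - 1"] \<open>\<not> l \<le> head k (?x - 1)\<close> hl l by simp
  then obtain a where a: "(a, ?x) \<in> D k" by (metis (mono_tags, lifting) card.empty empty_Collect_eq)
  have a1: "1 \<le> a" using pos_D k a by blast
  have t: "l \<le> tail k a" "tail k (Suc a) < l" using box_position[OF k a] hl by auto
  then have "l \<le> M" using tail_antimono[OF k(2) a1] M by simp
  then have j: "1 \<le> M + 1 - l" "M + 1 - l \<le> M" "M + 1 - (M + 1 - l) = l" using l1 by auto
  have "a \<le> U (k, M + 1 - l)" "\<not> Suc a \<le> U (k, M + 1 - l)"
    using U k j a1 t unfolding rows_rep_def by (auto simp: not_le)
  then have "U (k, M + 1 - l) = a" by simp
  then show "(U (k, M + 1 - l), ?x) \<in> D k" using a by simp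
qed

text \<open>The box \<open>(R, x)\<close> belongs to the strip \<open>k'\<close> with which it enters the chain. That strip is earlier
  than \<open>k\<close>, hence by the lattice condition \<open>(R, x)\<close> is preceded in it by no more boxes than the given
  box is in strip \<open>k\<close>.\<close>

lemma box_above_entry:
  assumes U: "rows_rep M U" and S: "cols_rep S" and hl: head_lattice
    and M: "\<And>k. 1 \<le> k \<Longrightarrow> k \<le> p \<Longrightarrow> tail k 1 \<le> M"
    and k: "1 \<le> k" "k \<le> p" and l: "S (l, p + 1 - k) \<noteq> 0"
    and R: "1 \<le> R" "R < U (k, M + 1 - l)" "(R, S (l, p + 1 - k)) \<notin> Y 0"
  shows "\<exists>k' l'. 1 \<le> k' \<and> k' < k \<and> 1 \<le> l' \<and> l' \<le> l \<and> S (l', p + 1 - k') \<noteq> 0 \<and> U (k', M + 1 - l') = R"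
proof -
  let ?x = "S (l, p + 1 - k)"
  note box = box_of_entries[OF U S k M[OF k] l]
  have in_k: "(R, ?x) \<in> Y (k - 1)" using above[OF k _ R(1,2)] box(1) D_iff by blast
  \<comment> \<open>The strip with which the box (R, x) enters the chain.\<close>
  define k' where "k' = (LEAST k'. (R, ?x) \<in> Y k')"
  have mem: "(R, ?x) \<in> Y k'" unfolding k'_def by (rule LeastI[of "\<lambda>k'. (R, ?x) \<in> Y k'", OF in_k])
  have "k' \<le> k - 1" unfolding k'_def by (rule Least_le[of "\<lambda>k'. (R, ?x) \<in> Y k'", OF in_k])
  moreover have "k' \<noteq> 0" using mem R(3) by (metis)
  ultimately have k': "1 \<le> k'" "k' < k" "k' \<le> p" using k by auto
  have "(R, ?x) \<notin> Y (k' - 1)"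
    using not_less_Least[of "k' - 1" "\<lambda>k'. (R, ?x) \<in> Y k'"] k' unfolding k'_def by simp
  then have D: "(R, ?x) \<in> D k'" using mem D_iff by simp
  \<comment> \<open>The position of this box in its strip, counted from the left.\<close>
  define l' where "l' = head k' ?x"
  have "finite {a. (a, ?x) \<in> D k'}"
    by (rule finite_subset[OF _ finite_col[OF k'(3), of ?x]]) (auto simp: D_iff)
  then have "card {a. (a, ?x) \<in> D k'} > 0" using D by (auto simp: card_gt_0_iff)
  then have l'gt: "head k' (?x - 1) < l'" using head_Suc[OF k'(3), of "?x - 1"] l by (simp add: l'_def)
  have "l' \<le> l" using head_lattice_trans[OF hl k'(1), of k ?x] k' k box(2) by (simp add: l'_def)
  have c: "1 \<le> p + 1 - k'" "p + 1 - k' \<le> p" "p + 1 - (p + 1 - k') = k'" using k' by auto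
  have rep: "S (l', p + 1 - k') \<noteq> 0 \<and> S (l', p + 1 - k') \<le> x \<longleftrightarrow> l' \<le> head k' x" for x
    using S c l'gt unfolding cols_rep_def by (metis One_nat_def Suc_leI gr_implies_not0 not_gr_zero)
  have nz: "S (l', p + 1 - k') \<noteq> 0" "S (l', p + 1 - k') \<le> ?x" using rep[of ?x] by (auto simp: l'_def)
  moreover have "\<not> S (l', p + 1 - k') \<le> ?x - 1" using rep[of "?x - 1"] nz l'gt by auto
  ultimately have x: "S (l', p + 1 - k') = ?x" by simp
  have "(U (k', M + 1 - l'), ?x) \<in> D k'"
    using box_of_entries(1)[OF U S k'(1,3) M[OF k'(1,3)] nz(1)] x by simp
  then have "U (k', M + 1 - l') = R" using D_column[OF k'(1,3) _ D] by blast
  then show ?thesis using k' nz \<open>l' \<le> l\<close> l'gt by (intro exI[of _ k'] exI[of _ l']) simp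
qed

end

section \<open>The two systems of indices\<close>

lemma upper_strict: "1 \<le> i \<Longrightarrow> i < i' \<Longrightarrow> i' \<le> p \<Longrightarrow> p \<le> n \<Longrightarrow> upper n p i < upper n p i'"
  by (auto simp: upper_def Let_def)

lemma upper_bounds: "1 \<le> i \<Longrightarrow> i \<le> p \<Longrightarrow> p \<le> n \<Longrightarrow> i \<le> upper n p i \<and> upper n p i \<le> n"
  by (auto simp: upper_def Let_def)

lemma jth_smallest:
  assumes "finite A" "1 \<le> j" "j \<le> card A"
  shows "jth_smallest j A \<in> A" "card {a \<in> A. a < jth_smallest j A} = j - 1"
proof -
  let ?xs = "sorted_list_of_set A"
  have len: "length ?xs = card A" and set: "set ?xs = A" using assms(1) by auto
  have sorted: "sorted_wrt (<) ?xs" by (rule strict_sorted_list_of_set)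
  have j: "j - 1 < length ?xs" using assms len by simp
  show "jth_smallest j A \<in> A" unfolding jth_smallest_def using nth_mem[OF j] set by simp
  have nth_less: "?xs ! i < ?xs ! i' \<longleftrightarrow> i < i'" if "i < length ?xs" "i' < length ?xs" for i i'
    using sorted_wrt_nth_less[OF sorted, of i i'] sorted_wrt_nth_less[OF sorted, of i' i] that
    by (cases i i' rule: linorder_cases) auto
  have "{a \<in> A. a < ?xs ! (j - 1)} = (!) ?xs ` {..<j - 1}"
  proof
    show "{a \<in> A. a < ?xs ! (j - 1)} \<subseteq> (!) ?xs ` {..<j - 1}"
    proof
      fix a assume a: "a \<in> {a \<in> A. a < ?xs ! (j - 1)}"
      then obtain i where "i < length ?xs" "a = ?xs ! i" using set by (metis (mono_tags, lifting) in_set_conv_nth mem_Collect_eq)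
      then show "a \<in> (!) ?xs ` {..<j - 1}" using a nth_less[of i "j - 1"] j by auto
    qed
    show "(!) ?xs ` {..<j - 1} \<subseteq> {a \<in> A. a < ?xs ! (j - 1)}"
      using nth_less j set nth_mem[of _ ?xs] by fastforce
  qed
  moreover have "inj_on ((!) ?xs) {..<j - 1}"
    using nth_less j by (auto simp: inj_on_def) (metis less_trans nat_neq_iff One_nat_def)
  ultimately show "card {a \<in> A. a < jth_smallest j A} = j - 1"
    by (simp add: jth_smallest_def card_image)
qed

text \<open>The numbers of the two definitions: \<open>d\<close> gives the row lengths of \<open>\<delta>\<close>, and \<open>(\<sigma> i, s i)\<close> and
  \<open>(\<tau> j, t j)\<close> are the first box of strip \<open>p + 1 - i\<close> and the second box of strip \<open>p + 1 - j\<close> from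
  the left, given by row and column. The last two assumptions describe the boxes above them that are not in
  \<open>\<delta>\<close>: these are first or second boxes of the strips for larger indices.\<close>

locale index_data =
  fixes n p q :: nat and d \<sigma> \<tau> s t :: "nat \<Rightarrow> nat"
  assumes pq: "p + q \<le> n" "q \<le> p"
    and d: "1 \<le> a \<Longrightarrow> a \<le> b \<Longrightarrow> d b \<le> d a"
    and \<sigma>_range: "1 \<le> i \<Longrightarrow> i \<le> p \<Longrightarrow> 1 \<le> \<sigma> i \<and> \<sigma> i \<le> n"
    and \<sigma>_step: "1 \<le> i \<Longrightarrow> i < p \<Longrightarrow> \<sigma> (Suc i) < \<sigma> i"
    and \<tau>_range: "1 \<le> j \<Longrightarrow> j \<le> q \<Longrightarrow> 1 \<le> \<tau> j"
    and s: "1 \<le> i \<Longrightarrow> i \<le> p \<Longrightarrow> d (\<sigma> i) < s i"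
    and t: "1 \<le> j \<Longrightarrow> j \<le> q \<Longrightarrow> d (\<tau> j) < t j"
    and s_above: "1 \<le> i \<Longrightarrow> i \<le> p \<Longrightarrow> 1 \<le> R \<Longrightarrow> R < \<sigma> i \<Longrightarrow> d R < s i
      \<Longrightarrow> \<exists>i'. i < i' \<and> i' \<le> p \<and> \<sigma> i' = R"
    and t_above: "1 \<le> j \<Longrightarrow> j \<le> q \<Longrightarrow> 1 \<le> R \<Longrightarrow> R < \<tau> j \<Longrightarrow> d R < t j
      \<Longrightarrow> \<exists>i'. j < i' \<and> i' \<le> p \<and> (\<sigma> i' = R \<or> i' \<le> q \<and> \<tau> i' = R)"
begin

definition m :: "nat \<Rightarrow> nat" where
  "m i = min (n + 1 - \<sigma> i) (upper n p i)"

lemma pn: "p \<le> n" using pq by simp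

lemma \<sigma>_strict: "1 \<le> i \<Longrightarrow> i < i' \<Longrightarrow> i' \<le> p \<Longrightarrow> \<sigma> i' < \<sigma> i"
proof -
  assume h: "1 \<le> i" "i < i'" "i' \<le> p"
  have "Suc i \<le> i'" using h by simp
  then show ?thesis using h(3)
  proof (induction i' rule: dec_induct)
    case base
    then show ?case using \<sigma>_step h by simp
  next
    case (step k)
    then show ?case using \<sigma>_step[of k] h by simp
  qed
qed

lemma \<sigma>_upper: "1 \<le> i \<Longrightarrow> i \<le> p \<Longrightarrow> \<sigma> i + i \<le> n + 1"
proof (induction i rule: dec_induct)
  case base
  then show ?case using \<sigma>_range[of 1] by simp
next
  case (step i)
  then show ?case using \<sigma>_step[of i] by simp
qed

lemma \<sigma>_lower: "i \<le> p \<Longrightarrow> 1 \<le> i \<Longrightarrow> p + 1 \<le> \<sigma> i + i"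
proof (induction rule: inc_induct)
  case base
  then show ?case using \<sigma>_range[of p] by simp
next
  case (step i)
  then show ?case using \<sigma>_step[of i] by simp
qed

lemma m_strict: "1 \<le> i \<Longrightarrow> i < i' \<Longrightarrow> i' \<le> p \<Longrightarrow> m i < m i'"
  using \<sigma>_strict[of i i'] upper_strict[of i i' p n] \<sigma>_range[of i] \<sigma>_range[of i'] pn
  by (auto simp: m_def)

lemma m_bounds: "1 \<le> i \<Longrightarrow> i \<le> p \<Longrightarrow> i \<le> m i \<and> m i \<le> n"
  using \<sigma>_upper[of i] upper_bounds[of i p n] pn by (auto simp: m_def)

text \<open>The number \<open>m i\<close> is admissible because the box \<open>(\<sigma> i, s i)\<close> lies outside \<open>\<delta>\<close>. An admissible
  \<open>k\<close> larger than \<open>n + 1 - \<sigma> i\<close> would put the box in row \<open>R = n + 1 - k\<close> above it outside \<open>\<delta>\<close> as well.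
  Then \<open>R = \<sigma> i'\<close> for some \<open>i' > i\<close>, and \<open>k \<le> upper n p i < upper n p i'\<close> gives \<open>m i' = k\<close>, so that
  \<open>k\<close> is already taken.\<close>

lemma Max_m:
  assumes i: "1 \<le> i" "i \<le> p"
  shows "Max {k \<in> {i..upper n p i} - m ` {i + 1..p}. d (n + 1 - k) < s i} = m i"
proof (rule Max_eqI)
  show "finite {k \<in> {i..upper n p i} - m ` {i + 1..p}. d (n + 1 - k) < s i}" by simp
  have "m i \<notin> m ` {i + 1..p}" using m_strict[of i] i by (auto simp: Suc_le_eq) (metis nat_neq_iff)
  moreover have "d (n + 1 - m i) < s i"
  proof -
    have "d (n + 1 - m i) \<le> d (\<sigma> i)"
      using \<sigma>_range[OF i] by (intro d) (auto simp: m_def)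
    then show ?thesis using s[OF i] by simp
  qed
  ultimately show "m i \<in> {k \<in> {i..upper n p i} - m ` {i + 1..p}. d (n + 1 - k) < s i}"
    using m_bounds[OF i] by (auto simp: m_def)
next
  fix k assume k: "k \<in> {k \<in> {i..upper n p i} - m ` {i + 1..p}. d (n + 1 - k) < s i}"
  have "k \<le> n + 1 - \<sigma> i"
  proof (rule ccontr)
    \<comment> \<open>The bound k \<le> upper n p i \<le> n makes row n + 1 - k a genuine row.\<close>
    assume "\<not> k \<le> n + 1 - \<sigma> i"
    then have R: "1 \<le> n + 1 - k" "n + 1 - k < \<sigma> i"
      using k upper_bounds[OF i pn] \<sigma>_range[OF i] by auto
    then obtain i' where i': "i < i'" "i' \<le> p" "\<sigma> i' = n + 1 - k"
      using s_above[OF i R] k by auto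
    have "k \<le> n" using k upper_bounds[OF i pn] by auto
    then have "m i' = k" using i' k upper_strict[OF i(1) i'(1,2) pn] by (auto simp: m_def)
    then show False using k i' by auto
  qed
  then show "k \<le> m i" using k by (simp add: m_def)
qed

abbreviation free :: "nat \<Rightarrow> nat set" where
  "free j \<equiv> {j + 1..n} - m ` {j + 1..p}"

lemma card_free: "j \<le> p \<Longrightarrow> card (free j) = n - p"
proof -
  assume j: "j \<le> p"
  have "inj_on m {j + 1..p}"
  proof (rule inj_onI)
    fix x y assume h: "x \<in> {j + 1..p}" "y \<in> {j + 1..p}" "m x = m y"
    then show "x = y" using m_strict[of x y] m_strict[of y x] by (cases x y rule: linorder_cases) auto
  qed
  then have "card (m ` {j + 1..p}) = p - j" by (simp add: card_image)
  moreover have "m ` {j + 1..p} \<subseteq> {j + 1..n}"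
  proof (rule image_subsetI)
    fix x assume "x \<in> {j + 1..p}"
    then show "m x \<in> {j + 1..n}" using m_bounds[of x] by auto
  qed
  ultimately have "card (free j) = (n - j) - (p - j)" by (simp add: card_Diff_subset)
  then show ?thesis using j by simp
qed

lemma n_index:
  assumes "1 \<le> j" "j \<le> q"
  shows "n_index n p m j \<in> free j" "card {a \<in> free j. a < n_index n p m j} = j - 1"
  unfolding n_index_def
  using jth_smallest[of "free j" j] card_free[of j] assms pq by auto

text \<open>Passing from \<open>free j\<close> to \<open>free (Suc j)\<close> removes \<open>Suc j\<close> and adds at most \<open>m (Suc j)\<close>, which is at least
  \<open>Suc j\<close>. So no initial part gains elements, whereas the element sought moves up by one place.\<close>

lemma n_index_step:
  assumes j: "1 \<le> j" "Suc j \<le> q"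
  shows "n_index n p m j < n_index n p m (Suc j)"
proof (rule ccontr)
  let ?N = "n_index n p m j" and ?N' = "n_index n p m (Suc j)"
  assume "\<not> ?N < ?N'"
  then have le: "?N' \<le> ?N" by simp
  note N = n_index[OF j(1)] and N' = n_index[of "Suc j"]
  have fin: "finite {a \<in> free i. P a}" for i P by simp
  have "{a \<in> free j. a \<le> ?N} = insert ?N {a \<in> free j. a < ?N}" using N(1) j by auto
  then have c: "card {a \<in> free j. a \<le> ?N} = j" using N(2) j by simp
  have "{a \<in> free (Suc j). a \<le> ?N'} = insert ?N' {a \<in> free (Suc j). a < ?N'}" using N'(1) j by auto
  then have "card {a \<in> free (Suc j). a \<le> ?N'} = Suc j" using N'(2) j by simp
  moreover have "card {a \<in> free (Suc j). a \<le> ?N'} \<le> card {a \<in> free (Suc j). a \<le> ?N}"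
    using le by (intro card_mono fin) auto
  moreover have "card {a \<in> free (Suc j). a \<le> ?N} \<le> card {a \<in> free j. a \<le> ?N}"
  proof (cases "m (Suc j) = Suc j")
    case True
    have "{Suc j..p} = insert (Suc j) {Suc (Suc j)..p}" using j pq by auto
    then have "free (Suc j) \<subseteq> free j" using True by auto
    then show ?thesis by (intro card_mono fin) auto
  next
    case False
    have notin: "Suc j \<notin> m ` {j + 1..p}"
    proof
      assume "Suc j \<in> m ` {j + 1..p}"
      then obtain i where i: "j + 1 \<le> i" "i \<le> p" "Suc j = m i" by auto
      have "i \<le> Suc j" using m_bounds[of i] i by linarith
      then have "i = Suc j" using i(1) by simp
      then show False using False i(3) by metis
    qed
    then have mem: "Suc j \<in> {a \<in> free j. a \<le> ?N}" using N(1) j pq by auto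
    have "{a \<in> free (Suc j). a \<le> ?N} \<subseteq> insert (m (Suc j)) ({a \<in> free j. a \<le> ?N} - {Suc j})"
    proof
      fix a assume a: "a \<in> {a \<in> free (Suc j). a \<le> ?N}"
      have "a \<in> m ` {j + 1..p} \<Longrightarrow> a = m (Suc j)"
      proof -
        assume "a \<in> m ` {j + 1..p}"
        then obtain i where "j + 1 \<le> i" "i \<le> p" "a = m i" by auto
        then show ?thesis using a by (cases "i = Suc j") auto
      qed
      then show "a \<in> insert (m (Suc j)) ({a \<in> free j. a \<le> ?N} - {Suc j})" using a by auto
    qed
    then have "card {a \<in> free (Suc j). a \<le> ?N} \<le> card (insert (m (Suc j)) ({a \<in> free j. a \<le> ?N} - {Suc j}))"
      by (intro card_mono) auto
    also have "\<dots> \<le> Suc (card ({a \<in> free j. a \<le> ?N} - {Suc j}))" by (rule card_insert_le_m1) auto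
    also have "\<dots> = card {a \<in> free j. a \<le> ?N}" using mem by (intro card_Suc_Diff1 fin)
    finally show ?thesis .
  qed
  ultimately show False using c by simp
qed

lemma n_index_strict: "1 \<le> j \<Longrightarrow> j < j' \<Longrightarrow> j' \<le> q \<Longrightarrow> n_index n p m j < n_index n p m j'"
proof -
  assume h: "1 \<le> j" "j < j'" "j' \<le> q"
  have "Suc j \<le> j'" using h by simp
  then show ?thesis using h(3)
  proof (induction j' rule: dec_induct)
    case base
    then show ?case using n_index_step h by simp
  next
    case (step k)
    then show ?case using n_index_step[of k] h by simp
  qed
qed

text \<open>If \<open>\<tau> j + N \<le> n + 1\<close> for \<open>N = n_index n p m j\<close>, then row \<open>n + 1 - N\<close> is not above row \<open>\<tau> j\<close>, where
  \<open>\<delta>\<close> is shorter than \<open>t j\<close>. Conversely let the first condition hold and argue by induction from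
  \<open>j = q\<close> downwards. If \<open>R = n + 1 - N\<close> were above \<open>\<tau> j\<close>, then \<open>R\<close> would be \<open>\<tau> i\<close> or \<open>\<sigma> i\<close> for some
  \<open>i > j\<close>. In the first case the induction hypothesis for \<open>i\<close> contradicts the growth of the
  \<open>n_index\<close>. In the second case \<open>N\<close> is free and so differs from \<open>m i\<close>, which forces
  \<open>m i = 2 * i - 1 < N\<close>; but then at least \<open>i - 1 \<ge> j\<close> free numbers are smaller than \<open>N\<close>, one too
  many.\<close>

lemma over_iff_under:
  "(\<forall>j\<in>{1..q}. d (n + 1 - n_index n p m j) < t j) \<longleftrightarrow> (\<forall>j\<in>{1..q}. \<tau> j + n_index n p m j \<le> n + 1)"
proof
  assume under: "\<forall>j\<in>{1..q}. \<tau> j + n_index n p m j \<le> n + 1"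
  show "\<forall>j\<in>{1..q}. d (n + 1 - n_index n p m j) < t j"
  proof
    fix j assume j: "j \<in> {1..q}"
    have "\<tau> j + n_index n p m j \<le> n + 1" using under j by blast
    then have "d (n + 1 - n_index n p m j) \<le> d (\<tau> j)"
      using \<tau>_range[of j] j by (intro d) auto
    then show "d (n + 1 - n_index n p m j) < t j" using t[of j] j by simp
  qed
next
  assume over: "\<forall>j\<in>{1..q}. d (n + 1 - n_index n p m j) < t j"
  have "j \<le> q \<Longrightarrow> 1 \<le> j \<Longrightarrow> \<tau> j + n_index n p m j \<le> n + 1" for j
  proof (induction "q - j" arbitrary: j rule: less_induct)
    case less
    note j = less.prems(2,1)
    let ?N = "n_index n p m j"
    have IH: "\<tau> i + n_index n p m i \<le> n + 1" if "j < i" "i \<le> q" for i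
      using less.hyps[of i] that j by simp
    show ?case
    proof (rule ccontr)
      assume neg: "\<not> \<tau> j + ?N \<le> n + 1"
      have N: "j + 1 \<le> ?N" "?N \<le> n" "?N \<notin> m ` {j + 1..p}" using n_index(1)[OF j] by auto
      define R where "R = n + 1 - ?N"
      have R: "1 \<le> R" "R < \<tau> j" "?N = n + 1 - R" using N neg by (auto simp: R_def)
      have "d R < t j" using over j by (simp add: R_def)
      then obtain i where i: "j < i" "i \<le> p" "\<sigma> i = R \<or> i \<le> q \<and> \<tau> i = R"
        using t_above[OF j R(1,2)] by blast
      from i(3) show False
      proof
        assume "i \<le> q \<and> \<tau> i = R"
        then show False using IH[of i] n_index_strict[of j i] i j R N by simp
      next
        assume \<sigma>: "\<sigma> i = R"
        have "m i \<in> m ` {j + 1..p}" using i(1,2) by simp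
        then have "m i \<noteq> ?N" using N(3) by metis
        then have m: "m i = upper n p i" "upper n p i < ?N" using \<sigma> R(3) by (auto simp: m_def)
        \<comment> \<open>As p - i positive numbers \<sigma> i' with i' > i lie below \<sigma> i, n + 1 - \<sigma> i \<le> n - p + i.\<close>
        have "\<not> upper n p i = n - p + i"
          using m(2) \<sigma>_lower[of i] i j \<sigma> R(3) pn N by simp
        then have up: "upper n p i = 2 * i - 1" by (simp add: upper_def Let_def split: if_splits)
        have "{j + 1..2 * i - 1} - m ` {j + 1..i} \<subseteq> {a \<in> free j. a < ?N}"
        proof
          fix a assume a: "a \<in> {j + 1..2 * i - 1} - m ` {j + 1..i}"
          have "a \<notin> m ` {j + 1..p}"
          proof
            assume "a \<in> m ` {j + 1..p}"
            then obtain k where k: "j + 1 \<le> k" "k \<le> p" "a = m k" by auto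
            then have "i < k" using a by auto
            then have "m i < m k" using m_strict[of i k] i j k by simp
            then show False using a k m up by simp
          qed
          then show "a \<in> {a \<in> free j. a < ?N}" using a m up N by auto
        qed
        then have "card ({j + 1..2 * i - 1} - m ` {j + 1..i}) \<le> card {a \<in> free j. a < ?N}"
          by (intro card_mono) auto
        moreover have "card {j + 1..2 * i - 1} - card (m ` {j + 1..i}) \<le> card ({j + 1..2 * i - 1} - m ` {j + 1..i})"
          by (rule diff_card_le_card_Diff) simp
        moreover have "card (m ` {j + 1..i}) \<le> i - j" using card_image_le[of "{j + 1..i}" m] by simp
        ultimately show False using n_index(2)[OF j] i j by simp
      qed
    qed
  qed
  then show "\<forall>j\<in>{1..q}. \<tau> j + n_index n p m j \<le> n + 1" by simp
qed

end

section \<open>The bijection\<close>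

lemma decr_antimono:
  assumes "decr \<nu>" "1 \<le> a" "a \<le> b" shows "\<nu> b \<le> \<nu> a"
  using assms(3)
proof (induction b rule: dec_induct)
  case (step k)
  then show ?case using assms(1,2) unfolding decr_def by (meson le_trans)
qed simp

lemma part_antimono: "is_partition \<nu> \<Longrightarrow> 1 \<le> a \<Longrightarrow> a \<le> b \<Longrightarrow> part \<nu> b \<le> part \<nu> a"
  using decr_antimono is_shape_decr is_shape_part by blast

lemma part_pos_iff:
  assumes "is_partition \<nu>" shows "1 \<le> part \<nu> a \<longleftrightarrow> 1 \<le> a \<and> a \<le> length \<nu>"
proof (cases "1 \<le> a \<and> a \<le> length \<nu>")
  case True
  then have "\<nu> ! (a - 1) \<in> set \<nu>" by (intro nth_mem) linarith
  then have "\<nu> ! (a - 1) \<noteq> 0" using assms unfolding is_partition_def by metis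
  then show ?thesis using True by (simp add: part_def)
qed (auto simp: part_def)

lemma finite_young_is_shape:
  assumes "is_shape \<nu>" shows "finite (young \<nu>)"
proof -
  obtain ls where ls: "is_partition ls" "\<forall>a\<ge>1. \<nu> a = parts_ge ls a"
    using assms by (auto simp: is_shape_def)
  have "young \<nu> = young (parts_ge ls)" using ls(2) by (simp add: young_eq_iff)
  also have "\<dots> = converse (young (part ls))" by (rule young_converse[OF ls(1)])
  finally have "young \<nu> = converse (young (part ls))" .
  moreover have "young (part ls) \<subseteq> Sigma {1..length ls} (\<lambda>a. {..part ls a})"
    by (auto simp: young_def part_def split: if_splits)
  then have "finite (young (part ls))" by (rule finite_subset) auto
  ultimately show ?thesis by simp
qed

lemma part_conjugate_1: "is_partition \<mu> \<Longrightarrow> part (conjugate \<mu>) 1 = length \<mu>"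
proof -
  assume \<mu>: "is_partition \<mu>"
  have "filter (\<lambda>l. 1 \<le> l) \<mu> = \<mu>"
    using \<mu> by (intro filter_True) (auto simp: is_partition_def Suc_le_eq intro: gr0I)
  then show ?thesis using part_conjugate[OF \<mu>, of 1] by (simp add: parts_ge_def)
qed

lemma diagram_conjugate_iff:
  "is_partition \<mu> \<Longrightarrow> (l, c) \<in> diagram (conjugate \<mu>) \<longleftrightarrow> 1 \<le> c \<and> 1 \<le> l \<and> l \<le> part \<mu> c"
  using young_conjugate[of \<mu>] by (auto simp: diagram_young young_def)

lemma rot_diagram_iff:
  assumes \<mu>: "is_partition \<mu>"
  shows "(k, j) \<in> rot_diagram \<mu> \<longleftrightarrow> 1 \<le> k \<and> k \<le> length \<mu> \<and> 1 \<le> j \<and> j \<le> part \<mu> 1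
    \<and> part \<mu> 1 + 1 - j \<le> part \<mu> (length \<mu> + 1 - k)"
proof
  assume "(k, j) \<in> rot_diagram \<mu>"
  then obtain a y where ay: "1 \<le> a" "1 \<le> y" "y \<le> part \<mu> a" "k = length \<mu> + 1 - a" "j = part \<mu> 1 + 1 - y"
    by (auto simp: rot_diagram_def diagram_def)
  have "1 \<le> part \<mu> a" using ay by simp
  then have "a \<le> length \<mu>" using part_pos_iff[OF \<mu>] by blast
  moreover have "part \<mu> a \<le> part \<mu> 1" using part_antimono[OF \<mu> order_refl ay(1)] .
  moreover have "length \<mu> + 1 - k = a" "part \<mu> 1 + 1 - j = y" using ay calculation by auto
  ultimately show "1 \<le> k \<and> k \<le> length \<mu> \<and> 1 \<le> j \<and> j \<le> part \<mu> 1
    \<and> part \<mu> 1 + 1 - j \<le> part \<mu> (length \<mu> + 1 - k)" using ay by auto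
next
  assume h: "1 \<le> k \<and> k \<le> length \<mu> \<and> 1 \<le> j \<and> j \<le> part \<mu> 1
    \<and> part \<mu> 1 + 1 - j \<le> part \<mu> (length \<mu> + 1 - k)"
  then have "(length \<mu> + 1 - k, part \<mu> 1 + 1 - j) \<in> diagram \<mu>" by (auto simp: diagram_def)
  moreover have "length \<mu> + 1 - (length \<mu> + 1 - k) = k" "part \<mu> 1 + 1 - (part \<mu> 1 + 1 - j) = j"
    using h by auto
  ultimately show "(k, j) \<in> rot_diagram \<mu>"
    unfolding rot_diagram_def by (metis (mono_tags, lifting) case_prod_conv image_eqI)
qed

lemma diagram_conjugate_box:
  assumes "is_partition \<mu>" shows "diagram (conjugate \<mu>) \<subseteq> {1..part \<mu> 1} \<times> {1..length \<mu>}"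
proof
  fix b assume "b \<in> diagram (conjugate \<mu>)"
  then obtain l c where b: "b = (l, c)" "(l, c) \<in> diagram (conjugate \<mu>)" by (cases b) auto
  have h: "1 \<le> c" "1 \<le> l" "l \<le> part \<mu> c" using b diagram_conjugate_iff[OF assms] by auto
  then have "1 \<le> part \<mu> c" by simp
  then have "c \<le> length \<mu>" using part_pos_iff[OF assms] by blast
  then show "b \<in> {1..part \<mu> 1} \<times> {1..length \<mu>}"
    using b h part_antimono[OF assms order_refl h(1)] by auto
qed

lemma rot_diagram_box:
  "is_partition \<mu> \<Longrightarrow> rot_diagram \<mu> \<subseteq> {1..length \<mu>} \<times> {1..part \<mu> 1}"
  by (auto simp: rot_diagram_iff)

lemma shape_iff: "b \<in> shape T \<longleftrightarrow> T b \<noteq> 0"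
  by (simp add: shape_def)

lemma SST_conjugate_iff:
  assumes \<mu>: "is_partition \<mu>"
  shows "S \<in> SST (diagram (conjugate \<mu>)) \<longleftrightarrow>
    shape S = diagram (conjugate \<mu>) \<and> normal_std (part \<mu> 1) (length \<mu>) S"
proof
  assume S: "S \<in> SST (diagram (conjugate \<mu>))"
  then have sh: "shape S = diagram (conjugate \<mu>)" by (simp add: SST_def)
  have nz: "S (l, c) \<noteq> 0 \<longleftrightarrow> 1 \<le> c \<and> 1 \<le> l \<and> l \<le> part \<mu> c" for l c
    using diagram_conjugate_iff[OF \<mu>, of l c] shape_iff[of "(l, c)" S] sh by simp
  have row: "S (l, c) \<le> S (l, c')" if "S (l, c) \<noteq> 0" "S (l, c') \<noteq> 0" "c < c'" for l c c'
    using S that unfolding SST_def shape_def by blast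
  have col: "S (l, c) < S (l', c)" if "S (l, c) \<noteq> 0" "S (l', c) \<noteq> 0" "l < l'" for l l' c
    using S that unfolding SST_def shape_def by blast
  have "S (l', c) \<noteq> 0 \<and> S (l', c) < S (l, c)" if "S (l, c) \<noteq> 0" "1 \<le> l'" "l' < l" for l l' c
    using nz[of l c] nz[of l' c] col[of l' c l] that by auto
  moreover have "S (l, c) \<noteq> 0 \<and> S (l, c) \<le> S (l, c')" if "S (l, c') \<noteq> 0" "1 \<le> c" "c < c'" for l c c'
    using nz[of l c] nz[of l c'] part_antimono[OF \<mu>, of c c'] row[of l c c'] that by auto
  moreover have "in_box S (part \<mu> 1) (length \<mu>)" using sh diagram_conjugate_box[OF \<mu>] by simp
  ultimately show "shape S = diagram (conjugate \<mu>) \<and> normal_std (part \<mu> 1) (length \<mu>) S"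
    unfolding normal_std_def using sh by blast
next
  assume h: "shape S = diagram (conjugate \<mu>) \<and> normal_std (part \<mu> 1) (length \<mu>) S"
  then have "1 \<le> l \<and> 1 \<le> c" if "S (l, c) \<noteq> 0" for l c
    using in_boxD[of S "part \<mu> 1" "length \<mu>" l c] that unfolding normal_std_def by blast
  then show "S \<in> SST (diagram (conjugate \<mu>))"
    using h unfolding SST_def normal_std_def shape_def by blast
qed

lemma SST_rot_iff:
  assumes \<mu>: "is_partition \<mu>"
  shows "U \<in> SST (rot_diagram \<mu>) \<longleftrightarrow>
    shape U = rot_diagram \<mu> \<and> anti_std (length \<mu>) (part \<mu> 1) U"
proof
  assume U: "U \<in> SST (rot_diagram \<mu>)"
  then have sh: "shape U = rot_diagram \<mu>" by (simp add: SST_def)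
  have nz: "U (k, j) \<noteq> 0 \<longleftrightarrow> (k, j) \<in> rot_diagram \<mu>" for k j
    using shape_iff[of "(k, j)" U] sh by simp
  have row: "U (k, j) \<le> U (k, j')" if "U (k, j) \<noteq> 0" "U (k, j') \<noteq> 0" "j < j'" for k j j'
    using U that unfolding SST_def shape_def by blast
  have col: "U (k, j) < U (k', j)" if "U (k, j) \<noteq> 0" "U (k', j) \<noteq> 0" "k < k'" for k k' j
    using U that unfolding SST_def shape_def by blast
  have "U (k, j) \<le> U (k, j')" if "1 \<le> j" "j \<le> j'" "j' \<le> part \<mu> 1" for k j j'
  proof (cases "U (k, j) = 0 \<or> j = j'")
    case False
    then have "U (k, j') \<noteq> 0" using that nz rot_diagram_iff[OF \<mu>] by auto
    then show ?thesis using row[of k j j'] False that by simp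
  qed auto
  moreover have "U (k, j) < U (k', j)" if h: "U (k, j) \<noteq> 0" "k < k'" "k' \<le> length \<mu>" for k k' j
  proof -
    have kj: "(k, j) \<in> rot_diagram \<mu>" using h(1) nz by simp
    have "part \<mu> (length \<mu> + 1 - k) \<le> part \<mu> (length \<mu> + 1 - k')"
      using h by (intro part_antimono[OF \<mu>]) auto
    then have "(k', j) \<in> rot_diagram \<mu>" using kj h unfolding rot_diagram_iff[OF \<mu>] by auto
    then show ?thesis using col[of k j k'] nz h by blast
  qed
  moreover have "in_box U (length \<mu>) (part \<mu> 1)" using sh rot_diagram_box[OF \<mu>] by simp
  ultimately show "shape U = rot_diagram \<mu> \<and> anti_std (length \<mu>) (part \<mu> 1) U"
    unfolding anti_std_def using sh by blast
next
  assume h: "shape U = rot_diagram \<mu> \<and> anti_std (length \<mu>) (part \<mu> 1) U"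
  have pos: "1 \<le> k \<and> k \<le> length \<mu> \<and> 1 \<le> j \<and> j \<le> part \<mu> 1" if "(k, j) \<in> rot_diagram \<mu>" for k j
    using that rot_diagram_iff[OF \<mu>] by blast
  show "U \<in> SST (rot_diagram \<mu>)"
    unfolding SST_def
  proof (intro CollectI conjI allI impI; (elim conjE)?)
    show "shape U = rot_diagram \<mu>" using h by blast
    show "U (i, j) \<le> U (i, j')" if "(i, j) \<in> rot_diagram \<mu>" "(i, j') \<in> rot_diagram \<mu>" "j < j'" for i j j'
      using h that pos[of i j] pos[of i j'] unfolding anti_std_def by (meson less_imp_le)
    show "U (i, j) < U (i', j)" if "(i, j) \<in> rot_diagram \<mu>" "(i', j) \<in> rot_diagram \<mu>" "i < i'" for i i' j
    proof -
      have "U (i, j) \<noteq> 0" using h that shape_iff by blast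
      then show ?thesis using h that pos[of i' j] unfolding anti_std_def by blast
    qed
  qed
qed

lemma chain_mono:
  assumes "\<And>i. i < p \<Longrightarrow> E i \<subseteq> E (Suc i)" "i \<le> j" "j \<le> p" shows "E i \<subseteq> E j"
  using assms(2,3)
proof (induction j rule: dec_induct)
  case (step k)
  then show ?case using assms(1)[of k] by auto
qed simp

text \<open>The differences of consecutive members of a growing chain are disjoint, so the definite description
  is the only index available.\<close>

lemma recording_eq_iff:
  assumes mono: "\<And>i. i < p \<Longrightarrow> E i \<subseteq> E (Suc i)" and i: "1 \<le> i" "i \<le> p"
  shows "recording p E b = i \<longleftrightarrow> b \<in> E i - E (i - 1)"
proof -
  note incr = chain_mono[where p = p and E = E, OF mono]
  have uniq: "x = y" if "x \<in> {1..p} \<and> b \<in> E x - E (x - 1)" "y \<in> {1..p} \<and> b \<in> E y - E (y - 1)" for x y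
  proof -
    have "x \<le> y - 1 \<and> y - 1 \<le> p" if "x < y" using that \<open>y \<in> {1..p} \<and> _\<close> by auto
    then have "\<not> x < y" using incr[of x "y - 1"] that by blast
    moreover have "y \<le> x - 1 \<and> x - 1 \<le> p" if "y < x" using that \<open>x \<in> {1..p} \<and> _\<close> by auto
    then have "\<not> y < x" using incr[of y "x - 1"] that by blast
    ultimately show ?thesis by simp
  qed
  show ?thesis
  proof (cases "\<exists>j\<in>{1..p}. b \<in> E j - E (j - 1)")
    case True
    then obtain j where j: "j \<in> {1..p} \<and> b \<in> E j - E (j - 1)" by blast
    then have "recording p E b = j" unfolding recording_def using True uniq
      by (simp, intro the_equality) auto
    then show ?thesis using j uniq i by auto
  next
    case False
    then show ?thesis using i by (auto simp: recording_def)
  qed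
qed

lemma recording_cong:
  assumes "\<forall>i\<le>p. E i = F i" shows "recording p E = recording p F"
proof -
  have "i \<in> {1..p} \<and> b \<in> E i - E (i - 1) \<longleftrightarrow> i \<in> {1..p} \<and> b \<in> F i - F (i - 1)" for i b
    using assms by auto
  then show ?thesis unfolding recording_def Bex_def by (simp only:)
qed

lemma recording_inject:
  assumes E: "\<And>i. i < p \<Longrightarrow> E i \<subseteq> E (Suc i)" and F: "\<And>i. i < p \<Longrightarrow> F i \<subseteq> F (Suc i)"
    and zero: "E 0 = F 0"
  shows "recording p E = recording p F \<longleftrightarrow> (\<forall>i\<le>p. E i = F i)"
proof
  assume eq: "recording p E = recording p F"
  have "i \<le> p \<Longrightarrow> E i = F i" for i
  proof (induction i)
    case (Suc i)
    have sub: "E i \<subseteq> E (Suc i)" "F i \<subseteq> F (Suc i)" using E[of i] F[of i] Suc.prems by auto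
    have "E (Suc i) = E i \<union> {b. recording p E b = Suc i}"
      using recording_eq_iff[where p = p and E = E and i = "Suc i", OF E] sub Suc.prems by auto
    moreover have "F (Suc i) = F i \<union> {b. recording p F b = Suc i}"
      using recording_eq_iff[where p = p and E = F and i = "Suc i", OF F] sub Suc.prems by auto
    ultimately show ?case using Suc eq by simp
  qed (simp add: zero)
  then show "\<forall>i\<le>p. E i = F i" by blast
qed (rule recording_cong)

text \<open>The shapes of the successive insertions, transposed in the first case so that both are chains
  from \<open>\<delta>\<close> to \<open>lam\<close>.\<close>

definition conj_chain :: "nat list \<Rightarrow> nat \<Rightarrow> tableau \<Rightarrow> nat \<Rightarrow> (nat \<times> nat) set" where
  "conj_chain \<delta> p S i = converse (young (\<lambda>x. part (conjugate \<delta>) x + col_content S (p - i) x))"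

definition rot_chain :: "nat list \<Rightarrow> tableau \<Rightarrow> nat \<Rightarrow> (nat \<times> nat) set" where
  "rot_chain \<delta> U i = young (\<lambda>a. part \<delta> a + row_content U i a)"

locale LR_data =
  fixes \<mu> lam \<delta> :: "nat list"
  assumes \<mu>: "is_partition \<mu>" and lam: "is_partition lam" and \<delta>: "is_partition \<delta>"
begin

abbreviation p :: nat where "p \<equiv> length \<mu>"
abbreviation M :: nat where "M \<equiv> part \<mu> 1"

lemma LR_conj_iff: "S \<in> LR_conj lam \<delta> \<mu> \<longleftrightarrow>
   shape S = diagram (conjugate \<mu>) \<and> normal_std M p S
   \<and> (\<forall>c. decr (\<lambda>x. part (conjugate \<delta>) x + col_content S c x))
   \<and> (\<forall>x\<ge>1. part (conjugate lam) x = part (conjugate \<delta>) x + col_content S 0 x)"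
  using LR_iff[OF diagram_conjugate_box[OF \<mu>] is_partition_conjugate[OF \<delta>] is_partition_conjugate[OF lam]]
    SST_conjugate_iff[OF \<mu>] by auto

lemma LR_rot_iff: "U \<in> LR_rot lam \<delta> \<mu> \<longleftrightarrow>
   shape U = rot_diagram \<mu> \<and> anti_std p M U
   \<and> (\<forall>c. decr (\<lambda>a. part \<delta> a + col_content U c a))
   \<and> (\<forall>a\<ge>1. part lam a = part \<delta> a + col_content U 0 a)"
  using LR_iff[OF rot_diagram_box[OF \<mu>] \<delta> lam] SST_rot_iff[OF \<mu>] by auto

lemma conj_chain_insert:
  assumes S: "S \<in> LR_conj lam \<delta> \<mu>" and i: "i \<le> p"
  shows "converse (shape (insert_chain (\<lambda>k. restrict_tab S {b. snd b = p + 1 - k}) (H_tab (conjugate \<delta>)) i))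
      = conj_chain \<delta> p S i"
    and "is_shape (\<lambda>x. part (conjugate \<delta>) x + col_content S (p - i) x)"
proof -
  have box: "in_box S M p" using S unfolding LR_conj_iff normal_std_def by blast
  have cs: "col_strict S" using S SST_col_strict by (auto simp: LR_def)
  note c = insert_chain_columns[OF box cs is_partition_conjugate[OF \<delta>] _ i]
  show "converse (shape (insert_chain (\<lambda>k. restrict_tab S {b. snd b = p + 1 - k}) (H_tab (conjugate \<delta>)) i))
      = conj_chain \<delta> p S i"
    "is_shape (\<lambda>x. part (conjugate \<delta>) x + col_content S (p - i) x)"
    using c S unfolding LR_conj_iff conj_chain_def by simp_all
qed

lemma rot_strip:
  assumes U: "U \<in> LR_rot lam \<delta> \<mu>" and "i < p" "1 \<le> a"
  shows "part \<delta> (Suc a) + row_content U (Suc i) (Suc a) \<le> part \<delta> a + row_content U i a"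
  using strip_of_cols[of p M U "part \<delta>" a "Suc i"] U assms(2,3) unfolding LR_rot_iff by simp

lemma rot_chain_insert:
  assumes U: "U \<in> LR_rot lam \<delta> \<mu>" and i: "i \<le> p"
  shows "shape (insert_chain (\<lambda>k. restrict_tab U {b. fst b = k}) (H_tab \<delta>) i) = rot_chain \<delta> U i"
    and "is_shape (\<lambda>a. part \<delta> a + row_content U i a)"
proof -
  have anti: "anti_std p M U" using U LR_rot_iff by blast
  note box = anti_std_box[OF anti]
  note c = insert_chain_rows[OF box anti_std_strict[OF anti] \<delta> rot_strip[OF U] i]
  show "shape (insert_chain (\<lambda>k. restrict_tab U {b. fst b = k}) (H_tab \<delta>) i) = rot_chain \<delta> U i"
    "is_shape (\<lambda>a. part \<delta> a + row_content U i a)"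
    using c unfolding rot_chain_def by simp_all
qed

lemma strip_chain_rot:
  assumes U: "U \<in> LR_rot lam \<delta> \<mu>"
  shows "strip_chain p (rot_chain \<delta> U)"
proof
  have anti: "anti_std p M U" using U LR_rot_iff by blast
  note box = anti_std_box[OF anti]
  show "finite (rot_chain \<delta> U i)" if "i \<le> p" for i
    unfolding rot_chain_def using finite_young_is_shape rot_chain_insert(2)[OF U that] by blast
  show "1 \<le> a \<and> 1 \<le> y" if "(a, y) \<in> rot_chain \<delta> U i" for i a y
    using that by (simp add: rot_chain_def young_def)
  show "(a', y') \<in> rot_chain \<delta> U i"
    if "i \<le> p" "(a, y) \<in> rot_chain \<delta> U i" "1 \<le> a'" "a' \<le> a" "1 \<le> y'" "y' \<le> y" for i a y a' y'
    using decr_antimono[OF is_shape_decr[OF rot_chain_insert(2)[OF U that(1)]] that(3,4)] that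
    by (auto simp: rot_chain_def young_def)
  show "rot_chain \<delta> U i \<subseteq> rot_chain \<delta> U (Suc i)" if "i < p" for i
    using row_content_Suc[OF box, of _ i] by (auto simp: rot_chain_def young_def)
  show "(a, y) \<in> rot_chain \<delta> U i" if "i < p" "1 \<le> a" "(Suc a, y) \<in> rot_chain \<delta> U (Suc i)" for i a y
    using rot_strip[OF U that(1,2)] that by (auto simp: rot_chain_def young_def)
qed

lemma strip_chain_conj:
  assumes S: "S \<in> LR_conj lam \<delta> \<mu>"
  shows "strip_chain p (conj_chain \<delta> p S)"
proof
  have std: "normal_std M p S" using S LR_conj_iff by blast
  then have box: "in_box S M p" by (simp add: normal_std_def)
  have cc: "col_content S (p - Suc i) x = col_content S (p - i) x + card {l. S (l, p - i) = x}"
    if "i < p" "1 \<le> x" for i x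
  proof -
    have "Suc (p - Suc i) = p - i" using that by simp
    then show ?thesis using col_content_Suc[OF box that(2), of "p - Suc i"] by simp
  qed
  have one: "card {l. S (l, c) = x} \<le> 1" if "1 \<le> x" for c x
  proof -
    have uniq: "l = l'" if "S (l, c) = x" "S (l', c) = x" for l l'
    proof -
      have nz: "S (l, c) \<noteq> 0" "S (l', c) \<noteq> 0" using that \<open>1 \<le> x\<close> by auto
      have "1 \<le> l" "1 \<le> l'" using in_boxD[OF box nz(1)] in_boxD[OF box nz(2)] by auto
      then have "\<not> l < l'" "\<not> l' < l" using std nz that unfolding normal_std_def by (metis less_irrefl)+
      then show ?thesis by simp
    qed
    have "finite {l. S (l, c) = x}"
      by (rule finite_subset[OF _ finite_col_entries[OF box that, of c]]) auto
    then show ?thesis using uniq by (auto simp: card_le_Suc0_iff_eq)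
  qed
  show "finite (conj_chain \<delta> p S i)" if "i \<le> p" for i
    unfolding conj_chain_def using finite_young_is_shape conj_chain_insert(2)[OF S that] by simp
  show "1 \<le> a \<and> 1 \<le> y" if "(a, y) \<in> conj_chain \<delta> p S i" for i a y
    using that by (simp add: conj_chain_def young_def)
  show "(a', y') \<in> conj_chain \<delta> p S i"
    if "i \<le> p" "(a, y) \<in> conj_chain \<delta> p S i" "1 \<le> a'" "a' \<le> a" "1 \<le> y'" "y' \<le> y" for i a y a' y'
    using decr_antimono[OF is_shape_decr[OF conj_chain_insert(2)[OF S that(1)]] that(5,6)] that
    by (auto simp: conj_chain_def young_def)
  show "conj_chain \<delta> p S i \<subseteq> conj_chain \<delta> p S (Suc i)" if "i < p" for i
    using cc[OF that] by (auto simp: conj_chain_def young_def)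
  show "(a, y) \<in> conj_chain \<delta> p S i" if "i < p" "1 \<le> a" "(Suc a, y) \<in> conj_chain \<delta> p S (Suc i)" for i a y
    using cc[OF that(1), of y] one[of y "p - i"] that by (auto simp: conj_chain_def young_def)
qed

lemma conj_chain_0:
  assumes "S \<in> LR_conj lam \<delta> \<mu>" shows "conj_chain \<delta> p S 0 = young (part \<delta>)"
proof -
  have box: "in_box S M p" using assms unfolding LR_conj_iff normal_std_def by blast
  have "young (\<lambda>x. part (conjugate \<delta>) x + col_content S (p - 0) x) = young (part (conjugate \<delta>))"
    unfolding young_eq_iff using col_content_0[OF box] by simp
  then show ?thesis using young_conjugate[OF \<delta>] by (simp add: conj_chain_def)
qed

lemma rot_chain_0:
  assumes "U \<in> LR_rot lam \<delta> \<mu>" shows "rot_chain \<delta> U 0 = young (part \<delta>)"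
proof -
  have box: "in_box U p M" using assms unfolding LR_rot_iff anti_std_def by blast
  then show ?thesis unfolding rot_chain_def young_eq_iff using row_content_0[OF box] by simp
qed

lemma conj_chain_p:
  assumes "S \<in> LR_conj lam \<delta> \<mu>" shows "conj_chain \<delta> p S p = young (part lam)"
proof -
  have "young (\<lambda>x. part (conjugate \<delta>) x + col_content S (p - p) x) = young (part (conjugate lam))"
    unfolding young_eq_iff using assms unfolding LR_conj_iff by simp
  then show ?thesis using young_conjugate[OF lam] by (simp add: conj_chain_def)
qed

lemma rot_chain_p:
  assumes "U \<in> LR_rot lam \<delta> \<mu>" shows "rot_chain \<delta> U p = young (part lam)"
proof -
  have box: "in_box U p M" using assms unfolding LR_rot_iff anti_std_def by blast
  then show ?thesis unfolding rot_chain_def young_eq_iff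
    using row_content_all[OF box] assms unfolding LR_rot_iff by simp
qed

definition matched :: "tableau \<Rightarrow> tableau \<Rightarrow> bool" where
  "matched S U \<longleftrightarrow> (\<forall>i\<le>p. rot_chain \<delta> U i = conj_chain \<delta> p S i)"

text \<open>Rebuild \<open>U\<close> from the strips of \<open>S\<close>; it is semistandard because the two lattice conditions on the
  strips agree.\<close>

lemma ex_matched_rot:
  assumes S: "S \<in> LR_conj lam \<delta> \<mu>" shows "\<exists>U\<in>LR_rot lam \<delta> \<mu>. matched S U"
proof -
  interpret strip_chain p "conj_chain \<delta> p S" by (rule strip_chain_conj[OF S])
  have std: "normal_std M p S" and sh: "shape S = diagram (conjugate \<mu>)" using S LR_conj_iff by auto
  have crep: "cols_rep S" by (rule cols_rep_recorded(1)[OF std conj_chain_def])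
  have tl: tail_lattice using head_lattice_of_cols[OF std crep] head_lattice_iff_tail_lattice by simp
  have size: "card (D k) = part \<mu> (p + 1 - k)" if k: "1 \<le> k" "k \<le> p" for k
  proof -
    have c: "1 \<le> p + 1 - k" "p + 1 - k \<le> p" "p + 1 - (p + 1 - k) = k" using k by auto
    show ?thesis
    proof (rule nat_eq_if_le_iff)
      fix l :: nat assume that: "1 \<le> l"
      show "l \<le> card (D k) \<longleftrightarrow> l \<le> part \<mu> (p + 1 - k)"
        using cols_rep_shape[OF crep c(1,2) that] diagram_conjugate_iff[OF \<mu>, of l "p + 1 - k"]
          shape_iff[of "(l, p + 1 - k)" S] sh c that by simp
    qed
  qed
  have bound: "tail k 1 \<le> M" if "1 \<le> k" "k \<le> p" for k
    using tail_1[of k] size[of k] that part_antimono[OF \<mu>, of 1 "p + 1 - k"] by simp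
  let ?U = "rows_of M"
  have anti: "anti_std p M ?U" by (rule anti_std_rows_of[OF tl])
  have box: "in_box ?U p M" using anti by (simp add: anti_std_def)
  have rec: "conj_chain \<delta> p S i = rot_chain \<delta> ?U i" if "i \<le> p" for i
    unfolding rot_chain_def by (rule rows_of_recorded[OF bound conj_chain_0[OF S] that])
  have "shape ?U = rot_diagram \<mu>"
  proof (rule set_eqI, clarify)
    fix k j
    show "(k, j) \<in> shape ?U \<longleftrightarrow> (k, j) \<in> rot_diagram \<mu>"
    proof (cases "1 \<le> k \<and> k \<le> p \<and> 1 \<le> j \<and> j \<le> M")
      case True
      then show ?thesis using rows_rep_shape[OF rows_rep_rows_of, of k j M] size[of k]
        by (simp add: shape_iff rot_diagram_iff[OF \<mu>])
    next
      case False
      then show ?thesis using in_boxD[OF box, of k j] by (auto simp: shape_iff rot_diagram_iff[OF \<mu>])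
    qed
  qed
  moreover have "decr (\<lambda>a. part \<delta> a + col_content ?U c a)" for c
  proof (rule cols_of_strip[OF anti is_shape_decr[OF is_shape_part[OF \<delta>]]])
    fix i a assume i: "i < p" and a: "(1::nat) \<le> a"
    have Y: "conj_chain \<delta> p S k = young (\<lambda>a. part \<delta> a + row_content ?U k a)" if "k \<le> p" for k
      using rec[OF that] by (simp add: rot_chain_def)
    show "part \<delta> (Suc a) + row_content ?U (Suc i) (Suc a) \<le> part \<delta> a + row_content ?U i a"
      using rowlen_strip[OF i a] rowlen_recorded[OF _ Y, of "Suc i" "Suc a"]
        rowlen_recorded[OF _ Y, of i a] i a by simp
  qed
  moreover have "part lam a = part \<delta> a + col_content ?U 0 a" if a: "1 \<le> a" for a
  proof -
    have "young (part lam) = young (\<lambda>a. part \<delta> a + row_content ?U p a)"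
      using rec[of p] conj_chain_p[OF S] by (simp add: rot_chain_def)
    then show ?thesis using row_content_all[OF box a] a unfolding young_eq_iff by simp
  qed
  ultimately have "?U \<in> LR_rot lam \<delta> \<mu>" unfolding LR_rot_iff using anti by blast
  then show ?thesis using rec by (auto simp: matched_def)
qed

lemma ex_matched_conj:
  assumes U: "U \<in> LR_rot lam \<delta> \<mu>" shows "\<exists>S\<in>LR_conj lam \<delta> \<mu>. matched S U"
proof -
  interpret strip_chain p "rot_chain \<delta> U" by (rule strip_chain_rot[OF U])
  have anti: "anti_std p M U" and sh: "shape U = rot_diagram \<mu>" using U LR_rot_iff by auto
  note rrep = rows_rep_recorded[OF anti rot_chain_def]
  note bound = rrep(3)
  have tl: tail_lattice by (rule tail_lattice_of_rows[OF anti rrep(1) bound])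
  then have hl: head_lattice using head_lattice_iff_tail_lattice by simp
  have size: "card (D k) = part \<mu> (p + 1 - k)" if k: "1 \<le> k" "k \<le> p" for k
  proof -
    have M: "card (D k) \<le> M" using bound[OF k] tail_1[OF k(2)] by simp
    have M': "part \<mu> (p + 1 - k) \<le> M" using part_antimono[OF \<mu>, of 1 "p + 1 - k"] k by simp
    have "l \<le> card (D k) \<longleftrightarrow> l \<le> part \<mu> (p + 1 - k)" if l: "1 \<le> l" "l \<le> M" for l
    proof -
      have j: "1 \<le> M + 1 - l" "M + 1 - l \<le> M" "M + 1 - (M + 1 - l) = l" using l by auto
      have "U (k, M + 1 - l) \<noteq> 0 \<longleftrightarrow> l \<le> card (D k)"
        using rows_rep_shape[OF rrep(1) k j(1,2)] j(3) by simp
      moreover have "U (k, M + 1 - l) \<noteq> 0 \<longleftrightarrow> l \<le> part \<mu> (p + 1 - k)"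
        using rot_diagram_iff[OF \<mu>, of k "M + 1 - l"] shape_iff[of "(k, M + 1 - l)" U] sh k j by simp
      ultimately show ?thesis by simp
    qed
    from this[of "card (D k)"] this[of "part \<mu> (p + 1 - k)"] show ?thesis using M M'
      by (cases "card (D k) = 0"; cases "part \<mu> (p + 1 - k) = 0") auto
  qed
  let ?S = cols_of
  have "card (D k) \<le> M" if "k \<le> p" for k
  proof (cases "k = 0")
    case False
    then show ?thesis using bound[of k] tail_1[OF that] that by simp
  qed (simp add: D_def)
  then have std: "normal_std M p ?S" by (rule normal_std_cols_of[OF hl])
  then have box: "in_box ?S M p" by (simp add: normal_std_def)
  have Y0: "rot_chain \<delta> U 0 = converse (young (part (conjugate \<delta>)))"
    using rot_chain_0[OF U] young_conjugate[OF \<delta>] by simp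
  have rec: "rot_chain \<delta> U i = conj_chain \<delta> p ?S i" if "i \<le> p" for i
    unfolding conj_chain_def by (rule cols_of_recorded[OF box Y0 that])
  have "shape ?S = diagram (conjugate \<mu>)"
  proof (rule set_eqI, clarify)
    fix l c
    show "(l, c) \<in> shape ?S \<longleftrightarrow> (l, c) \<in> diagram (conjugate \<mu>)"
    proof (cases "1 \<le> c \<and> c \<le> p \<and> 1 \<le> l")
      case True
      then have "1 \<le> p + 1 - c" "p + 1 - c \<le> p" "p + 1 - (p + 1 - c) = c" by auto
      then have "card (D (p + 1 - c)) = part \<mu> c" using size[of "p + 1 - c"] by metis
      then show ?thesis using cols_rep_shape[OF cols_rep_cols_of, of c l] True
        by (simp add: shape_iff diagram_conjugate_iff[OF \<mu>])
    next
      case False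
      then have "(l, c) \<notin> diagram (conjugate \<mu>)" using diagram_conjugate_box[OF \<mu>] by auto
      moreover have "(l, c) \<notin> shape ?S" using in_boxD[OF box, of l c] False by (auto simp: shape_iff)
      ultimately show ?thesis by simp
    qed
  qed
  moreover have "decr (\<lambda>x. part (conjugate \<delta>) x + col_content ?S c x)" for c
  proof (cases "c \<le> p")
    case True
    then have pc: "p - (p - c) = c" "p - c \<le> p" by simp_all
    show ?thesis
      using decr_collen[OF pc(2)] collen_recorded[OF pc(2) rec[OF pc(2), unfolded conj_chain_def]]
      unfolding pc(1) by (subst decr_cong[of _ "collen (p - c)"]) auto
  next
    case False
    then show ?thesis using is_shape_decr[OF is_shape_part[OF is_partition_conjugate[OF \<delta>]]]
        col_content_0[OF box] by (subst decr_cong[of _ "part (conjugate \<delta>)"]) auto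
  qed
  moreover have "part (conjugate lam) x = part (conjugate \<delta>) x + col_content ?S 0 x" if x: "1 \<le> x" for x
  proof -
    have "converse (young (\<lambda>x. part (conjugate \<delta>) x + col_content ?S 0 x)) = young (part lam)"
      using rec[of p] rot_chain_p[OF U] by (simp add: conj_chain_def)
    then have "young (\<lambda>x. part (conjugate \<delta>) x + col_content ?S 0 x) = young (part (conjugate lam))"
      using young_conjugate[OF lam] by (metis converse_converse)
    then show ?thesis using x unfolding young_eq_iff by simp
  qed
  ultimately have "?S \<in> LR_conj lam \<delta> \<mu>" unfolding LR_conj_iff using std by blast
  then show ?thesis using rec by (auto simp: matched_def)
qed

lemma matched_rot_unique:
  assumes S: "S \<in> LR_conj lam \<delta> \<mu>"
    and U: "U \<in> LR_rot lam \<delta> \<mu>" "matched S U" and U': "U' \<in> LR_rot lam \<delta> \<mu>" "matched S U'"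
  shows "U = U'"
proof -
  interpret strip_chain p "conj_chain \<delta> p S" by (rule strip_chain_conj[OF S])
  have "rows_rep M V" if "V \<in> LR_rot lam \<delta> \<mu>" "matched S V" for V
    using that rows_rep_recorded(1)[of M V "part \<delta>"]
    unfolding LR_rot_iff matched_def rot_chain_def by metis
  then show ?thesis using rows_rep_unique U U' by blast
qed

lemma matched_conj_unique:
  assumes U: "U \<in> LR_rot lam \<delta> \<mu>"
    and S: "S \<in> LR_conj lam \<delta> \<mu>" "matched S U" and S': "S' \<in> LR_conj lam \<delta> \<mu>" "matched S' U"
  shows "S = S'"
proof -
  interpret strip_chain p "rot_chain \<delta> U" by (rule strip_chain_rot[OF U])
  have "cols_rep V" if "V \<in> LR_conj lam \<delta> \<mu>" "matched V U" for V
    using that cols_rep_recorded(1)[of M V "part (conjugate \<delta>)"]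
    unfolding LR_conj_iff matched_def conj_chain_def by metis
  then show ?thesis using cols_rep_unique S S' by blast
qed

text \<open>Matched tableaux describe the same strips, so their entries supply the data for
  \<open>over_iff_under\<close>.\<close>

lemma over_iff_under_of_matched:
  fixes n :: nat
  assumes S: "S \<in> LR_conj lam \<delta> \<mu>" and U: "U \<in> LR_rot lam \<delta> \<mu>" and SU: "matched S U"
    and n: "length lam \<le> n" "part (conjugate \<mu>) 1 + part (conjugate \<mu>) 2 \<le> n"
  shows "S \<in> LR_over n lam \<delta> \<mu> \<longleftrightarrow> U \<in> LR_under n lam \<delta> \<mu>"
proof -
  interpret strip_chain p "rot_chain \<delta> U" by (rule strip_chain_rot[OF U])
  define q where "q = part (conjugate \<mu>) 2"
  have p: "part (conjugate \<mu>) 1 = p" by (rule part_conjugate_1[OF \<mu>])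
  have q: "j \<le> q \<longleftrightarrow> 2 \<le> part \<mu> j" if "1 \<le> j" for j
    using le_parts_ge_iff[of \<mu> j 2] part_conjugate[OF \<mu>, of 2] \<mu> that by (simp add: q_def is_partition_def)
  have qp: "q \<le> p"
    using part_conjugate[OF \<mu>, of 2] by (simp add: q_def parts_ge_def)
  have anti: "anti_std p M U" and shU: "shape U = rot_diagram \<mu>" using U LR_rot_iff by auto
  have std: "normal_std M p S" and shS: "shape S = diagram (conjugate \<mu>)" using S LR_conj_iff by auto
  note rrep = rows_rep_recorded[OF anti rot_chain_def]
  have crep: "cols_rep S"
    by (rule cols_rep_recorded(1)[OF std]) (use SU in \<open>simp add: matched_def conj_chain_def\<close>)
  have hl: head_lattice by (rule head_lattice_of_cols[OF std crep])
  note bound = rrep(3)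
  have S_nz: "S (l, c) \<noteq> 0 \<longleftrightarrow> 1 \<le> c \<and> 1 \<le> l \<and> l \<le> part \<mu> c" for l c
    using diagram_conjugate_iff[OF \<mu>, of l c] shape_iff[of "(l, c)" S] shS by simp
  note incr = chain_mono[where p = p and E = "rot_chain \<delta> U", OF sub_Y]
  let ?u = "\<lambda>l i. U (p + 1 - i, M + 1 - l)"
  have entry: "?u l i \<ge> 1" "?u l i \<le> n" "part \<delta> (?u l i) < S (l, i)"
    if h: "1 \<le> i" "i \<le> p" "1 \<le> l" "l \<le> part \<mu> i" for l i
  proof -
    have k: "1 \<le> p + 1 - i" "p + 1 - i \<le> p" "p + 1 - (p + 1 - i) = i" using h by auto
    have "S (l, i) \<noteq> 0" using S_nz h by simp
    then have box: "(?u l i, S (l, i)) \<in> D (p + 1 - i)"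
      using box_of_entries(1)[OF rrep(1) crep k(1,2) bound[OF k(1,2)], of l] k(3) by simp
    then have "(?u l i, S (l, i)) \<in> rot_chain \<delta> U p" using incr[of "p + 1 - i" p] k D_iff by blast
    then have inside: "(?u l i, S (l, i)) \<in> young (part lam)" using rot_chain_p[OF U] by simp
    then have "1 \<le> part lam (?u l i)" by (auto simp: young_def)
    then have "?u l i \<le> length lam" using part_pos_iff[OF lam] by blast
    then show "?u l i \<le> n" using n by simp
    show "?u l i \<ge> 1" using inside by (auto simp: young_def)
    have "(?u l i, S (l, i)) \<notin> rot_chain \<delta> U 0"
      using box incr[of 0 "p + 1 - i - 1"] k by (auto simp: D_iff)
    then show "part \<delta> (?u l i) < S (l, i)"
      unfolding rot_chain_0[OF U] using inside by (auto simp: young_def)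
  qed
  have above: "\<exists>i' l'. i < i' \<and> i' \<le> p \<and> 1 \<le> l' \<and> l' \<le> l \<and> l' \<le> part \<mu> i' \<and> ?u l' i' = R"
    if h: "1 \<le> i" "i \<le> p" "1 \<le> l" "l \<le> part \<mu> i" and R: "1 \<le> R" "R < ?u l i" "part \<delta> R < S (l, i)" for l i R
  proof -
    have k: "1 \<le> p + 1 - i" "p + 1 - i \<le> p" "p + 1 - (p + 1 - i) = i" using h by auto
    have nz: "S (l, p + 1 - (p + 1 - i)) \<noteq> 0" using S_nz h k by simp
    have "(R, S (l, p + 1 - (p + 1 - i))) \<notin> rot_chain \<delta> U 0"
      unfolding rot_chain_0[OF U] k(3) using R by (simp add: young_def)
    then obtain k' l' where kl: "1 \<le> k'" "k' < p + 1 - i" "1 \<le> l'" "l' \<le> l"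
        "S (l', p + 1 - k') \<noteq> 0" "U (k', M + 1 - l') = R"
      using box_above_entry[OF rrep(1) crep hl bound k(1,2) nz R(1,2)] by auto
    have "p + 1 - (p + 1 - k') = k'" using kl k by simp
    then show ?thesis using kl S_nz[of l' "p + 1 - k'"]
      by (intro exI[of _ "p + 1 - k'"] exI[of _ l']) auto
  qed
  have one: "1 \<le> part \<mu> i" if "1 \<le> i" "i \<le> p" for i using part_pos_iff[OF \<mu>] that by blast
  interpret index_data n p q "part \<delta>" "\<lambda>i. U (p + 1 - i, M)" "\<lambda>j. U (p + 1 - j, M - 1)"
    "\<lambda>i. S (1, i)" "\<lambda>j. S (2, j)"
  proof
    show "p + q \<le> n" "q \<le> p" using n p qp by (simp_all add: q_def)
    show "part \<delta> b \<le> part \<delta> a" if "1 \<le> a" "a \<le> b" for a b using part_antimono[OF \<delta> that] .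
    show "1 \<le> U (p + 1 - i, M) \<and> U (p + 1 - i, M) \<le> n" if "1 \<le> i" "i \<le> p" for i
      using entry(1,2)[OF that, of 1] one[OF that] by simp
    show "U (p + 1 - Suc i, M) < U (p + 1 - i, M)" if i: "1 \<le> i" "i < p" for i
    proof -
      have "1 \<le> U (p + 1 - Suc i, M)" using entry(1)[of "Suc i" 1] one[of "Suc i"] i by simp
      then have "U (p + 1 - Suc i, M) \<noteq> 0" "p + 1 - Suc i < p + 1 - i" "p + 1 - i \<le> p" using i by auto
      then show ?thesis by (rule anti_std_col[OF anti])
    qed
    show "1 \<le> U (p + 1 - j, M - 1)" if "1 \<le> j" "j \<le> q" for j
      using entry(1)[of j 2] q[OF that(1)] that qp by simp
    show "part \<delta> (U (p + 1 - i, M)) < S (1, i)" if "1 \<le> i" "i \<le> p" for i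
      using entry(3)[OF that, of 1] one[OF that] by simp
    show "part \<delta> (U (p + 1 - j, M - 1)) < S (2, j)" if "1 \<le> j" "j \<le> q" for j
      using entry(3)[of j 2] q[OF that(1)] that qp by simp
    show "\<exists>i'>i. i' \<le> p \<and> U (p + 1 - i', M) = R"
      if "1 \<le> i" "i \<le> p" "1 \<le> R" "R < U (p + 1 - i, M)" "part \<delta> R < S (1, i)" for i R
    proof -
      have "R < ?u 1 i" using that by simp
      from above[OF that(1,2) order_refl one[OF that(1,2)] that(3) this that(5)]
      obtain i' l' where i': "i < i'" "i' \<le> p" "1 \<le> l'" "l' \<le> 1" "?u l' i' = R" by blast
      then have "l' = 1" by simp
      then show ?thesis using i' by auto
    qed
    show "\<exists>i'>j. i' \<le> p \<and> (U (p + 1 - i', M) = R \<or> i' \<le> q \<and> U (p + 1 - i', M - 1) = R)"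
      if "1 \<le> j" "j \<le> q" "1 \<le> R" "R < U (p + 1 - j, M - 1)" "part \<delta> R < S (2, j)" for j R
    proof -
      have j: "j \<le> p" "1 \<le> (2 :: nat)" "2 \<le> part \<mu> j" using that q[of j] qp by auto
      have "R < ?u 2 j" using that by simp
      from above[OF that(1) j that(3) this that(5)]
      obtain i' l' where i': "j < i'" "i' \<le> p" "1 \<le> l'" "l' \<le> 2" "l' \<le> part \<mu> i'" "?u l' i' = R"
        by blast
      show ?thesis
      proof (cases "l' = 1")
        case True
        then show ?thesis using i' by auto
      next
        case False
        then have "l' = 2" using i' by simp
        then show ?thesis using i' q[of i'] by (intro exI[of _ i']) simp
      qed
    qed
  qed
  have over: "m_over n p \<delta> S i = m i" if "1 \<le> i" "i \<le> p" for i
    using that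
  proof (induction "p - i" arbitrary: i rule: less_induct)
    case less
    have "m_over n p \<delta> S ` {i + 1..p} = m ` {i + 1..p}"
      using less by (intro image_cong) auto
    then show ?case using Max_m[of i] less.prems
      by (subst m_over.simps) (simp add: rev_part_def)
  qed
  have under: "m_under n p \<mu> U = m" by (rule ext) (unfold m_under_def m_def, rule refl)
  have idx: "n_index n p (m_over n p \<delta> S) j = n_index n p m j" for j
  proof -
    have "m_over n p \<delta> S ` {j + 1..p} = m ` {j + 1..p}" using over by (intro image_cong) auto
    then show ?thesis by (simp add: n_index_def)
  qed
  have "S \<in> LR_over n lam \<delta> \<mu> \<longleftrightarrow>
      (\<forall>j\<in>{1..q}. S (2, j) > rev_part n \<delta> (n_index n p (m_over n p \<delta> S) j))"
    using S unfolding LR_over_def Let_def p q_def[symmetric] by blast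
  also have "\<dots> \<longleftrightarrow> (\<forall>j\<in>{1..q}. U (p + 1 - j, M - 1) + n_index n p m j \<le> n + 1)"
    unfolding idx rev_part_def by (rule over_iff_under)
  also have "\<dots> \<longleftrightarrow> U \<in> LR_under n lam \<delta> \<mu>"
    using U unfolding LR_under_def Let_def p q_def[symmetric] under[symmetric] by blast
  finally show ?thesis .
qed

lemma Q_eq_iff_matched:
  assumes S: "S \<in> LR_conj lam \<delta> \<mu>" and U: "U \<in> LR_rot lam \<delta> \<mu>"
  shows "Q_rot \<delta> \<mu> U = Q_conj \<delta> \<mu> S \<longleftrightarrow> matched S U"
proof -
  interpret SC: strip_chain p "conj_chain \<delta> p S" by (rule strip_chain_conj[OF S])
  interpret UC: strip_chain p "rot_chain \<delta> U" by (rule strip_chain_rot[OF U])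
  have "Q_rot \<delta> \<mu> U = recording p (rot_chain \<delta> U)"
    unfolding Q_rot_def Let_def part_conjugate_1[OF \<mu>]
    by (rule recording_cong) (use rot_chain_insert(1)[OF U] in blast)
  moreover have "Q_conj \<delta> \<mu> S = recording p (conj_chain \<delta> p S)"
    unfolding Q_conj_def Let_def part_conjugate_1[OF \<mu>]
    by (rule recording_cong) (use conj_chain_insert(1)[OF S] in blast)
  moreover have "rot_chain \<delta> U 0 = conj_chain \<delta> p S 0"
    using rot_chain_0[OF U] conj_chain_0[OF S] by simp
  ultimately show ?thesis
    using recording_inject[where p = p and E = "rot_chain \<delta> U" and F = "conj_chain \<delta> p S", OF UC.sub_Y SC.sub_Y] by (simp add: matched_def)
qed

lemma psi_matched:
  assumes S: "S \<in> LR_conj lam \<delta> \<mu>"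
  shows "psi lam \<delta> \<mu> S \<in> LR_rot lam \<delta> \<mu>" "matched S (psi lam \<delta> \<mu> S)"
proof -
  obtain U where U: "U \<in> LR_rot lam \<delta> \<mu>" "matched S U" using ex_matched_rot[OF S] by blast
  have "psi lam \<delta> \<mu> S = U"
    unfolding psi_def
    by (rule the_equality) (use U Q_eq_iff_matched[OF S] matched_rot_unique[OF S] in blast)+
  then show "psi lam \<delta> \<mu> S \<in> LR_rot lam \<delta> \<mu>" "matched S (psi lam \<delta> \<mu> S)" using U by auto
qed

lemma bij_betw_psi: "bij_betw (psi lam \<delta> \<mu>) (LR_conj lam \<delta> \<mu>) (LR_rot lam \<delta> \<mu>)"
  unfolding bij_betw_def
proof
  show "inj_on (psi lam \<delta> \<mu>) (LR_conj lam \<delta> \<mu>)"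
    using psi_matched matched_conj_unique by (metis inj_onI)
  show "psi lam \<delta> \<mu> ` LR_conj lam \<delta> \<mu> = LR_rot lam \<delta> \<mu>"
  proof
    show "psi lam \<delta> \<mu> ` LR_conj lam \<delta> \<mu> \<subseteq> LR_rot lam \<delta> \<mu>" using psi_matched by blast
    show "LR_rot lam \<delta> \<mu> \<subseteq> psi lam \<delta> \<mu> ` LR_conj lam \<delta> \<mu>"
    proof
      fix U assume U: "U \<in> LR_rot lam \<delta> \<mu>"
      obtain S where S: "S \<in> LR_conj lam \<delta> \<mu>" "matched S U" using ex_matched_conj[OF U] by blast
      then have "U = psi lam \<delta> \<mu> S" using matched_rot_unique[OF S(1) U S(2)] psi_matched[OF S(1)] by blast
      then show "U \<in> psi lam \<delta> \<mu> ` LR_conj lam \<delta> \<mu>" using S by blast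
    qed
  qed
qed

end

theorem theorem4p9:
  fixes n :: nat and \<mu> lam \<delta> :: "nat list"
  assumes "n \<ge> 1"
    and "is_partition \<mu>" and "length \<mu> \<le> n"
    and "part (conjugate \<mu>) 1 + part (conjugate \<mu>) 2 \<le> n"
    and "is_partition lam" and "length lam \<le> n"
    and "is_partition \<delta>" and "length \<delta> \<le> n" and "\<forall>x\<in>set \<delta>. even x"
  shows "bij_betw (psi lam \<delta> \<mu>) (LR_conj lam \<delta> \<mu>) (LR_rot lam \<delta> \<mu>)
    \<and> bij_betw (psi lam \<delta> \<mu>) (LR_over n lam \<delta> \<mu>) (LR_under n lam \<delta> \<mu>)"
proof
  interpret LR_data \<mu> lam \<delta> by unfold_locales fact+
  show bij: "bij_betw (psi lam \<delta> \<mu>) (LR_conj lam \<delta> \<mu>) (LR_rot lam \<delta> \<mu>)" by (rule bij_betw_psi)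
  have iff: "S \<in> LR_over n lam \<delta> \<mu> \<longleftrightarrow> psi lam \<delta> \<mu> S \<in> LR_under n lam \<delta> \<mu>" if "S \<in> LR_conj lam \<delta> \<mu>" for S
    using over_iff_under_of_matched[OF that psi_matched[OF that]] assms(4,6) by blast
  have "LR_over n lam \<delta> \<mu> = {S \<in> LR_conj lam \<delta> \<mu>. S \<in> LR_over n lam \<delta> \<mu>}"
    "LR_under n lam \<delta> \<mu> = {U \<in> LR_rot lam \<delta> \<mu>. U \<in> LR_under n lam \<delta> \<mu>}"
    by (auto simp: LR_over_def LR_under_def)
  then show "bij_betw (psi lam \<delta> \<mu>) (LR_over n lam \<delta> \<mu>) (LR_under n lam \<delta> \<mu>)"
    using bij_betw_Collect[OF bij, of "\<lambda>U. U \<in> LR_under n lam \<delta> \<mu>" "\<lambda>S. S \<in> LR_over n lam \<delta> \<mu>"] iff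
    by simp
qed

end
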